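(* Let $(\tilde W,\tilde S)$ be the hyperbolic cover of an extended Weyl system (of domestic, wild or tubular type), with set of reflections $\tilde T$, and let $\tilde c\in\tilde W$ be a Coxeter transformation. Then the Hurwitz action is transitive on the set $\mathrm{Red}_{\tilde T}(\tilde c)$ of reduced reflection factorizations of $\tilde c$, i.e. on the set of all tuples $(t_1,\ldots,t_m)\in\tilde T^m$ with $t_1\cdots t_m=\tilde c$, where $m=\ell_{\tilde T}(\tilde c)$ is the minimal number of factors from $\tilde T$ needed to write $\tilde c$.
   Context: Extended Coxeter-Dynkin diagram: given integers $r\ge 0$ and $p_1,\ldots,p_r\ge 1$, the vertex set is $Q=\{1,1^*\}\cup\{(i,j)\mid 1\le i\le r,\ 1\le j\le p_i\}$. Single edges join $(i,j)$ and $(i,j+1)$ for $1\le j<p_i$, join $1$ and $(i,1)$, and join $1^*$ and $(i,1)$, for all $i$. The vertices $1$ and $1^*$ are joined by a dotted double bond. There are no other edges. Extended space: $V$ is the real vector space with basis $B=\{\alpha_\nu\mid \nu\in Q\}$ and symmetric bilinear form given by $(\alpha_\nu\mid\alpha_\nu)=2$, $(\alpha_1\mid\alpha_{1^*})=2$, $(\alpha_\nu\mid\alpha_\omega)=-1$ if $\nu,\omega$ are joined by a single edge, and $0$ otherwise. For $(\alpha\mid\alpha)\ne0$ put $s_\alpha(v)=v-\frac{2(\alpha\mid v)}{(\alpha\mid\alpha)}\alpha$. The extended Weyl system is $(W,S)$ with $S=\{s_\alpha\mid\alpha\in B\}$, $W=\langle S\rangle\le\mathrm{GL}(V)$. It is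 wild, tubular or domestic if the signature (positive, negative, zero) of the form is $(|B|-2,1,1)$, $(|B|-2,0,2)$ or $(|B|-1,0,1)$, respectively (these are all cases). Hyperbolic cover: put $a=\alpha_{1^*}-\alpha_1$, $\overline B=B\setminus\{\alpha_{1^*}\}$, $\overline V=\mathrm{span}_{\mathbb R}(\overline B)$. Domestic or wild type: $\tilde V=V\oplus\mathbb R a'$ with the form extended by $(\overline V\mid a')=0$, $(a\mid a')=1$, $(a'\mid a')=0$. Tubular type: here the diagram on $Q\setminus\{1^*\}$ is an affine Dynkin diagram of type $\tilde D_4,\tilde E_6,\tilde E_7$ or $\tilde E_8$ (that is, $(p_i)$ is, up to order, $(1,1,1,1)$, $(2,2,2)$, $(1,3,3)$ or $(1,2,5)$). Let $\alpha_0\in\overline B$ be the simple root at the end vertex of an arm of maximal length (the affine node), let $\tilde\alpha$ be the highest root of the finite root system (type $D_4,E_6,E_7,E_8$) with simple system $\overline B\setminus\{\alpha_0\}$, $V_{\mathrm{fin}}=\mathrm{span}_{\mathbb R}(\overline B\setminus\{\alpha_0\})$ and $b=\alpha_0+\tilde\alpha$. Then $V=V_{\mathrm{fin}}\oplus\mathbb Ra\oplus\mathbb Rb$ and $\mathbb Ra\oplus\mathbb Rb$ is the radical of the form. Put $\tilde V=V\oplus\mathbb Rb'$ with $(V_{\mathrm{fin}}\mid b')=0=(a\mid b')$, $(b\mid b')=1$, $(b'\mid b')=0$. In all cases let $\tilde s_\alpha$ be the reflection of $\tilde V$ with respect to $\alpha\in B\subset\tilde V$, $\tilde S=\{\tilde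 s_\alpha\mid\alpha\in B\}$, $\tilde W=\langle\tilde S\rangle\le\mathrm{GL}(\tilde V)$, $\tilde T=\bigcup_{w\in\tilde W}w\tilde Sw^{-1}$. Coxeter transformation in $\tilde W$: any element $\tilde c=\left(\prod_{\alpha\in B\setminus\{\alpha_1,\alpha_{1^*}\}}\tilde s_\alpha\right)\tilde s_{\alpha_1}\tilde s_{\alpha_{1^*}}$, the first $|B|-2$ factors in an arbitrary order. Hurwitz action: the braid group $\mathcal B_m$ with standard generators $\sigma_i$ acts on $\tilde T^m$ by $\sigma_i(g_1,\ldots,g_m)=(g_1,\ldots,g_{i-1},g_{i+1},g_{i+1}^{-1}g_ig_{i+1},g_{i+2},\ldots,g_m)$. *)

theory Defs
  imports
    "HOL-Analysis.Analysis"
    "HOL-Analysis.Finite_Function_Topology"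
    "HOL-Algebra.Group_Action"
    "HOL-Algebra.Generated_Groups"
begin

section \<open>Linear groups, reflections, Weyl groups\<close>

text \<open>
  Vector spaces are subspaces of an ambient real vector type.  Elements of \<open>GL U\<close> are
  extensional functions (\<open>undefined\<close> outside of \<open>U\<close>), as in \<^const>\<open>BijGroup\<close>.
\<close>

definition GL :: "'v::real_vector set \<Rightarrow> ('v \<Rightarrow> 'v) monoid" where
  "GL U = (BijGroup U)\<lparr>carrier :=
     {g \<in> Bij U. (\<forall>x\<in>U. \<forall>y\<in>U. g (x + y) = g x + g y) \<and> (\<forall>c. \<forall>x\<in>U. g (c *\<^sub>R x) = c *\<^sub>R g x)}\<rparr>"

definition reflection :: "('v::real_vector \<Rightarrow> 'v \<Rightarrow> real) \<Rightarrow> 'v set \<Rightarrow> 'v \<Rightarrow> 'v \<Rightarrow> 'v" where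
  "reflection f U \<alpha> = (\<lambda>v\<in>U. v - (2 * f \<alpha> v / f \<alpha> \<alpha>) *\<^sub>R \<alpha>)"

definition weyl_group ::
  "('v::real_vector \<Rightarrow> 'v \<Rightarrow> real) \<Rightarrow> 'v set \<Rightarrow> 'v set \<Rightarrow> ('v \<Rightarrow> 'v) monoid" where
  "weyl_group f U \<Delta> = subgroup_generated (GL U) (reflection f U ` \<Delta>)"

definition weyl_reflections ::
  "('v::real_vector \<Rightarrow> 'v \<Rightarrow> real) \<Rightarrow> 'v set \<Rightarrow> 'v set \<Rightarrow> ('v \<Rightarrow> 'v) set" where
  "weyl_reflections f U \<Delta> =
     (let W = weyl_group f U \<Delta> in
      \<Union>w\<in>carrier W. (\<lambda>s. w \<otimes>\<^bsub>W\<^esub> s \<otimes>\<^bsub>W\<^esub> inv\<^bsub>W\<^esub> w) ` (reflection f U ` \<Delta>))"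

definition root_system ::
  "('v::real_vector \<Rightarrow> 'v \<Rightarrow> real) \<Rightarrow> 'v set \<Rightarrow> 'v set \<Rightarrow> 'v set" where
  "root_system f U \<Delta> = {w \<alpha> | w \<alpha>. w \<in> carrier (weyl_group f U \<Delta>) \<and> \<alpha> \<in> \<Delta>}"

definition highest_root ::
  "('v::real_vector \<Rightarrow> 'v \<Rightarrow> real) \<Rightarrow> 'v set \<Rightarrow> 'v set \<Rightarrow> 'v \<Rightarrow> bool" where
  "highest_root f U \<Delta> \<theta> \<longleftrightarrow>
     \<theta> \<in> root_system f U \<Delta> \<and>
     (\<forall>\<beta>\<in>root_system f U \<Delta>. \<exists>k :: 'v \<Rightarrow> nat. \<theta> = \<beta> + (\<Sum>\<alpha>\<in>\<Delta>. real (k \<alpha>) *\<^sub>R \<alpha>))"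

definition has_signature ::
  "('v::real_vector \<Rightarrow> 'v \<Rightarrow> real) \<Rightarrow> 'v set \<Rightarrow> nat \<times> nat \<times> nat \<Rightarrow> bool" where
  "has_signature f U = (\<lambda>(pos, neg, zero).
     \<exists>E. finite E \<and> independent E \<and> span E = U \<and> pairwise (\<lambda>x y. f x y = 0) E \<and>
         card {e\<in>E. f e e > 0} = pos \<and> card {e\<in>E. f e e < 0} = neg \<and> card {e\<in>E. f e e = 0} = zero)"

section \<open>Extended Coxeter-Dynkin diagrams and extended spaces\<close>

text \<open>\<open>Hub\<close> and \<open>Hub_star\<close> are the vertices \<open>1\<close> and \<open>1\<^sup>*\<close>, joined by the dotted double bond.\<close>

datatype vertex = Hub | Hub_star | Arm nat nat

definition vertices :: "nat \<Rightarrow> (nat \<Rightarrow> nat) \<Rightarrow> vertex set" where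
  "vertices r p = {Hub, Hub_star} \<union> {Arm i j | i j. 1 \<le> i \<and> i \<le> r \<and> 1 \<le> j \<and> j \<le> p i}"

definition single_edges :: "nat \<Rightarrow> (nat \<Rightarrow> nat) \<Rightarrow> vertex set set" where
  "single_edges r p =
     {{Arm i j, Arm i (j + 1)} | i j. 1 \<le> i \<and> i \<le> r \<and> 1 \<le> j \<and> j < p i} \<union>
     {{Hub, Arm i 1} | i. 1 \<le> i \<and> i \<le> r} \<union>
     {{Hub_star, Arm i 1} | i. 1 \<le> i \<and> i \<le> r}"

definition gram :: "nat \<Rightarrow> (nat \<Rightarrow> nat) \<Rightarrow> vertex \<Rightarrow> vertex \<Rightarrow> real" where
  "gram r p \<nu> \<omega> =
     (if \<nu> = \<omega> \<or> {\<nu>, \<omega>} = {Hub, Hub_star} then 2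
      else if {\<nu>, \<omega>} \<in> single_edges r p then -1 else 0)"

definition simple_root :: "vertex \<Rightarrow> vertex \<Rightarrow>\<^sub>0 real" where
  "simple_root \<nu> = Poly_Mapping.single \<nu> 1"

definition ext_basis :: "nat \<Rightarrow> (nat \<Rightarrow> nat) \<Rightarrow> (vertex \<Rightarrow>\<^sub>0 real) set" where
  "ext_basis r p = simple_root ` vertices r p"

definition ext_space :: "nat \<Rightarrow> (nat \<Rightarrow> nat) \<Rightarrow> (vertex \<Rightarrow>\<^sub>0 real) set" where
  "ext_space r p = span (ext_basis r p)"

definition ext_form ::
  "nat \<Rightarrow> (nat \<Rightarrow> nat) \<Rightarrow> (vertex \<Rightarrow>\<^sub>0 real) \<Rightarrow> (vertex \<Rightarrow>\<^sub>0 real) \<Rightarrow> real" where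
  "ext_form r p v w =
     (\<Sum>\<nu>\<in>vertices r p. \<Sum>\<omega>\<in>vertices r p.
        Poly_Mapping.lookup v \<nu> * Poly_Mapping.lookup w \<omega> * gram r p \<nu> \<omega>)"

definition wild :: "nat \<Rightarrow> (nat \<Rightarrow> nat) \<Rightarrow> bool" where
  "wild r p \<longleftrightarrow> has_signature (ext_form r p) (ext_space r p) (card (ext_basis r p) - 2, 1, 1)"

definition tubular :: "nat \<Rightarrow> (nat \<Rightarrow> nat) \<Rightarrow> bool" where
  "tubular r p \<longleftrightarrow> has_signature (ext_form r p) (ext_space r p) (card (ext_basis r p) - 2, 0, 2)"

definition domestic :: "nat \<Rightarrow> (nat \<Rightarrow> nat) \<Rightarrow> bool" where
  "domestic r p \<longleftrightarrow> has_signature (ext_form r p) (ext_space r p) (card (ext_basis r p) - 1, 0, 1)"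

section \<open>The hyperbolic cover\<close>

definition bar_basis :: "nat \<Rightarrow> (nat \<Rightarrow> nat) \<Rightarrow> (vertex \<Rightarrow>\<^sub>0 real) set" where
  "bar_basis r p = ext_basis r p - {simple_root Hub_star}"

definition affine_node :: "nat \<Rightarrow> (nat \<Rightarrow> nat) \<Rightarrow> vertex \<Rightarrow> bool" where
  "affine_node r p \<nu> \<longleftrightarrow>
     (\<exists>i. 1 \<le> i \<and> i \<le> r \<and> \<nu> = Arm i (p i) \<and> (\<forall>k. 1 \<le> k \<and> k \<le> r \<longrightarrow> p k \<le> p i))"

type_synonym cover_vector = "(vertex \<Rightarrow>\<^sub>0 real) \<times> real"

text \<open>
  The cover space is the external direct sum of the extended space and a line: \<open>v\<close> is embedded
  as \<open>(v, 0)\<close>, and \<open>(0, 1)\<close> is the additional basis vector (\<open>a'\<close> or \<open>b'\<close>, depending on the type).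
\<close>

definition cover_space :: "nat \<Rightarrow> (nat \<Rightarrow> nat) \<Rightarrow> cover_vector set" where
  "cover_space r p = ext_space r p \<times> UNIV"

definition cover_basis :: "nat \<Rightarrow> (nat \<Rightarrow> nat) \<Rightarrow> cover_vector set" where
  "cover_basis r p = (\<lambda>\<alpha>. (\<alpha>, 0)) ` ext_basis r p"

text \<open>
  \<open>cover_form r p F\<close>: the form \<open>F\<close> is an admissible form on the cover space.  Its values there are
  determined by these conditions, up to the choice of the affine node in the tubular case; a
  bilinear form on the subspace always extends to the ambient type, and the values outside of the
  subspace are never used.
\<close>

definition cover_form ::
  "nat \<Rightarrow> (nat \<Rightarrow> nat) \<Rightarrow> (cover_vector \<Rightarrow> cover_vector \<Rightarrow> real) \<Rightarrow> bool" where
  "cover_form r p F \<longleftrightarrow>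
     bilinear F \<and> (\<forall>x y. F x y = F y x) \<and>
     (\<forall>v\<in>ext_space r p. \<forall>w\<in>ext_space r p. F (v, 0) (w, 0) = ext_form r p v w) \<and>
     (let a = simple_root Hub_star - simple_root Hub in
      if tubular r p then
        \<exists>\<nu> \<theta>. affine_node r p \<nu> \<and>
          (let \<Delta> = bar_basis r p - {simple_root \<nu>}; b = simple_root \<nu> + \<theta> in
             highest_root (ext_form r p) (span \<Delta>) \<Delta> \<theta> \<and>
             (\<forall>v\<in>span \<Delta>. F (v, 0) (0, 1) = 0) \<and> F (a, 0) (0, 1) = 0 \<and>
             F (b, 0) (0, 1) = 1 \<and> F (0, 1) (0, 1) = 0)
      else
        (\<forall>v\<in>span (bar_basis r p). F (v, 0) (0, 1) = 0) \<and>
        F (a, 0) (0, 1) = 1 \<and> F (0, 1) (0, 1) = 0)"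

definition cover_weyl_group ::
  "nat \<Rightarrow> (nat \<Rightarrow> nat) \<Rightarrow> (cover_vector \<Rightarrow> cover_vector \<Rightarrow> real) \<Rightarrow> (cover_vector \<Rightarrow> cover_vector) monoid"
  where "cover_weyl_group r p F = weyl_group F (cover_space r p) (cover_basis r p)"

definition cover_reflections ::
  "nat \<Rightarrow> (nat \<Rightarrow> nat) \<Rightarrow> (cover_vector \<Rightarrow> cover_vector \<Rightarrow> real) \<Rightarrow> (cover_vector \<Rightarrow> cover_vector) set"
  where "cover_reflections r p F = weyl_reflections F (cover_space r p) (cover_basis r p)"

definition list_product :: "('g, 'k) monoid_scheme \<Rightarrow> 'g list \<Rightarrow> 'g" where
  "list_product G gs = foldr (\<lambda>x y. x \<otimes>\<^bsub>G\<^esub> y) gs \<one>\<^bsub>G\<^esub>"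

definition coxeter_transformation ::
  "nat \<Rightarrow> (nat \<Rightarrow> nat) \<Rightarrow> (cover_vector \<Rightarrow> cover_vector \<Rightarrow> real) \<Rightarrow> (cover_vector \<Rightarrow> cover_vector) \<Rightarrow> bool"
  where
  "coxeter_transformation r p F c \<longleftrightarrow>
     (\<exists>as. distinct as \<and> set as = ext_basis r p - {simple_root Hub, simple_root Hub_star} \<and>
        c = list_product (cover_weyl_group r p F)
              (map (\<lambda>\<alpha>. reflection F (cover_space r p) (\<alpha>, 0))
                (as @ [simple_root Hub, simple_root Hub_star])))"

section \<open>Reduced factorizations\<close>

definition factorization_length :: "('g, 'k) monoid_scheme \<Rightarrow> 'g set \<Rightarrow> 'g \<Rightarrow> nat" where
  "factorization_length G T g = (LEAST n. \<exists>ts. length ts = n \<and> set ts \<subseteq> T \<and> list_product G ts = g)"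

definition reduced_factorizations :: "('g, 'k) monoid_scheme \<Rightarrow> 'g set \<Rightarrow> 'g \<Rightarrow> 'g list set" where
  "reduced_factorizations G T g =
     {ts. length ts = factorization_length G T g \<and> set ts \<subseteq> T \<and> list_product G ts = g}"

section \<open>Braid groups and the Hurwitz action\<close>

text \<open>
  Braid words: \<open>(i, True)\<close> stands for the generator \<open>\<sigma>\<^sub>i\<close>, and \<open>(i, False)\<close> for its inverse.
\<close>

type_synonym braid_word = "(nat \<times> bool) list"

definition braid_words :: "nat \<Rightarrow> braid_word set" where
  "braid_words m = lists ({1..<m} \<times> UNIV)"

inductive braid_eq :: "nat \<Rightarrow> braid_word \<Rightarrow> braid_word \<Rightarrow> bool" for m where
  refl: "u \<in> braid_words m \<Longrightarrow> braid_eq m u u"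
| sym: "braid_eq m u v \<Longrightarrow> braid_eq m v u"
| trans: "braid_eq m u v \<Longrightarrow> braid_eq m v w \<Longrightarrow> braid_eq m u w"
| append: "braid_eq m u u' \<Longrightarrow> braid_eq m v v' \<Longrightarrow> braid_eq m (u @ v) (u' @ v')"
| cancel: "1 \<le> i \<Longrightarrow> i < m \<Longrightarrow> braid_eq m [(i, e), (i, \<not> e)] []"
| far: "1 \<le> i \<Longrightarrow> i + 2 \<le> j \<Longrightarrow> j < m \<Longrightarrow>
    braid_eq m [(i, True), (j, True)] [(j, True), (i, True)]"
| braid: "1 \<le> i \<Longrightarrow> i + 1 < m \<Longrightarrow>
    braid_eq m [(i, True), (i + 1, True), (i, True)] [(i + 1, True), (i, True), (i + 1, True)]"

definition braid_class :: "nat \<Rightarrow> braid_word \<Rightarrow> braid_word set" where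
  "braid_class m u = {v. braid_eq m u v}"

definition braid_group :: "nat \<Rightarrow> braid_word set monoid" where
  "braid_group m =
     \<lparr>carrier = braid_class m ` braid_words m,
      mult = (\<lambda>X Y. \<Union>u\<in>X. \<Union>v\<in>Y. braid_class m (u @ v)),
      one = braid_class m []\<rparr>"

text \<open>Lists are indexed from 0, so \<open>\<sigma>\<^sub>i\<close> acts on the list positions \<open>i - 1\<close> and \<open>i\<close>.\<close>

fun hurwitz_letter :: "('g, 'k) monoid_scheme \<Rightarrow> nat \<times> bool \<Rightarrow> 'g list \<Rightarrow> 'g list" where
  "hurwitz_letter G (i, True) gs =
     gs[i - 1 := gs ! i, i := inv\<^bsub>G\<^esub> (gs ! i) \<otimes>\<^bsub>G\<^esub> (gs ! (i - 1)) \<otimes>\<^bsub>G\<^esub> (gs ! i)]"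
| "hurwitz_letter G (i, False) gs =
     gs[i - 1 := (gs ! (i - 1)) \<otimes>\<^bsub>G\<^esub> (gs ! i) \<otimes>\<^bsub>G\<^esub> inv\<^bsub>G\<^esub> (gs ! (i - 1)), i := gs ! (i - 1)]"

definition hurwitz_word :: "('g, 'k) monoid_scheme \<Rightarrow> braid_word \<Rightarrow> 'g list \<Rightarrow> 'g list" where
  "hurwitz_word G u gs = foldr (hurwitz_letter G) u gs"

text \<open>
  A braid acts through any word representing it; by the lemma \<open>hurwitz_eq\<close> below, the
  choice does not matter.
\<close>

definition hurwitz :: "('g, 'k) monoid_scheme \<Rightarrow> braid_word set \<Rightarrow> 'g list \<Rightarrow> 'g list" where
  "hurwitz G \<beta> = hurwitz_word G (SOME u. u \<in> \<beta>)"

subsection \<open>The braid group is a group\<close>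

lemma braid_eq_words: "braid_eq m u v \<Longrightarrow> u \<in> braid_words m \<and> v \<in> braid_words m"
  by (induction rule: braid_eq.induct) (auto simp: braid_words_def)

lemma braid_class_eq_iff:
  assumes "u \<in> braid_words m"
  shows "braid_class m u = braid_class m v \<longleftrightarrow> braid_eq m u v"
  using assms braid_eq.refl[of u m] braid_eq.sym[of m] braid_eq.trans[of m]
  unfolding braid_class_def set_eq_iff mem_Collect_eq by blast

lemma braid_class_mult:
  assumes "u \<in> braid_words m" "v \<in> braid_words m"
  shows "braid_class m u \<otimes>\<^bsub>braid_group m\<^esub> braid_class m v = braid_class m (u @ v)"
proof -
  have "braid_class m (u' @ v') = braid_class m (u @ v)"
    if "u' \<in> braid_class m u" "v' \<in> braid_class m v" for u' v'
  proof -
    from that have *: "braid_eq m (u @ v) (u' @ v')"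
      by (auto simp: braid_class_def intro: braid_eq.append)
    then have "u @ v \<in> braid_words m"
      using braid_eq_words by blast
    with * show ?thesis using braid_class_eq_iff by metis
  qed
  moreover have "u \<in> braid_class m u" "v \<in> braid_class m v"
    using assms by (auto simp: braid_class_def intro: braid_eq.refl)
  ultimately show ?thesis
    unfolding braid_group_def monoid.simps by blast
qed

lemma braid_words_append [simp]:
  "u @ v \<in> braid_words m \<longleftrightarrow> u \<in> braid_words m \<and> v \<in> braid_words m"
  by (auto simp: braid_words_def)

lemma braid_words_Nil [simp]: "[] \<in> braid_words m"
  by (simp add: braid_words_def)

lemma braid_words_Cons [simp]:
  "x # u \<in> braid_words m \<longleftrightarrow> 1 \<le> fst x \<and> fst x < m \<and> u \<in> braid_words m"
  by (cases x) (auto simp: braid_words_def)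

lemma braid_inverse_ex:
  "u \<in> braid_words m \<Longrightarrow> \<exists>v\<in>braid_words m. braid_eq m (v @ u) []"
proof (induction u)
  case Nil
  then show ?case by (intro bexI[of _ "[]"]) (auto intro: braid_eq.refl)
next
  case (Cons x u)
  obtain i e where x: "x = (i, e)" by (cases x)
  from Cons obtain v where v: "v \<in> braid_words m" "braid_eq m (v @ u) []"
    by auto
  have i: "1 \<le> i" "i < m" "u \<in> braid_words m" using Cons.prems x by auto
  have "braid_eq m [(i, \<not> e), (i, e)] []"
    using braid_eq.cancel[of i m "\<not> e"] i by simp
  then have "braid_eq m ([(i, \<not> e), (i, e)] @ u) ([] @ u)"
    using i(3) by (rule braid_eq.append[OF _ braid_eq.refl])
  then have "braid_eq m (v @ ([(i, \<not> e), (i, e)] @ u)) (v @ ([] @ u))"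
    by (rule braid_eq.append[OF braid_eq.refl[OF v(1)]])
  then have "braid_eq m ((v @ [(i, \<not> e)]) @ x # u) []"
    using v(2) braid_eq.trans x by auto
  moreover have "v @ [(i, \<not> e)] \<in> braid_words m" using v i by simp
  ultimately show ?case by blast
qed

lemma group_braid_group: "group (braid_group m)"
proof (rule groupI)
  fix X Y Z
  assume XY: "X \<in> carrier (braid_group m)" "Y \<in> carrier (braid_group m)"
  then obtain u v where uv: "u \<in> braid_words m" "v \<in> braid_words m"
      "X = braid_class m u" "Y = braid_class m v"
    by (auto simp: braid_group_def)
  then show "X \<otimes>\<^bsub>braid_group m\<^esub> Y \<in> carrier (braid_group m)"
    by (simp add: braid_class_mult) (simp add: braid_group_def)
  assume "Z \<in> carrier (braid_group m)"
  then obtain w where w: "w \<in> braid_words m" "Z = braid_class m w"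
    by (auto simp: braid_group_def)
  show "X \<otimes>\<^bsub>braid_group m\<^esub> Y \<otimes>\<^bsub>braid_group m\<^esub> Z = X \<otimes>\<^bsub>braid_group m\<^esub> (Y \<otimes>\<^bsub>braid_group m\<^esub> Z)"
    using uv w by (simp add: braid_class_mult)
next
  show "\<one>\<^bsub>braid_group m\<^esub> \<in> carrier (braid_group m)"
    by (simp add: braid_group_def)
next
  fix X assume "X \<in> carrier (braid_group m)"
  then obtain u where u: "u \<in> braid_words m" "X = braid_class m u"
    by (auto simp: braid_group_def)
  have one: "\<one>\<^bsub>braid_group m\<^esub> = braid_class m []" by (simp add: braid_group_def)
  show "\<one>\<^bsub>braid_group m\<^esub> \<otimes>\<^bsub>braid_group m\<^esub> X = X"
    unfolding one u by (subst braid_class_mult) (use u in auto)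
  obtain v where v: "v \<in> braid_words m" "braid_eq m (v @ u) []"
    using braid_inverse_ex u by blast
  show "\<exists>Y\<in>carrier (braid_group m). Y \<otimes>\<^bsub>braid_group m\<^esub> X = \<one>\<^bsub>braid_group m\<^esub>"
  proof (rule bexI)
    show "braid_class m v \<otimes>\<^bsub>braid_group m\<^esub> X = \<one>\<^bsub>braid_group m\<^esub>"
      using u v braid_class_eq_iff[of "v @ u" m "[]"] by (simp add: one braid_class_mult)
    show "braid_class m v \<in> carrier (braid_group m)"
      using v by (simp add: braid_group_def)
  qed
qed

subsection \<open>The Hurwitz action is an action\<close>

context group
begin

lemma inv_cancel_left:
  assumes "x \<in> carrier G" "y \<in> carrier G"
  shows "inv x \<otimes> (x \<otimes> y) = y" "x \<otimes> (inv x \<otimes> y) = y"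
  using assms by (simp_all flip: m_assoc)

lemma hurwitz_letter_length [simp]: "length (hurwitz_letter G x gs) = length gs"
  by (cases "(G, x, gs)" rule: hurwitz_letter.cases) auto

lemma hurwitz_letter_carrier:
  assumes "1 \<le> i" "i < length gs" "set gs \<subseteq> carrier G"
  shows "set (hurwitz_letter G (i, e) gs) \<subseteq> carrier G"
proof -
  have "gs ! i \<in> carrier G" "gs ! (i - 1) \<in> carrier G"
    using assms by (auto simp: subset_iff)
  then show ?thesis
    using assms(3) by (cases e) (simp_all add: set_update_subsetI)
qed

lemma hurwitz_word_tuples:
  assumes "u \<in> braid_words m" "length gs = m" "set gs \<subseteq> carrier G"
  shows "length (hurwitz_word G u gs) = m \<and> set (hurwitz_word G u gs) \<subseteq> carrier G"
  using assms(1)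
proof (induction u)
  case (Cons x u)
  then show ?case
    using hurwitz_letter_carrier[of "fst x" "hurwitz_word G u gs" "snd x"]
    by (auto simp: hurwitz_word_def)
qed (use assms in \<open>auto simp: hurwitz_word_def\<close>)

lemma hurwitz_word_append:
  "hurwitz_word G (u @ v) gs = hurwitz_word G u (hurwitz_word G v gs)"
  by (simp add: hurwitz_word_def)

lemma hurwitz_word_cancel:
  assumes "1 \<le> i" "i < length gs" "set gs \<subseteq> carrier G"
  shows "hurwitz_letter G (i, e) (hurwitz_letter G (i, \<not> e) gs) = gs"
proof -
  have "gs ! i \<in> carrier G" "gs ! (i - 1) \<in> carrier G"
    using assms by (auto simp: subset_iff)
  then show ?thesis
    using assms by (cases e) (auto simp: nth_list_update m_assoc inv_cancel_left
        intro!: nth_equalityI)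
qed

lemma hurwitz_word_far:
  assumes "1 \<le> i" "i + 2 \<le> j" "j < length gs"
  shows "hurwitz_letter G (i, True) (hurwitz_letter G (j, True) gs) =
         hurwitz_letter G (j, True) (hurwitz_letter G (i, True) gs)"
  using assms by (auto simp: nth_list_update intro!: nth_equalityI)

lemma hurwitz_word_braid:
  assumes "1 \<le> i" "i + 1 < length gs" "set gs \<subseteq> carrier G"
  shows "hurwitz_word G [(i, True), (i + 1, True), (i, True)] gs =
         hurwitz_word G [(i + 1, True), (i, True), (i + 1, True)] gs"
proof -
  have c: "gs ! i \<in> carrier G" "gs ! (i - 1) \<in> carrier G" "gs ! (i + 1) \<in> carrier G"
    using assms by (auto simp: subset_iff)
  obtain k where k: "i = Suc k" using assms(1) by (cases i) auto
  show ?thesis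
    using assms c unfolding k hurwitz_word_def
    by (auto simp: nth_list_update m_assoc inv_mult_group inv_cancel_left less_Suc_eq intro!: nth_equalityI)
qed

lemma hurwitz_word_eq:
  assumes "braid_eq m u v" "length gs = m" "set gs \<subseteq> carrier G"
  shows "hurwitz_word G u gs = hurwitz_word G v gs"
  using assms
proof (induction arbitrary: gs rule: braid_eq.induct)
  case (append u u' v v')
  then show ?case
    using hurwitz_word_tuples braid_eq_words by (metis hurwitz_word_append)
next
  case (cancel i e)
  then show ?case using hurwitz_word_cancel[of i gs e] by (simp add: hurwitz_word_def)
next
  case (far i j)
  then show ?case using hurwitz_word_far[of i j gs] by (simp add: hurwitz_word_def)
next
  case (braid i)
  then show ?case using hurwitz_word_braid[of i gs] by simp
qed auto

lemma hurwitz_eq: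
  assumes "u \<in> braid_words m" "length gs = m" "set gs \<subseteq> carrier G"
  shows "hurwitz G (braid_class m u) gs = hurwitz_word G u gs"
proof -
  have "u \<in> braid_class m u"
    using assms by (auto simp: braid_class_def intro: braid_eq.refl)
  then have "(SOME v. v \<in> braid_class m u) \<in> braid_class m u"
    by (rule someI)
  then show ?thesis
    using assms hurwitz_word_eq by (auto simp: hurwitz_def braid_class_def)
qed

lemma hurwitz_group_action:
  assumes E: "\<And>gs. gs \<in> E \<Longrightarrow> length gs = m \<and> set gs \<subseteq> carrier G"
    and closed: "\<And>i e gs. 1 \<le> i \<Longrightarrow> i < m \<Longrightarrow> gs \<in> E \<Longrightarrow> hurwitz_letter G (i, e) gs \<in> E"
  shows "group_action (braid_group m) E (\<lambda>\<beta>. \<lambda>gs\<in>E. hurwitz G \<beta> gs)"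
proof -
  have word: "hurwitz_word G u gs \<in> E" if "u \<in> braid_words m" "gs \<in> E" for u gs
    using that
  proof (induction u)
    case (Cons x u)
    then show ?case using closed[of "fst x" _ "snd x"] by (auto simp: hurwitz_word_def)
  qed (auto simp: hurwitz_word_def)
  have act: "(\<lambda>gs\<in>E. hurwitz G (braid_class m u) gs) = (\<lambda>gs\<in>E. hurwitz_word G u gs)"
    if "u \<in> braid_words m" for u
    using hurwitz_eq E that by fastforce
  have Bij: "(\<lambda>gs\<in>E. hurwitz_word G u gs) \<in> Bij E" if u: "u \<in> braid_words m" for u
  proof -
    obtain v where v: "v \<in> braid_words m" "braid_eq m (v @ u) []"
      using braid_inverse_ex u by blast
    obtain w where w: "w \<in> braid_words m" "braid_eq m (w @ v) []"
      using braid_inverse_ex v by blast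
    have vu: "hurwitz_word G v (hurwitz_word G u gs) = gs" if "gs \<in> E" for gs
      using hurwitz_word_eq[OF v(2)] E[OF that]
      by (simp add: hurwitz_word_append) (simp add: hurwitz_word_def)
    have wv: "hurwitz_word G w (hurwitz_word G v gs) = gs" if "gs \<in> E" for gs
      using hurwitz_word_eq[OF w(2)] E[OF that]
      by (simp add: hurwitz_word_append) (simp add: hurwitz_word_def)
    have uv: "hurwitz_word G u (hurwitz_word G v gs) = gs" if "gs \<in> E" for gs
      using vu wv word that u v w by metis
    have "bij_betw (hurwitz_word G u) E E"
      by (rule bij_betw_byWitness[where f' = "hurwitz_word G v"]) (use vu uv word u v in auto)
    then show ?thesis
      by (auto simp: Bij_def cong: bij_betw_cong)
  qed
  have "(\<lambda>\<beta>. \<lambda>gs\<in>E. hurwitz G \<beta> gs) \<in> hom (braid_group m) (BijGroup E)"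
  proof (rule homI)
    fix X assume "X \<in> carrier (braid_group m)"
    then show "(\<lambda>gs\<in>E. hurwitz G X gs) \<in> carrier (BijGroup E)"
      using act Bij by (auto simp: braid_group_def BijGroup_def)
  next
    fix X Y assume "X \<in> carrier (braid_group m)" "Y \<in> carrier (braid_group m)"
    then obtain u v where uv: "u \<in> braid_words m" "v \<in> braid_words m"
        "X = braid_class m u" "Y = braid_class m v"
      by (auto simp: braid_group_def)
    then show "(\<lambda>gs\<in>E. hurwitz G (X \<otimes>\<^bsub>braid_group m\<^esub> Y) gs) =
        (\<lambda>gs\<in>E. hurwitz G X gs) \<otimes>\<^bsub>BijGroup E\<^esub> (\<lambda>gs\<in>E. hurwitz G Y gs)"
      using Bij word
      by (auto simp: act braid_class_mult BijGroup_def compose_def hurwitz_word_append fun_eq_iff)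
  qed
  then show ?thesis
    by (intro group_action.intro group_hom.intro group_hom_axioms.intro
        group_braid_group group_BijGroup)
qed

lemma list_product_append:
  assumes "set xs \<subseteq> carrier G" "set ys \<subseteq> carrier G"
  shows "list_product G (xs @ ys) = list_product G xs \<otimes> list_product G ys"
proof -
  have "list_product G zs \<in> carrier G" if "set zs \<subseteq> carrier G" for zs
    using that by (induction zs) (auto simp: list_product_def)
  then show ?thesis
    using assms by (induction xs) (auto simp: list_product_def m_assoc)
qed

lemma list_product_hurwitz_letter:
  assumes "1 \<le> i" "i < length gs" "set gs \<subseteq> carrier G"
  shows "list_product G (hurwitz_letter G (i, e) gs) = list_product G gs"
proof -
  define xs where "xs = take (i - 1) gs"
  define ys where "ys = drop (i + 1) gs"
  define g where "g = gs ! (i - 1)"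
  define h where "h = gs ! i"
  have "gs = take (i - 1) gs @ gs ! (i - 1) # drop (Suc (i - 1)) gs"
    by (rule id_take_nth_drop) (use assms in auto)
  moreover have "drop (Suc (i - 1)) gs = gs ! i # drop (i + 1) gs"
    using assms Cons_nth_drop_Suc[of i gs] by simp
  ultimately have gs: "gs = xs @ [g, h] @ ys"
    unfolding xs_def ys_def g_def h_def by simp
  have len: "length xs = i - 1" using assms by (simp add: xs_def)
  have i: "i = Suc (length xs)" using len assms by simp
  have c: "set xs \<subseteq> carrier G" "set ys \<subseteq> carrier G" "g \<in> carrier G" "h \<in> carrier G"
    using assms(3) unfolding gs by auto
  define ab where "ab = (if e then [h, inv h \<otimes> g \<otimes> h] else [g \<otimes> h \<otimes> inv g, g])"
  have eq: "hurwitz_letter G (i, e) gs = xs @ ab @ ys"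
    unfolding gs i ab_def by (cases e) (auto simp: nth_append list_update_append)
  have "set ab \<subseteq> carrier G" "list_product G ab = list_product G [g, h]"
    using c by (auto simp: ab_def list_product_def m_assoc inv_cancel_left)
  then show ?thesis
    unfolding eq unfolding gs using c by (simp add: list_product_append del: append.simps)
qed

lemma hurwitz_action_reduced_factorizations:
  assumes T: "T \<subseteq> carrier G"
    and conj: "\<And>s t. s \<in> T \<Longrightarrow> t \<in> T \<Longrightarrow> t \<otimes> s \<otimes> inv t \<in> T \<and> inv t \<otimes> s \<otimes> t \<in> T"
  shows "group_action (braid_group (factorization_length G T g)) (reduced_factorizations G T g)
           (\<lambda>\<beta>. \<lambda>ts\<in>reduced_factorizations G T g. hurwitz G \<beta> ts)"
proof (rule hurwitz_group_action)
  fix i e ts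
  assume i: "1 \<le> i" "i < factorization_length G T g" and ts: "ts \<in> reduced_factorizations G T g"
  have "ts ! i \<in> T" "ts ! (i - 1) \<in> T"
    using i ts by (auto simp: reduced_factorizations_def subset_iff)
  then have "set (hurwitz_letter G (i, e) ts) \<subseteq> T"
    using ts conj by (cases e) (simp_all add: reduced_factorizations_def set_update_subsetI)
  then show "hurwitz_letter G (i, e) ts \<in> reduced_factorizations G T g"
    using i ts T list_product_hurwitz_letter[of i ts e]
    by (auto simp: reduced_factorizations_def)
qed (use T in \<open>auto simp: reduced_factorizations_def\<close>)

end

subsection \<open>Weyl groups are groups\<close>

lemma group_GL:
  assumes "subspace U"
  shows "group (GL U)"
proof -
  have "subgroup (carrier (GL U)) (BijGroup U)"
  proof (rule group.subgroupI[OF group_BijGroup])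
    show "carrier (GL U) \<subseteq> carrier (BijGroup U)"
      by (auto simp: GL_def BijGroup_def)
    have "(\<lambda>x\<in>U. x) \<in> carrier (GL U)"
      using assms id_Bij by (auto simp: GL_def subspace_add subspace_scale)
    then show "carrier (GL U) \<noteq> {}" by blast
  next
    fix g assume g: "g \<in> carrier (GL U)"
    then have gB: "g \<in> Bij U" by (simp add: GL_def)
    have "inv\<^bsub>BijGroup U\<^esub> g = (\<lambda>x\<in>U. inv_into U g x)"
      using gB by (rule inv_BijGroup)
    moreover have "(\<lambda>x\<in>U. inv_into U g x) \<in> carrier (GL U)"
    proof -
      have add: "inv_into U g (x + y) = inv_into U g x + inv_into U g y"
        if "x \<in> U" "y \<in> U" for x y
        by (rule Bij_inv_into_lemma[where g = "(+)"])
          (use that g gB assms in \<open>auto simp: GL_def subspace_add\<close>)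
      have scale: "inv_into U g (c *\<^sub>R x) = c *\<^sub>R inv_into U g x" if "x \<in> U" for c x
        using Bij_inv_into_lemma[where g = "\<lambda>_ x. c *\<^sub>R x" and h = g and S = U and x = x and y = x]
          that g gB assms by (auto simp: GL_def subspace_scale)
      show ?thesis
        using restrict_inv_into_Bij[OF gB] add scale assms
        by (auto simp: GL_def subspace_add subspace_scale)
    qed
    ultimately show "inv\<^bsub>BijGroup U\<^esub> g \<in> carrier (GL U)" by simp
  next
    fix g h assume gh: "g \<in> carrier (GL U)" "h \<in> carrier (GL U)"
    then have "g \<in> Bij U" "h \<in> Bij U" "\<And>x. x \<in> U \<Longrightarrow> h x \<in> U"
      using Bij_imp_funcset by (auto simp: GL_def)
    then show "g \<otimes>\<^bsub>BijGroup U\<^esub> h \<in> carrier (GL U)"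
      using gh assms compose_Bij[of g U h]
      by (auto simp: GL_def BijGroup_def compose_def subspace_add subspace_scale)
  qed
  then have "group ((BijGroup U)\<lparr>carrier := carrier (GL U)\<rparr>)"
    by (rule subgroup.subgroup_is_group[OF _ group_BijGroup])
  then show ?thesis by (simp add: GL_def)
qed

lemma group_weyl_group: "subspace U \<Longrightarrow> group (weyl_group f U \<Delta>)"
  unfolding weyl_group_def by (intro group.group_subgroup_generated group_GL)

lemma reflection_in_GL:
  assumes U: "subspace U" and f: "\<alpha> \<in> U" "f \<alpha> \<alpha> \<noteq> 0" "linear (f \<alpha>)"
  shows "reflection f U \<alpha> \<in> carrier (GL U)"
proof -
  define s where "s v = v - (2 * f \<alpha> v / f \<alpha> \<alpha>) *\<^sub>R \<alpha>" for v
  have lin: "f \<alpha> (x + y) = f \<alpha> x + f \<alpha> y" "f \<alpha> (x - y) = f \<alpha> x - f \<alpha> y"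
      "f \<alpha> (c *\<^sub>R x) = c * f \<alpha> x" for x y c
    using f(3) by (simp_all add: linear_add linear_diff linear_scale)
  have U': "s v \<in> U" if "v \<in> U" for v
    using that U f unfolding s_def by (intro subspace_diff subspace_scale)
  have invol: "s (s v) = v" for v
  proof -
    have "f \<alpha> (s v) = - f \<alpha> v"
      using f(2) by (simp add: s_def lin)
    then have "s (s v) = s v + (2 * f \<alpha> v / f \<alpha> \<alpha>) *\<^sub>R \<alpha>"
      unfolding s_def[of "s v"] by simp
    then show ?thesis by (simp add: s_def)
  qed
  have bij: "bij_betw s U U"
    by (rule bij_betw_byWitness[where f' = s]) (use U' invol in auto)
  have s_lin: "s (x + y) = s x + s y" "s (c *\<^sub>R x) = c *\<^sub>R s x" for x y c
    by (simp_all add: s_def lin algebra_simps add_divide_distrib)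
  have "reflection f U \<alpha> = (\<lambda>v\<in>U. s v)"
    by (simp add: reflection_def s_def)
  then show ?thesis
    using bij s_lin U by (auto simp: GL_def Bij_def subspace_add subspace_scale cong: bij_betw_cong)
qed

subsection \<open>Well-definedness of the cover\<close>

lemma lookup_scaleR: "Poly_Mapping.lookup (c *\<^sub>R v) \<nu> = c * Poly_Mapping.lookup v \<nu>"
  for v :: "vertex \<Rightarrow>\<^sub>0 real"
proof -
  have "finite {i. c *\<^sub>R Poly_Mapping.lookup v i \<noteq> 0}"
    by (rule finite_subset[OF _ finite_lookup[of v]]) auto
  then show ?thesis
    by (simp add: scaleR_poly_mapping_def Abs_poly_mapping_inverse)
qed

lemma finite_vertices [simp]: "finite (vertices r p)"
proof -
  have "vertices r p \<subseteq> {Hub, Hub_star} \<union> (\<Union>i\<in>{1..r}. Arm i ` {1..p i})"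
    by (auto simp: vertices_def)
  then show ?thesis by (rule finite_subset) auto
qed

lemma ext_form_simple_root:
  assumes "\<nu> \<in> vertices r p" "\<omega> \<in> vertices r p"
  shows "ext_form r p (simple_root \<nu>) (simple_root \<omega>) = gram r p \<nu> \<omega>"
proof -
  have *: "Poly_Mapping.lookup (simple_root \<mu>) \<kappa> = (if \<kappa> = \<mu> then 1 else 0)" for \<mu> \<kappa>
    by (simp add: simple_root_def lookup_single when_def)
  have "ext_form r p (simple_root \<nu>) (simple_root \<omega>) =
      (\<Sum>\<kappa>\<in>vertices r p. if \<kappa> = \<nu> then (\<Sum>\<rho>\<in>vertices r p. if \<rho> = \<omega> then gram r p \<kappa> \<rho> else 0) else 0)"
    unfolding ext_form_def *
  proof (intro sum.cong refl)
    fix \<kappa>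
    show "(\<Sum>\<rho>\<in>vertices r p. (if \<kappa> = \<nu> then 1 else 0) * (if \<rho> = \<omega> then 1 else 0) * gram r p \<kappa> \<rho>) =
        (if \<kappa> = \<nu> then \<Sum>\<rho>\<in>vertices r p. if \<rho> = \<omega> then gram r p \<kappa> \<rho> else 0 else 0)"
    proof (cases "\<kappa> = \<nu>")
      case True
      show ?thesis unfolding if_P[OF True] by (rule sum.cong) auto
    qed simp
  qed auto
  also have "\<dots> = gram r p \<nu> \<omega>"
    using assms by (simp add: sum.delta)
  finally show ?thesis .
qed

lemma ext_form_sym: "ext_form r p v w = ext_form r p w v"
proof -
  have "gram r p \<nu> \<omega> = gram r p \<omega> \<nu>" for \<nu> \<omega>
    unfolding gram_def by (simp add: insert_commute eq_commute)
  then show ?thesis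
    unfolding ext_form_def by (subst sum.swap) (simp add: mult.commute)
qed

lemma bilinear_ext_form: "bilinear (ext_form r p)"
proof -
  have "linear (ext_form r p v)" for v
    by (rule linearI)
      (simp_all add: ext_form_def lookup_add lookup_scaleR algebra_simps sum.distrib sum_distrib_left)
  moreover from this have "linear (\<lambda>v. ext_form r p v w)" for w
    by (simp add: ext_form_sym[of r p _ w])
  ultimately show ?thesis by (simp add: bilinear_def)
qed

lemma weyl_group_closed:
  assumes "subspace U" "w \<in> carrier (weyl_group f U \<Delta>)" "x \<in> U"
  shows "w x \<in> U"
proof -
  have "w \<in> carrier (GL U)"
    using group.carrier_subgroup_generated_subset[OF group_GL[OF assms(1)]] assms(2)
    unfolding weyl_group_def by blast
  then have "w \<in> Bij U" by (simp add: GL_def)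
  then show ?thesis using Bij_imp_funcset assms(3) by blast
qed

lemma subspace_cover_space: "subspace (cover_space r p)"
  unfolding cover_space_def ext_space_def by (intro subspace_Times subspace_span subspace_UNIV)

lemma reflection_in_GL_cover:
  assumes "cover_form r p F" "\<alpha> \<in> cover_basis r p"
  shows "reflection F (cover_space r p) \<alpha> \<in> carrier (GL (cover_space r p))"
proof (rule reflection_in_GL)
  obtain \<nu> where \<nu>: "\<nu> \<in> vertices r p" "\<alpha> = (simple_root \<nu>, 0)"
    using assms(2) by (auto simp: cover_basis_def ext_basis_def)
  then have mem: "simple_root \<nu> \<in> ext_space r p"
    by (auto simp: ext_space_def ext_basis_def intro: span_base)
  then show "\<alpha> \<in> cover_space r p" by (simp add: \<nu> cover_space_def)
  have "F \<alpha> \<alpha> = 2"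
    using assms(1) mem \<nu> ext_form_simple_root[of \<nu> r p \<nu>] by (simp add: cover_form_def gram_def)
  then show "F \<alpha> \<alpha> \<noteq> 0" by simp
  show "linear (F \<alpha>)" using assms(1) unfolding cover_form_def bilinear_def by blast
qed (rule subspace_cover_space)

lemma lookup_span:
  assumes "v \<in> span (simple_root ` A)" "\<nu> \<notin> A"
  shows "Poly_Mapping.lookup v \<nu> = 0"
  using assms(1)
proof (induction rule: span_induct_alt)
  case (step c x y)
  then show ?case
    using assms(2) by (auto simp: lookup_add lookup_scaleR simple_root_def lookup_single when_def
        split: if_splits)
qed simp

lemma inj_simple_root: "inj simple_root"
proof (rule injI)
  fix \<nu> \<omega> assume "simple_root \<nu> = simple_root \<omega>"
  then have "Poly_Mapping.lookup (simple_root \<nu>) \<nu> = Poly_Mapping.lookup (simple_root \<omega>) \<nu>"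
    by simp
  then show "\<nu> = \<omega>" by (simp add: simple_root_def lookup_single when_def split: if_splits)
qed

text \<open>
  The form of the hyperbolic cover exists: unconditionally outside of the tubular type, and for
  every choice of an affine node and a highest root in the tubular type.
\<close>

lemma cover_form_exists:
  assumes "tubular r p \<Longrightarrow> affine_node r p \<nu> \<and>
    highest_root (ext_form r p) (span (bar_basis r p - {simple_root \<nu>}))
      (bar_basis r p - {simple_root \<nu>}) \<theta>"
  shows "\<exists>F. cover_form r p F"
proof -
  define \<mu> where "\<mu> = (if tubular r p then \<nu> else Hub_star)"
  define l where "l v = Poly_Mapping.lookup v \<mu>" for v :: "vertex \<Rightarrow>\<^sub>0 real"
  define F :: "cover_vector \<Rightarrow> cover_vector \<Rightarrow> real" where
    "F x y = ext_form r p (fst x) (fst y) + snd x * l (fst y) + snd y * l (fst x)" for x y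
  have l_lin: "l (v + w) = l v + l w" "l (v - w) = l v - l w" "l (c *\<^sub>R v) = c * l v" "l 0 = 0"
    for v w c by (simp_all add: l_def lookup_add lookup_minus lookup_scaleR)
  have sym: "F x y = F y x" for x y
    by (simp add: F_def ext_form_sym)
  have "linear (F x)" for x
    by (rule linearI)
      (simp_all add: F_def l_lin bilinear_radd[OF bilinear_ext_form]
        bilinear_rmul[OF bilinear_ext_form] algebra_simps)
  moreover from this have "linear (\<lambda>x. F x y)" for y
    by (simp add: sym[of _ y])
  ultimately have bil: "bilinear F" by (simp add: bilinear_def)
  have F0: "F (v, 0) (w, 0) = ext_form r p v w" "F (v, 0) (0, 1) = l v" "F (0, 1) (0, 1) = 0" for v w
    using bilinear_rzero[OF bilinear_ext_form[of r p]] by (simp_all add: F_def l_lin)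
  have bar: "bar_basis r p = simple_root ` (vertices r p - {Hub_star})"
    using inj_simple_root by (auto simp: bar_basis_def ext_basis_def dest: injD)
  have l_simple: "l (simple_root \<kappa>) = (if \<kappa> = \<mu> then 1 else 0)" for \<kappa>
    by (simp add: l_def simple_root_def lookup_single when_def)
  show ?thesis
  proof (cases "tubular r p")
    case False
    then have "l v = 0" if "v \<in> span (bar_basis r p)" for v
      using lookup_span[OF that[unfolded bar]] by (simp add: l_def \<mu>_def)
    with False show ?thesis
      by (intro exI[of _ F]) (simp add: cover_form_def bil sym F0 Let_def l_lin l_simple \<mu>_def)
  next
    case True
    define \<Delta> where "\<Delta> = bar_basis r p - {simple_root \<nu>}"
    have \<Delta>: "\<Delta> = simple_root ` (vertices r p - {Hub_star, \<nu>})"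
      using inj_simple_root by (auto simp: \<Delta>_def bar dest: injD)
    have l0: "l v = 0" if "v \<in> span \<Delta>" for v
      using lookup_span[OF that[unfolded \<Delta>]] True by (simp add: l_def \<mu>_def)
    have hr: "highest_root (ext_form r p) (span \<Delta>) \<Delta> \<theta>" and an: "affine_node r p \<nu>"
      using assms True by (auto simp: \<Delta>_def)
    then have "\<theta> \<in> span \<Delta>"
      using weyl_group_closed[OF subspace_span] span_base
      unfolding highest_root_def root_system_def by blast
    moreover have "\<nu> \<noteq> Hub" "\<nu> \<noteq> Hub_star" using an by (auto simp: affine_node_def)
    ultimately have "cover_form r p F"
      unfolding cover_form_def Let_def using True hr an bil l0
      by (intro conjI allI sym)
        (auto simp: F0 l_lin l_simple \<mu>_def simp flip: \<Delta>_def intro!: exI[of _ \<nu>] exI[of _ \<theta>])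
    then show ?thesis by blast
  qed
qed

end

theory Submission
  imports Defs
begin


text \<open>
  Let \<open>a = \<alpha>\<^sub>1\<^sub>* - \<alpha>\<^sub>1\<close>. The reflections of the cover are the reflections at the vectors \<open>\<beta> + k a\<close>, with \<open>\<beta>\<close>
  a root of the Coxeter group \<open>W\<close> of the diagram without \<open>1\<^sup>*\<close> and \<open>k\<close> an integer. Modulo \<open>a\<close>, a Coxeter
  transformation becomes the product \<open>w\<close> of the simple reflections of the arms.

  A factorization of \<open>w\<close> into reflections of \<open>W\<close> is a path \<open>1, t\<^sub>1, t\<^sub>1 t\<^sub>2, \<dots>\<close> in \<open>W\<close>. Measured by
  \<open>y \<mapsto> \<langle>\<rho>, \<rho> - y \<rho>\<rangle>\<close>, every peak of the path can be lowered by a Hurwitz move, except a peak \<open>t, t\<close>, which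
  can be pushed to the end. Since \<open>w\<close> is a product of distinct simple reflections, the increasing
  paths to \<open>w\<close> are all in the Hurwitz orbit of the simple one. So a factorization of the Coxeter
  transformation of length at most \<open>|B|\<close> can be moved, modulo \<open>a\<close>, to the simple reflections of the
  arms followed by a pair \<open>s\<^sub>\<delta>, s\<^sub>\<delta>\<close>.

  In the cover, the pair is \<open>s\<close> at \<open>\<delta> + k a\<close> and at \<open>\<delta> + l a\<close>. Evaluating the product at fundamental coweights
  shows that \<open>l - k = 1\<close> and that \<open>\<delta>\<close> has coefficient \<open>1\<close> at \<open>\<alpha>\<^sub>1\<close>, up to sign. Moving the pair
  around an arm reflection conjugates \<open>\<delta>\<close>, which leads to \<open>\<delta> = \<alpha>\<^sub>1\<close>; then all levels on the arms vanish, and the pair is shifted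
  to \<open>\<alpha>\<^sub>1, \<alpha>\<^sub>1 + a\<close>.

  Coweights exist because the form is nondegenerate on the span of the roots of \<open>W\<close>, extended by \<open>b'\<close> in the
  tubular case.
\<close>

section \<open>Hurwitz moves on lists of roots\<close>

text \<open>This is the reflection only for vectors of norm 2, as all roots here are. It is total on
  the type, so products can be formed without restriction to a subspace.\<close>

definition rfl :: "('v::real_vector \<Rightarrow> 'v \<Rightarrow> real) \<Rightarrow> 'v \<Rightarrow> 'v \<Rightarrow> 'v" where
  "rfl F x v = v - F x v *\<^sub>R x"

definition rprod :: "('v::real_vector \<Rightarrow> 'v \<Rightarrow> real) \<Rightarrow> 'v list \<Rightarrow> 'v \<Rightarrow> 'v" where
  "rprod F xs = foldr (rfl F) xs"

lemma rprod_simps [simp]: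
  "rprod F [] v = v"
  "rprod F (x # xs) v = rfl F x (rprod F xs v)"
  "rprod F (xs @ ys) v = rprod F xs (rprod F ys v)"
  by (simp_all add: rprod_def)

text \<open>Sign changes are moves because only the reflections at the listed vectors matter.\<close>

inductive hmove :: "('v::real_vector \<Rightarrow> 'v \<Rightarrow> real) \<Rightarrow> 'v list \<Rightarrow> 'v list \<Rightarrow> bool" for F where
  right: "hmove F (ps @ [x, y] @ qs) (ps @ [y, rfl F y x] @ qs)"
| left: "hmove F (ps @ [x, y] @ qs) (ps @ [rfl F x y, x] @ qs)"
| neg: "hmove F (ps @ [x] @ qs) (ps @ [- x] @ qs)"

abbreviation hurw :: "('v::real_vector \<Rightarrow> 'v \<Rightarrow> real) \<Rightarrow> 'v list \<Rightarrow> 'v list \<Rightarrow> bool" where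
  "hurw F \<equiv> (hmove F)\<^sup>*\<^sup>*"

lemma hmove_append: "hmove F xs ys \<Longrightarrow> hmove F (ps @ xs @ qs) (ps @ ys @ qs)"
proof (induction rule: hmove.induct)
  case (right as x y bs)
  show ?case using hmove.right[of F "ps @ as" x y "bs @ qs"] by simp
next
  case (left as x y bs)
  show ?case using hmove.left[of F "ps @ as" x y "bs @ qs"] by simp
next
  case (neg as x bs)
  show ?case using hmove.neg[of F "ps @ as" x "bs @ qs"] by simp
qed

lemma hurw_append:
  assumes "hurw F xs ys"
  shows "hurw F (ps @ xs @ qs) (ps @ ys @ qs)"
  using assms by (induction rule: rtranclp_induct) (auto intro: rtranclp.rtrancl_into_rtrancl hmove_append)

lemma hurw_append1: "hurw F xs ys \<Longrightarrow> hurw F (xs @ qs) (ys @ qs)"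
  using hurw_append[of F xs ys "[]"] by simp

lemma hurw_append2: "hurw F xs ys \<Longrightarrow> hurw F (ps @ xs) (ps @ ys)"
  using hurw_append[of F xs ys _ "[]"] by simp

lemma hurw_right: "hurw F [x, y] [y, rfl F y x]"
  using hmove.right[of F "[]" x y "[]"] by auto

lemma hurw_left: "hurw F [x, y] [rfl F x y, x]"
  using hmove.left[of F "[]" x y "[]"] by auto

lemma hurw_neg: "hurw F [x] [- x]"
  using hmove.neg[of F "[]" x "[]"] by auto

lemma hurw_length: "hurw F xs ys \<Longrightarrow> length ys = length xs"
  by (induction rule: rtranclp_induct) (auto elim!: hmove.cases)

lemma hurw_closed:
  assumes "hurw F xs ys" "set xs \<subseteq> R"
    and "\<And>x y. x \<in> R \<Longrightarrow> y \<in> R \<Longrightarrow> rfl F x y \<in> R" "\<And>x. x \<in> R \<Longrightarrow> - x \<in> R"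
  shows "set ys \<subseteq> R"
  using assms(1) by (induction rule: rtranclp_induct) (use assms(2-) in \<open>auto elim!: hmove.cases\<close>)

text \<open>A move is given by its position and kind, so it can be repeated on preimages. With
  \<open>g = fst\<close>, this lifts moves of roots modulo \<open>a\<close> to roots with
  levels.\<close>

lemma hurw_lift:
  assumes "hurw F xs ys" "map g zs = xs"
    and refl: "\<And>z w. g (rfl G z w) = rfl F (g z) (g w)" and neg: "\<And>z. g (- z) = - g z"
  shows "\<exists>ws. hurw G zs ws \<and> map g ws = ys"
  using assms(1)
proof (induction rule: rtranclp_induct)
  case (step ys ys')
  then obtain ws where ws: "hurw G zs ws" "map g ws = ys" by blast
  from step(2) have "\<exists>ws'. hmove G ws ws' \<and> map g ws' = ys'"
  proof cases
    case (right ps x y qs)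
    then obtain ps' x' y' qs' where "ws = ps' @ [x', y'] @ qs'" "map g ps' = ps" "g x' = x" "g y' = y" "map g qs' = qs"
      using ws(2) by (auto simp: map_eq_append_conv map_eq_Cons_conv)
    with right show ?thesis
      by (intro exI[of _ "ps' @ [y', rfl G y' x'] @ qs'"]) (auto simp: refl intro: hmove.right[simplified])
  next
    case (left ps x y qs)
    then obtain ps' x' y' qs' where "ws = ps' @ [x', y'] @ qs'" "map g ps' = ps" "g x' = x" "g y' = y" "map g qs' = qs"
      using ws(2) by (auto simp: map_eq_append_conv map_eq_Cons_conv)
    with left show ?thesis
      by (intro exI[of _ "ps' @ [rfl G x' y', x'] @ qs'"]) (auto simp: refl intro: hmove.left[simplified])
  next
    case (neg ps x qs)
    then obtain ps' x' qs' where "ws = ps' @ [x'] @ qs'" "map g ps' = ps" "g x' = x" "map g qs' = qs"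
      using ws(2) by (auto simp: map_eq_append_conv map_eq_Cons_conv)
    with neg show ?thesis
      by (intro exI[of _ "ps' @ [- x'] @ qs'"]) (auto simp: assms(4) intro: hmove.neg[simplified])
  qed
  then obtain ws' where "hmove G ws ws'" "map g ws' = ys'" by blast
  with ws(1) show ?case by (intro exI[of _ ws']) (simp add: rtranclp.rtrancl_into_rtrancl)
qed (use assms(2) in blast)

text \<open>Compatibility of \<open>g\<close> with reflections is demanded only on the invariant set
  \<open>R\<close>, since for \<open>unlift\<close> it is established only over
  \<open>base_space\<close>.\<close>

lemma hurw_transport:
  assumes "hurw G zs ws" "set zs \<subseteq> R"
    and closed: "\<And>x y. x \<in> R \<Longrightarrow> y \<in> R \<Longrightarrow> rfl G x y \<in> R" "\<And>x. x \<in> R \<Longrightarrow> - x \<in> R"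
    and g: "\<And>x y. x \<in> R \<Longrightarrow> y \<in> R \<Longrightarrow> g (rfl G x y) = rfl F (g x) (g y)" "\<And>x. g (- x) = - g x"
  shows "hurw F (map g zs) (map g ws)"
  using assms(1)
proof (induction rule: rtranclp_induct)
  case (step ys ys')
  have R: "set ys \<subseteq> R" using hurw_closed[OF step(1) assms(2)] closed by blast
  from step(2) have "hmove F (map g ys) (map g ys')"
  proof cases
    case (right ps x y qs)
    then show ?thesis using R g hmove.right[of F "map g ps" "g x" "g y" "map g qs"] by simp
  next
    case (left ps x y qs)
    then show ?thesis using R g hmove.left[of F "map g ps" "g x" "g y" "map g qs"] by simp
  next
    case (neg ps x qs)
    then show ?thesis using R g hmove.neg[of F "map g ps" "g x" "map g qs"] by simp
  qed
  with step.IH show ?case by (rule rtranclp.rtrancl_into_rtrancl)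
qed simp

section \<open>Reflections of a symmetric bilinear form\<close>

locale symmetric_form =
  fixes F :: "'v::real_vector \<Rightarrow> 'v \<Rightarrow> real"
  assumes bil: "bilinear F" and sym: "F x y = F y x"
begin

lemmas lin = bilinear_ladd[OF bil] bilinear_radd[OF bil] bilinear_lsub[OF bil] bilinear_rsub[OF bil]
  bilinear_lmul[OF bil] bilinear_rmul[OF bil] bilinear_lneg[OF bil] bilinear_rneg[OF bil]
  bilinear_lzero[OF bil] bilinear_rzero[OF bil]

lemma form_sum_left: "F (\<Sum>i\<in>A. f i) y = (\<Sum>i\<in>A. F (f i) y)"
  by (induction A rule: infinite_finite_induct) (simp_all add: lin)

lemma rfl_lin:
  "rfl F x (u + v) = rfl F x u + rfl F x v" "rfl F x (u - v) = rfl F x u - rfl F x v"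
  "rfl F x (c *\<^sub>R v) = c *\<^sub>R rfl F x v" "rfl F x (- v) = - rfl F x v" "rfl F x 0 = 0"
  by (simp_all add: rfl_def lin algebra_simps)

lemma rfl_uminus: "rfl F (- x) = rfl F x"
  by (simp add: rfl_def lin fun_eq_iff)

lemma rfl_self: "F x x = 2 \<Longrightarrow> rfl F x x = - x"
  by (simp add: rfl_def scaleR_2)

lemma rfl_rfl: "F x x = 2 \<Longrightarrow> rfl F x (rfl F x v) = v"
  by (simp add: rfl_def lin)

lemma rfl_iso: "F x x = 2 \<Longrightarrow> F (rfl F x u) (rfl F x v) = F u v"
  by (simp add: rfl_def lin sym[of u x] algebra_simps)

lemma rfl_adj: "F (rfl F x u) v = F u (rfl F x v)"
  by (simp add: rfl_def lin sym[of u x] algebra_simps)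

text \<open>Since \<open>rfl F x\<close> is a self-adjoint involution, conjugating by it replaces
  both occurrences of \<open>y\<close> in the reflection formula by
  \<open>rfl F x y\<close>.\<close>

lemma rfl_conj: "F x x = 2 \<Longrightarrow> rfl F (rfl F x y) v = rfl F x (rfl F y (rfl F x v))"
proof -
  assume x: "F x x = 2"
  have "rfl F x (rfl F y (rfl F x v)) = rfl F x (rfl F x v) - F y (rfl F x v) *\<^sub>R rfl F x y"
    by (simp add: rfl_def[of F y] rfl_lin)
  also have "\<dots> = v - F (rfl F x y) v *\<^sub>R rfl F x y"
    by (simp add: rfl_rfl[OF x] rfl_adj)
  finally show ?thesis by (simp add: rfl_def[of F "rfl F x y"])
qed

lemma rprod_lin:
  "rprod F xs (u + v) = rprod F xs u + rprod F xs v" "rprod F xs (u - v) = rprod F xs u - rprod F xs v"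
  "rprod F xs (c *\<^sub>R v) = c *\<^sub>R rprod F xs v" "rprod F xs (- v) = - rprod F xs v" "rprod F xs 0 = 0"
  by (induction xs) (simp_all add: rfl_lin)

lemma rprod_iso: "(\<And>x. x \<in> set xs \<Longrightarrow> F x x = 2) \<Longrightarrow> F (rprod F xs u) (rprod F xs v) = F u v"
  by (induction xs) (simp_all add: rfl_iso)

lemma rprod_rev: "(\<And>x. x \<in> set xs \<Longrightarrow> F x x = 2) \<Longrightarrow> rprod F xs (rprod F (rev xs) v) = v"
  by (induction xs arbitrary: v) (simp_all add: rfl_rfl)

lemma rprod_rev': "(\<And>x. x \<in> set xs \<Longrightarrow> F x x = 2) \<Longrightarrow> rprod F (rev xs) (rprod F xs v) = v"
  using rprod_rev[of "rev xs"] by simp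

lemma rprod_conj:
  "(\<And>x. x \<in> set xs \<Longrightarrow> F x x = 2) \<Longrightarrow> rfl F (rprod F xs y) v = rprod F xs (rfl F y (rprod F (rev xs) v))"
  by (induction xs arbitrary: v) (simp_all add: rfl_conj)

lemma hurw_norm:
  assumes "hurw F xs ys" "\<And>x. x \<in> set xs \<Longrightarrow> F x x = 2"
  shows "\<forall>y\<in>set ys. F y y = 2"
  using hurw_closed[of F xs ys "{x. F x x = 2}"] assms by (auto simp: rfl_iso lin)

lemma hurw_rprod:
  assumes "hurw F xs ys" "\<And>x. x \<in> set xs \<Longrightarrow> F x x = 2"
  shows "rprod F ys v = rprod F xs v"
  using assms(1)
proof (induction rule: rtranclp_induct)
  case (step ys zs)
  have "\<forall>y\<in>set ys. F y y = 2" using hurw_norm step(1) assms(2) by blast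
  with step(2) have "rprod F zs v = rprod F ys v"
    by cases (simp_all add: rfl_conj rfl_rfl rfl_uminus)
  then show ?case using step.IH by simp
qed simp

text \<open>Passing \<open>y\<close> leftwards conjugates it by each entry in turn, hence by the
  product of \<open>xs\<close>.\<close>

lemma hurw_past_left: "hurw F (xs @ [y]) (rprod F xs y # xs)"
proof (induction xs)
  case (Cons x xs)
  have "hurw F (x # xs @ [y]) (x # rprod F xs y # xs)"
    using hurw_append2[OF Cons, of "[x]"] by simp
  also have "hurw F (x # rprod F xs y # xs) (rfl F x (rprod F xs y) # x # xs)"
    using hurw_append1[OF hurw_left[of F x "rprod F xs y"], of xs] by simp
  finally show ?case by simp
qed simp

text \<open>Two equal reflections cancel, so they pass an entry without changing it; only the pair
  itself gets conjugated.\<close>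

lemma hurw_pair_right:
  "\<exists>r'. hurw F ([r, r] @ qs) (qs @ [r', r'])"
proof (induction qs arbitrary: r)
  case (Cons x qs)
  let ?r = "rfl F x r"
  have "hurw F [r, r, x] [r, x, ?r]"
    using hurw_append2[OF hurw_right[of F r x], of "[r]"] by simp
  also have "hurw F [r, x, ?r] [x, ?r, ?r]"
    using hurw_append1[OF hurw_right[of F r x], of "[?r]"] by simp
  finally have "hurw F ([r, r] @ x # qs) ([x] @ ([?r, ?r] @ qs))"
    using hurw_append1[of F "[r,r,x]" "[x, ?r, ?r]" qs] by simp
  moreover obtain r' where "hurw F ([?r, ?r] @ qs) (qs @ [r', r'])"
    using Cons by blast
  then have "hurw F ([x] @ ([?r, ?r] @ qs)) ([x] @ (qs @ [r', r']))"
    by (rule hurw_append2)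
  ultimately show ?case by (auto intro: rtranclp_trans)
qed auto

end

section \<open>Simply laced root systems\<close>

text \<open>The \<open>\<omega> i\<close> act as fundamental coweights, realised in the same space
  through \<open>F\<close>. They read off coordinates in the simple roots, so positivity makes sense
  even where \<open>F\<close> is indefinite or degenerate.\<close>

locale simply_laced = symmetric_form F for F :: "'v::real_vector \<Rightarrow> 'v \<Rightarrow> real" +
  fixes I :: "'i set" and \<alpha> \<omega> :: "'i \<Rightarrow> 'v"
  assumes fin: "finite I"
    and norm2: "i \<in> I \<Longrightarrow> F (\<alpha> i) (\<alpha> i) = 2"
    and gram01: "i \<in> I \<Longrightarrow> j \<in> I \<Longrightarrow> i \<noteq> j \<Longrightarrow> F (\<alpha> i) (\<alpha> j) = 0 \<or> F (\<alpha> i) (\<alpha> j) = - 1"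
    and dual: "i \<in> I \<Longrightarrow> j \<in> I \<Longrightarrow> F (\<omega> i) (\<alpha> j) = (if i = j then 1 else 0)"
begin

definition act :: "'i list \<Rightarrow> 'v \<Rightarrow> 'v" where "act w = rprod F (map \<alpha> w)"

lemma act_simps [simp]: "act [] v = v" "act (i # w) v = rfl F (\<alpha> i) (act w v)"
  "act (w @ w') v = act w (act w' v)"
  by (simp_all add: act_def)

lemma act_lin:
  "act w (u + v) = act w u + act w v" "act w (u - v) = act w u - act w v"
  "act w (c *\<^sub>R v) = c *\<^sub>R act w v" "act w (- v) = - act w v" "act w 0 = 0"
  by (simp_all add: act_def rprod_lin)

lemma act_rev: "set w \<subseteq> I \<Longrightarrow> act w (act (rev w) v) = v" "set w \<subseteq> I \<Longrightarrow> act (rev w) (act w v) = v"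
  using rprod_rev[of "map \<alpha> w" v] rprod_rev'[of "map \<alpha> w" v] norm2
  by (auto simp: act_def rev_map subset_iff)

lemma act_iso: "set w \<subseteq> I \<Longrightarrow> F (act w u) (act w v) = F u v"
  unfolding act_def by (rule rprod_iso) (use norm2 in auto)

lemma act_conj: "set w \<subseteq> I \<Longrightarrow> rfl F (act w y) v = act w (rfl F y (act (rev w) v))"
  using rprod_conj[of "map \<alpha> w" y v] norm2 by (auto simp: act_def rev_map subset_iff)

section \<open>Length and positivity\<close>

definition nonneg :: "'v \<Rightarrow> bool" where "nonneg v \<longleftrightarrow> (\<forall>j\<in>I. F (\<omega> j) v \<ge> 0)"

text \<open>This is the length of the linear map \<open>act w\<close>, not of the word: equality of
  maps takes the place of equality in an abstract Coxeter group.\<close>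

definition len :: "'i list \<Rightarrow> nat" where
  "len w = (LEAST n. \<exists>w'. set w' \<subseteq> I \<and> length w' = n \<and> act w' = act w)"

lemma len_le: "set w' \<subseteq> I \<Longrightarrow> act w' = act w \<Longrightarrow> len w \<le> length w'"
  unfolding len_def by (rule Least_le) blast

lemma len_ex: "set w \<subseteq> I \<Longrightarrow> \<exists>w'. set w' \<subseteq> I \<and> length w' = len w \<and> act w' = act w"
  unfolding len_def by (rule LeastI_ex) blast

lemma len_cong: "act w = act w' \<Longrightarrow> len w = len w'"
  by (simp add: len_def)

lemma len_append: "set w \<subseteq> I \<Longrightarrow> set u \<subseteq> I \<Longrightarrow> len (w @ u) \<le> len w + length u"
proof -
  assume a: "set w \<subseteq> I" "set u \<subseteq> I"
  then obtain w' where w': "set w' \<subseteq> I" "length w' = len w" "act w' = act w" using len_ex by blast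
  have "len (w @ u) \<le> length (w' @ u)"
    by (rule len_le) (use a w' in \<open>auto simp: fun_eq_iff\<close>)
  then show ?thesis using w' by simp
qed

text \<open>Strong induction on the length: the last letter \<open>t\<close> of a reduced word is
  split off, and the reflections of \<open>t\<close> and \<open>i\<close> either commute or satisfy
  the braid relation, the only cases in a simply laced system. This link between length and
  positivity is the source of the sign coherence of roots.\<close>

lemma nonneg_act:
  assumes "set w \<subseteq> I" "i \<in> I" "len w \<le> len (w @ [i])"
  shows "nonneg (act w (\<alpha> i))"
  using assms
proof (induction "len w" arbitrary: w i rule: less_induct)
  case less
  obtain w' where w': "set w' \<subseteq> I" "length w' = len w" "act w' = act w" using len_ex less by blast
  show ?case
  proof (cases w' rule: rev_cases)
    case Nil
    then have "act w (\<alpha> i) = \<alpha> i" using w'(3)[symmetric] by simp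
    then show ?thesis using dual less by (simp add: nonneg_def)
  next
    case (snoc v t)
    have v: "set v \<subseteq> I" "t \<in> I" "len w = Suc (length v)" and actw: "act w x = act v (rfl F (\<alpha> t) x)" for x
      using w' snoc by (auto simp flip: w'(3))
    have "len v \<le> length v" by (rule len_le) (use v in auto)
    moreover have lw: "len w = len (v @ [t])" using w'(3) snoc len_cong by metis
    then have "len w \<le> len v + 1" using len_append[of v "[t]"] v by simp
    ultimately have lv: "len w = Suc (len v)" using v by simp
    have lwi: "len (w @ [i]) = len (v @ [t, i])" by (rule len_cong) (simp add: fun_eq_iff actw)
    \<comment> \<open>Otherwise the new letter would cancel \<open>t\<close> and shorten the
      word.\<close>
    have "t \<noteq> i"
    proof
      assume "t = i"
      then have "len (v @ [t, i]) = len v" by (intro len_cong) (use less(3) in \<open>simp add: fun_eq_iff rfl_rfl norm2\<close>)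
      with lwi lv less(4) show False by simp
    qed
    with gram01 v less(3) consider "F (\<alpha> t) (\<alpha> i) = 0" | "F (\<alpha> t) (\<alpha> i) = -1" by metis
    then show ?thesis
    proof cases
      \<comment> \<open>The two reflections commute, so \<open>act w (\<alpha> i)\<close> equals
        \<open>act v (\<alpha> i)\<close> and \<open>v\<close> inherits the length
        hypothesis.\<close>
      case 1
      have "act (v @ [t, i]) = act (v @ [i, t])"
        using 1 by (simp add: fun_eq_iff rfl_def lin sym[of "\<alpha> i" "\<alpha> t"] algebra_simps)
      then have "len (w @ [i]) = len ((v @ [i]) @ [t])" using lwi len_cong[of "v @ [t, i]" "v @ [i, t]"] by simp
      then have "len (w @ [i]) \<le> len (v @ [i]) + 1" using len_append[of "v @ [i]" "[t]"] v less by simp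
      then have "len v \<le> len (v @ [i])" using less(4) lv by simp
      then have "nonneg (act v (\<alpha> i))" using less lv v by auto
      moreover have "act w (\<alpha> i) = act v (\<alpha> i)" using 1 by (simp add: actw rfl_def)
      ultimately show ?thesis by simp
    next
      case 2
      have ti: "act w (\<alpha> i) = act v (\<alpha> i) + act v (\<alpha> t)"
        using 2 by (simp add: actw rfl_def act_lin)
      show ?thesis
      proof (cases "len v \<le> len (v @ [i])")
        case True
        then have "nonneg (act v (\<alpha> i))" using less lv v by auto
        moreover have "nonneg (act v (\<alpha> t))" by (rule less.hyps) (use lw lv v in auto)
        ultimately show ?thesis by (simp add: ti nonneg_def lin)
      next
        case False
        \<comment> \<open>Now \<open>i\<close> shortens \<open>v\<close>. As
          \<open>\<alpha> i + \<alpha> t\<close> is also the image of \<open>\<alpha> t\<close>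
          under the reflection at \<open>\<alpha> i\<close>, the shorter \<open>u\<close> with
          \<open>t\<close> can replace \<open>w\<close> with \<open>i\<close>; the braid relation
          transfers the length hypothesis.\<close>
        define u where "u = v @ [i]"
        have u: "set u \<subseteq> I" using v less u_def by auto
        have "act u (\<alpha> t) = act v (\<alpha> i) + act v (\<alpha> t)"
          using 2 sym[of "\<alpha> t" "\<alpha> i"] by (simp add: u_def rfl_def act_lin)
        with ti have eq: "act w (\<alpha> i) = act u (\<alpha> t)" by simp
        have "len u \<le> len (u @ [t])"
        proof (rule ccontr)
          assume c: "\<not> len u \<le> len (u @ [t])"
          have st: "rfl F (\<alpha> i) (\<alpha> t) = rfl F (\<alpha> t) (\<alpha> i)"
            using 2 sym[of "\<alpha> t" "\<alpha> i"] by (simp add: rfl_def)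
          have *: "F (\<alpha> i) (\<alpha> i) = 2" "F (\<alpha> t) (\<alpha> t) = 2" using norm2 less v by auto
          have braid: "rfl F (\<alpha> i) (rfl F (\<alpha> t) (rfl F (\<alpha> i) x)) = rfl F (\<alpha> t) (rfl F (\<alpha> i) (rfl F (\<alpha> t) x))" for x
            using st by (simp flip: rfl_conj[OF *(1)] rfl_conj[OF *(2)])
          have "act (v @ [t, i]) = act ((u @ [t]) @ [i, t])"
            by (simp add: fun_eq_iff u_def flip: braid) (simp add: rfl_rfl *)
          then have "len (w @ [i]) = len ((u @ [t]) @ [i, t])" using lwi len_cong[of "v @ [t, i]"] by metis
          also have "\<dots> \<le> len (u @ [t]) + 2" using len_append[of "u @ [t]" "[i, t]"] u v less by simp
          finally show False using c False lv less(4) by (simp add: u_def)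
        qed
        moreover have "len u < len w" using False lv by (simp add: u_def)
        ultimately show ?thesis using less.hyps[of u t] u v eq by simp
      qed
    qed
  qed
qed

section \<open>Real roots, their coordinates and inversions\<close>

definition Phi :: "'v set" where "Phi = {act w (\<alpha> i) | w i. set w \<subseteq> I \<and> i \<in> I}"

text \<open>Pairing with this vector is the height of a root, and its orbit will measure the
  elements of the group.\<close>

definition \<rho> :: 'v where "\<rho> = (\<Sum>i\<in>I. \<omega> i)"

lemma height: "F \<rho> v = (\<Sum>i\<in>I. F (\<omega> i) v)"
  by (simp add: \<rho>_def form_sum_left)

lemma height_simple: "i \<in> I \<Longrightarrow> F \<rho> (\<alpha> i) = 1"
  using fin by (simp add: height dual sum.delta)

lemma simple_Phi: "i \<in> I \<Longrightarrow> \<alpha> i \<in> Phi"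
  unfolding Phi_def by (intro CollectI exI[of _ "[]"] exI[of _ i]) simp

lemma act_Phi: "set w \<subseteq> I \<Longrightarrow> \<beta> \<in> Phi \<Longrightarrow> act w \<beta> \<in> Phi"
  unfolding Phi_def
proof -
  assume w: "set w \<subseteq> I" and "\<beta> \<in> {act w (\<alpha> i) | w i. set w \<subseteq> I \<and> i \<in> I}"
  then obtain u i where "set u \<subseteq> I" "i \<in> I" "\<beta> = act u (\<alpha> i)" by blast
  with w show "act w \<beta> \<in> {act w (\<alpha> i) | w i. set w \<subseteq> I \<and> i \<in> I}"
    by (intro CollectI exI[of _ "w @ u"] exI[of _ i]) simp
qed

lemma Phi_norm: "\<beta> \<in> Phi \<Longrightarrow> F \<beta> \<beta> = 2"
  by (auto simp: Phi_def act_iso norm2)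

lemma Phi_rfl_act: "\<beta> \<in> Phi \<Longrightarrow> \<exists>w. set w \<subseteq> I \<and> act w = rfl F \<beta>"
proof -
  assume "\<beta> \<in> Phi"
  then obtain u i where u: "set u \<subseteq> I" "i \<in> I" "\<beta> = act u (\<alpha> i)" by (auto simp: Phi_def)
  then show ?thesis
    by (intro exI[of _ "u @ [i] @ rev u"]) (simp add: act_conj fun_eq_iff)
qed

lemma Phi_rfl: "\<beta> \<in> Phi \<Longrightarrow> \<gamma> \<in> Phi \<Longrightarrow> rfl F \<beta> \<gamma> \<in> Phi"
  by (metis Phi_rfl_act act_Phi)

lemma Phi_uminus: "\<beta> \<in> Phi \<Longrightarrow> - \<beta> \<in> Phi"
  using Phi_rfl[of \<beta> \<beta>] by (simp add: rfl_self Phi_norm)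

lemma Phi_rprod_act: "set xs \<subseteq> Phi \<Longrightarrow> \<exists>w. set w \<subseteq> I \<and> act w = rprod F xs"
proof (induction xs)
  case (Cons x xs)
  then obtain w where "set w \<subseteq> I" "act w = rprod F xs" by auto
  moreover obtain u where "set u \<subseteq> I" "act u = rfl F x" using Cons.prems Phi_rfl_act[of x] by auto
  ultimately show ?case by (intro exI[of _ "u @ w"]) (simp add: fun_eq_iff)
qed (auto intro!: exI[of _ "[]"] simp: fun_eq_iff)

lemma Phi_rprod: "set xs \<subseteq> Phi \<Longrightarrow> \<beta> \<in> Phi \<Longrightarrow> rprod F xs \<beta> \<in> Phi"
  by (metis Phi_rprod_act act_Phi)

lemma gram_Ints: "i \<in> I \<Longrightarrow> j \<in> I \<Longrightarrow> F (\<alpha> i) (\<alpha> j) \<in> \<int>"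
  using norm2[of i] gram01[of i j] by (cases "i = j") auto

text \<open>Reflecting at \<open>\<alpha> j\<close> changes only the coordinate at \<open>j\<close>,
  by \<open>F (\<alpha> j) v\<close>. Both integrality claims share one induction because the first
  needs the second at each step.\<close>

lemma Phi_lattice:
  assumes "\<beta> \<in> Phi"
  shows "\<beta> = (\<Sum>i\<in>I. F (\<omega> i) \<beta> *\<^sub>R \<alpha> i) \<and> (\<forall>i\<in>I. F (\<omega> i) \<beta> \<in> \<int> \<and> F (\<alpha> i) \<beta> \<in> \<int>)"
proof -
  obtain w k where w: "set w \<subseteq> I" "k \<in> I" "\<beta> = act w (\<alpha> k)" using assms by (auto simp: Phi_def)
  have "act w (\<alpha> k) = (\<Sum>i\<in>I. F (\<omega> i) (act w (\<alpha> k)) *\<^sub>R \<alpha> i) \<and>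
      (\<forall>i\<in>I. F (\<omega> i) (act w (\<alpha> k)) \<in> \<int> \<and> F (\<alpha> i) (act w (\<alpha> k)) \<in> \<int>)"
    using w(1)
  proof (induction w)
    case Nil
    then show ?case using w fin by (simp add: dual gram_Ints if_distrib[of "\<lambda>c. c *\<^sub>R _"] sum.delta cong: if_cong)
  next
    case (Cons j w)
    define v where "v = act w (\<alpha> k)"
    have j: "j \<in> I" using Cons by auto
    have v: "v = (\<Sum>i\<in>I. F (\<omega> i) v *\<^sub>R \<alpha> i)" "\<And>i. i \<in> I \<Longrightarrow> F (\<omega> i) v \<in> \<int> \<and> F (\<alpha> i) v \<in> \<int>"
      using Cons by (auto simp: v_def)
    have co: "F (\<omega> i) (rfl F (\<alpha> j) v) = F (\<omega> i) v - (if i = j then F (\<alpha> j) v else 0)" if "i \<in> I" for i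
      using that j by (simp add: rfl_def lin dual)
    have "(\<Sum>i\<in>I. F (\<omega> i) (rfl F (\<alpha> j) v) *\<^sub>R \<alpha> i)
        = (\<Sum>i\<in>I. F (\<omega> i) v *\<^sub>R \<alpha> i - (if i = j then F (\<alpha> j) v *\<^sub>R \<alpha> j else 0))"
      by (intro sum.cong) (auto simp: co algebra_simps)
    also have "\<dots> = rfl F (\<alpha> j) v"
      using j fin v(1) by (simp add: sum_subtractf sum.delta rfl_def)
    finally have "rfl F (\<alpha> j) v = (\<Sum>i\<in>I. F (\<omega> i) (rfl F (\<alpha> j) v) *\<^sub>R \<alpha> i)" by simp
    moreover have "F (\<omega> i) (rfl F (\<alpha> j) v) \<in> \<int> \<and> F (\<alpha> i) (rfl F (\<alpha> j) v) \<in> \<int>" if "i \<in> I" for i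
      using v(2)[OF that] v(2)[OF j] gram_Ints[OF that j] by (auto simp: co[OF that]) (simp add: rfl_def lin)
    ultimately show ?case by (simp add: v_def)
  qed
  then show ?thesis using w by simp
qed

lemma Phi_expand: "\<beta> \<in> Phi \<Longrightarrow> \<beta> = (\<Sum>i\<in>I. F (\<omega> i) \<beta> *\<^sub>R \<alpha> i)"
  and Phi_coord_Ints: "\<beta> \<in> Phi \<Longrightarrow> i \<in> I \<Longrightarrow> F (\<omega> i) \<beta> \<in> \<int>"
  using Phi_lattice by blast+

lemma Phi_Ints: "\<beta> \<in> Phi \<Longrightarrow> \<gamma> \<in> Phi \<Longrightarrow> F \<beta> \<gamma> \<in> \<int>"
proof -
  assume a: "\<beta> \<in> Phi" "\<gamma> \<in> Phi"
  have "F \<beta> \<gamma> = F (\<Sum>i\<in>I. F (\<omega> i) \<beta> *\<^sub>R \<alpha> i) \<gamma>" using Phi_expand[OF a(1)] by simp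
  also have "\<dots> = (\<Sum>i\<in>I. F (\<omega> i) \<beta> * F (\<alpha> i) \<gamma>)" by (simp add: form_sum_left lin)
  also have "\<dots> \<in> \<int>" using Phi_lattice a by (intro Ints_sum Ints_mult) auto
  finally show ?thesis .
qed

text \<open>If appending \<open>i\<close> shortens \<open>w\<close>, then \<open>nonneg_act\<close>
  applies to \<open>w @ [i]\<close>, which sends \<open>\<alpha> i\<close> to the negative of the
  root.\<close>

lemma Phi_coherent: "\<beta> \<in> Phi \<Longrightarrow> nonneg \<beta> \<or> nonneg (- \<beta>)"
proof -
  assume "\<beta> \<in> Phi"
  then obtain w i where w: "set w \<subseteq> I" "i \<in> I" "\<beta> = act w (\<alpha> i)" by (auto simp: Phi_def)
  show ?thesis
  proof (cases "len w \<le> len (w @ [i])")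
    case True
    then show ?thesis using w nonneg_act by simp
  next
    case False
    have "len ((w @ [i]) @ [i]) = len w"
      by (rule len_cong) (use w in \<open>simp add: fun_eq_iff rfl_rfl norm2\<close>)
    then have "nonneg (act (w @ [i]) (\<alpha> i))" using False w by (intro nonneg_act) auto
    then show ?thesis using w by (simp add: rfl_self norm2 act_lin)
  qed
qed

lemma Phi_nonzero: "\<beta> \<in> Phi \<Longrightarrow> \<exists>i\<in>I. F (\<omega> i) \<beta> \<noteq> 0"
proof (rule ccontr)
  assume a: "\<beta> \<in> Phi" "\<not> (\<exists>i\<in>I. F (\<omega> i) \<beta> \<noteq> 0)"
  then have "\<beta> = 0" using Phi_expand[OF a(1)] by simp
  then show False using Phi_norm[OF a(1)] by (simp add: lin)
qed

lemma nonneg_height: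
  assumes b: "\<beta> \<in> Phi" and "nonneg \<beta>"
  shows "F \<rho> \<beta> > 0"
proof -
  obtain i where "i \<in> I" "F (\<omega> i) \<beta> \<noteq> 0" using Phi_nonzero[OF b] by blast
  moreover have "0 \<le> F (\<omega> j) \<beta>" if "j \<in> I" for j using that assms(2) by (simp add: nonneg_def)
  ultimately show ?thesis unfolding height
    by (intro sum_pos2[OF fin \<open>i \<in> I\<close>]) (auto simp: order_less_le)
qed

lemma Phi_pos_iff:
  assumes b: "\<beta> \<in> Phi"
  shows "F \<rho> \<beta> > 0 \<longleftrightarrow> nonneg \<beta>"
proof (cases "nonneg \<beta>")
  case True
  then show ?thesis using nonneg_height[OF b] by simp
next
  case False
  then have "F \<rho> (- \<beta>) > 0" using Phi_coherent[OF b] nonneg_height[OF Phi_uminus[OF b]] by blast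
  then show ?thesis using False by (simp add: lin)
qed

lemma Phi_height_nonzero:
  assumes b: "\<beta> \<in> Phi"
  shows "F \<rho> \<beta> \<noteq> 0"
  using Phi_coherent[OF b] nonneg_height[OF b] nonneg_height[OF Phi_uminus[OF b]] bilinear_rneg[OF bil, of \<rho> \<beta>] by auto

lemma Phi_height_Ints: "\<beta> \<in> Phi \<Longrightarrow> F \<rho> \<beta> \<in> \<int>"
  unfolding height by (intro Ints_sum) (rule Phi_coord_Ints)

text \<open>The reflection alters only the coordinate at \<open>i\<close>, so a change of sign
  forces all others to vanish; among the multiples of \<open>\<alpha> i\<close>, norm and sign leave
  just \<open>\<alpha> i\<close>.\<close>

lemma simple_unique_inversion:
  assumes "\<beta> \<in> Phi" "i \<in> I" "F \<rho> \<beta> > 0" "F \<rho> (rfl F (\<alpha> i) \<beta>) < 0"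
  shows "\<beta> = \<alpha> i"
proof -
  have *: "- rfl F (\<alpha> i) \<beta> \<in> Phi" using assms Phi_rfl simple_Phi Phi_uminus by blast
  have p: "nonneg \<beta>" "nonneg (- rfl F (\<alpha> i) \<beta>)"
    using assms Phi_pos_iff[of \<beta>] Phi_pos_iff[OF *] by (auto simp: lin)
  have zero: "F (\<omega> j) \<beta> = 0" if "j \<in> I" "j \<noteq> i" for j
    using that p assms(2) by (force simp: nonneg_def rfl_def lin dual)
  have "(\<Sum>j\<in>I. F (\<omega> j) \<beta> *\<^sub>R \<alpha> j) = (\<Sum>j\<in>I. if j = i then F (\<omega> i) \<beta> *\<^sub>R \<alpha> i else 0)"
    by (intro sum.cong) (auto simp: zero)
  then have eq: "\<beta> = F (\<omega> i) \<beta> *\<^sub>R \<alpha> i"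
    using Phi_expand[OF assms(1)] fin assms(2) by (simp add: sum.delta)
  obtain c where c: "c = F (\<omega> i) \<beta>" by simp
  have \<beta>: "\<beta> = c *\<^sub>R \<alpha> i" using eq c by simp
  have "F \<beta> \<beta> = 2 * c\<^sup>2" unfolding \<beta> using assms(2) by (simp add: lin norm2 power2_eq_square)
  then have "c\<^sup>2 = 1" using Phi_norm[OF assms(1)] by simp
  moreover have "c \<ge> 0" using p assms(2) by (simp add: nonneg_def c)
  ultimately have "c = 1" by (simp add: power2_eq_1_iff)
  then show ?thesis using \<beta> by simp
qed

text \<open>By \<open>simple_unique_inversion\<close>, each further letter creates at most one new
  inversion. Finiteness is what excludes infinite positive strings in
  \<open>dihedral_height_bound\<close>.\<close>

lemma finite_inversions: "set w \<subseteq> I \<Longrightarrow> finite {\<beta> \<in> Phi. F \<rho> \<beta> > 0 \<and> F \<rho> (act w \<beta>) < 0}"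
proof (induction w)
  case Nil
  then show ?case by (auto intro!: finite_subset[of _ "{}"])
next
  case (Cons i w)
  have i: "i \<in> I" "set w \<subseteq> I" using Cons by auto
  have "{\<beta> \<in> Phi. F \<rho> \<beta> > 0 \<and> F \<rho> (act (i # w) \<beta>) < 0}
      \<subseteq> {\<beta> \<in> Phi. F \<rho> \<beta> > 0 \<and> F \<rho> (act w \<beta>) < 0} \<union> {act (rev w) (\<alpha> i)}"
  proof (rule subsetI)
    fix \<beta> assume \<beta>: "\<beta> \<in> {\<beta> \<in> Phi. F \<rho> \<beta> > 0 \<and> F \<rho> (act (i # w) \<beta>) < 0}"
    then have b: "act w \<beta> \<in> Phi" using act_Phi i by auto
    show "\<beta> \<in> {\<beta> \<in> Phi. F \<rho> \<beta> > 0 \<and> F \<rho> (act w \<beta>) < 0} \<union> {act (rev w) (\<alpha> i)}"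
    proof (cases "F \<rho> (act w \<beta>) < 0")
      case False
      then have "act w \<beta> = \<alpha> i"
        using \<beta> i Phi_height_nonzero[OF b] by (intro simple_unique_inversion b) auto
      then show ?thesis using act_rev(2)[OF i(2), of \<beta>] by simp
    qed (use \<beta> in auto)
  qed
  moreover have "finite ({\<beta> \<in> Phi. F \<rho> \<beta> > 0 \<and> F \<rho> (act w \<beta>) < 0} \<union> {act (rev w) (\<alpha> i)})"
    using Cons i by simp
  ultimately show ?case by (rule finite_subset)
qed

end


section \<open>Lowering peaks\<close>

text \<open>For roots \<open>x\<close>, \<open>y\<close> and \<open>c = F x y\<close>, each new term
  is minus the reflection of the term before last at the last one. This produces a string of roots
  of the dihedral group of \<open>x\<close> and \<open>y\<close>.\<close>

fun dih :: "real \<Rightarrow> 'v::real_vector \<Rightarrow> 'v \<Rightarrow> nat \<Rightarrow> 'v" where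
  "dih c x y 0 = x"
| "dih c x y (Suc 0) = y"
| "dih c x y (Suc (Suc n)) = c *\<^sub>R dih c x y (Suc n) - dih c x y n"

definition dbl :: "'a list \<Rightarrow> 'a list" where "dbl rs = concat (map (\<lambda>r. [r, r]) rs)"

lemma dbl_simps [simp]: "dbl [] = []" "dbl (r # rs) = r # r # dbl rs" "dbl (rs @ rs') = dbl rs @ dbl rs'"
  by (simp_all add: dbl_def)

lemma length_dbl [simp]: "length (dbl rs) = 2 * length rs"
  by (induction rs) simp_all

lemma set_dbl [simp]: "set (dbl rs) = set rs"
  by (induction rs) auto

text \<open>In \<open>peak_move\<close>, \<open>b\<close> and \<open>g\<close> are the heights of
  the two roots at a peak, \<open>b'\<close> and \<open>- g'\<close> the heights of their images
  under the entries before them, and \<open>c\<close> is their inner product. The left sides are the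
  rises after the two possible Hurwitz moves. If both moves failed, weighting the inequalities with
  \<open>b\<close> and \<open>g\<close> would give \<open>b * g' < g * b'\<close> and its
  opposite.\<close>

lemma peak_inequality:
  fixes b g b' g' c :: real
  assumes "b > 0" "g > 0" "b' > 0" "g' > 0" and c: "c * (b * g) < b\<^sup>2 + g\<^sup>2"
  shows "g * (c * b' - g') < b * b' \<or> (g - c * b) * (- g') < b * b'"
proof (rule ccontr)
  assume "\<not> ?thesis"
  then have 1: "b * b' + g * g' \<le> c * g * b'" and 2: "b * b' + g * g' \<le> c * b * g'"
    by (simp_all add: algebra_simps)
  have "b * (b * b' + g * g') \<le> b * (c * g * b')" using 1 assms by simp
  also have "\<dots> = c * (b * g) * b'" by simp
  also have "\<dots> < (b\<^sup>2 + g\<^sup>2) * b'" using c assms by (intro mult_strict_right_mono)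
  finally have "g * (b * g') < g * (g * b')" by (simp add: algebra_simps power2_eq_square)
  then have 3: "b * g' < g * b'" using assms by simp
  have "g * (b * b' + g * g') \<le> g * (c * b * g')" using 2 assms by simp
  also have "\<dots> = c * (b * g) * g'" by simp
  also have "\<dots> < (b\<^sup>2 + g\<^sup>2) * g'" using c assms by (intro mult_strict_right_mono)
  finally have "b * (g * b') < b * (b * g')" by (simp add: algebra_simps power2_eq_square)
  then have "g * b' < b * g'" using assms by simp
  with 3 show False by simp
qed

context simply_laced
begin

lemma dih_Phi:
  assumes "x \<in> Phi" "y \<in> Phi"
  shows "dih (F x y) x y n \<in> Phi \<and> dih (F x y) x y (Suc n) \<in> Phi \<and>
    F (dih (F x y) x y n) (dih (F x y) x y (Suc n)) = F x y"
proof (induction n)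
  case (Suc n)
  define c where "c = F x y"
  define a where "a = dih c x y n"
  define b where "b = dih c x y (Suc n)"
  have ab: "a \<in> Phi" "b \<in> Phi" "F a b = c" using Suc by (auto simp: a_def b_def c_def)
  have ba: "F b a = c" using ab(3) sym by metis
  have eq: "dih c x y (Suc (Suc n)) = c *\<^sub>R b - a" by (simp add: a_def b_def)
  also have "\<dots> = - rfl F b a" by (simp add: rfl_def ba)
  finally have "dih c x y (Suc (Suc n)) \<in> Phi" using ab Phi_rfl Phi_uminus by simp
  moreover have "F b (c *\<^sub>R b - a) = c" by (simp add: lin Phi_norm ab ba)
  ultimately show ?case using ab eq by (simp add: b_def c_def)
qed (use assms in simp)

text \<open>For consecutive heights \<open>a\<close>, \<open>b\<close>, the expression
  \<open>a\<^sup>2 + b\<^sup>2 - c * (a * b)\<close> is invariant under the recurrence. That it is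
  at most 0 forces the next height to be positive as well.\<close>

lemma dih_height:
  assumes "0 < F \<rho> x" "0 < F \<rho> y" "(F \<rho> x)\<^sup>2 + (F \<rho> y)\<^sup>2 \<le> c * (F \<rho> x * F \<rho> y)"
  shows "0 < F \<rho> (dih c x y n) \<and> 0 < F \<rho> (dih c x y (Suc n)) \<and>
    (F \<rho> (dih c x y n))\<^sup>2 + (F \<rho> (dih c x y (Suc n)))\<^sup>2 \<le> c * (F \<rho> (dih c x y n) * F \<rho> (dih c x y (Suc n)))"
proof (induction n)
  case (Suc n)
  define a where "a = F \<rho> (dih c x y n)"
  define b where "b = F \<rho> (dih c x y (Suc n))"
  have ab: "0 < a" "0 < b" "a\<^sup>2 + b\<^sup>2 \<le> c * (a * b)" using Suc by (auto simp: a_def b_def)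
  have eq: "F \<rho> (dih c x y (Suc (Suc n))) = c * b - a" by (simp add: lin a_def b_def)
  have "a * (c * b - a) \<ge> b\<^sup>2" using ab(3) by (simp add: algebra_simps power2_eq_square)
  moreover have "b\<^sup>2 > 0" using ab by simp
  ultimately have "a * (c * b - a) > 0" by linarith
  then have "c * b - a > 0" using ab(1) by (simp add: zero_less_mult_iff)
  moreover have "b\<^sup>2 + (c * b - a)\<^sup>2 \<le> c * (b * (c * b - a))"
    using ab(3) by (simp add: algebra_simps power2_eq_square)
  ultimately show ?case using ab eq by (simp add: b_def)
qed (use assms in simp)

text \<open>The reflection flips the string about \<open>y\<close>; once both strings are known to
  be positive, this exhibits their terms as inversions.\<close>

lemma rfl_dih:
  assumes "F y y = 2"
  shows "rfl F y (dih (F x y) x y (Suc n)) = - dih (F x y) y x n"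
proof (induction n rule: less_induct)
  case (less n)
  consider "n = 0" | "n = 1" | m where "n = Suc (Suc m)" by (metis One_nat_def not0_implies_Suc)
  then show ?case
  proof cases
    case 3
    have "dih (F x y) x y (Suc n) = F x y *\<^sub>R dih (F x y) x y (Suc (Suc m)) - dih (F x y) x y (Suc m)"
      using 3 dih.simps(3) by blast
    then show ?thesis using less[of "Suc m"] less[of m] 3 by (simp only: rfl_lin) simp
  qed (use assms sym[of y x] in \<open>auto simp: rfl_self rfl_lin\<close>, auto simp: rfl_def algebra_simps)
qed

text \<open>
  Otherwise the reflection at \<open>\<beta>\<close> would invert the infinitely many roots of the dihedral string
  through \<open>\<gamma>\<close> and \<open>\<beta>\<close>, all of which would be positive.
\<close>

lemma dihedral_height_bound:
  assumes "\<beta> \<in> Phi" "\<gamma> \<in> Phi" "F \<rho> \<beta> > 0" "F \<rho> \<gamma> > 0" "\<beta> \<noteq> \<gamma>"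
  shows "F \<beta> \<gamma> * (F \<rho> \<beta> * F \<rho> \<gamma>) < (F \<rho> \<beta>)\<^sup>2 + (F \<rho> \<gamma>)\<^sup>2"
proof -
  \<comment> \<open>Distinct roots differ in some coordinate. The root with the smaller one is
    placed first, so that this coordinate grows along the string.\<close>
  have ordered: False
    if x: "x \<in> Phi" "y \<in> Phi" "F \<rho> x > 0" "F \<rho> y > 0" and i: "i \<in> I" "F (\<omega> i) x < F (\<omega> i) y"
      and bound: "(F \<rho> x)\<^sup>2 + (F \<rho> y)\<^sup>2 \<le> F x y * (F \<rho> x * F \<rho> y)" for x y i
  proof -
    define c where "c = F x y"
    have "0 \<le> (F \<rho> x - F \<rho> y)\<^sup>2" by simp
    then have "2 * (F \<rho> x * F \<rho> y) \<le> c * (F \<rho> x * F \<rho> y)"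
      using bound by (simp add: power2_diff c_def)
    then have c: "c \<ge> 2" using x by (simp add: mult_le_cancel_right)
    have P: "dih c x y n \<in> Phi" "dih c y x n \<in> Phi" for n
      using dih_Phi[of x y n] dih_Phi[of y x n] x sym[of y x] by (auto simp: c_def)
    have h: "F \<rho> (dih c x y n) > 0" "F \<rho> (dih c y x n) > 0" for n
      using dih_height[of x y c n] dih_height[of y x c n] x bound by (auto simp: c_def algebra_simps)
    have nn: "F (\<omega> i) (dih c x y n) \<ge> 0" for n
      using Phi_pos_iff[OF P(1)] h(1) i by (auto simp: nonneg_def)
    \<comment> \<open>Since \<open>c \<ge> 2\<close> and the coordinates are nonnegative, the
      recurrence preserves strict growth. Hence the string contains infinitely many roots.\<close>
    have "F (\<omega> i) (dih c x y n) < F (\<omega> i) (dih c x y (Suc n))" for n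
    proof (induction n)
      case (Suc n)
      have "0 \<le> (c - 2) * F (\<omega> i) (dih c x y (Suc n))" using c nn by simp
      then show ?case using Suc by (simp add: lin algebra_simps)
    qed (use i in simp)
    then have "strict_mono (\<lambda>n. F (\<omega> i) (dih c x y n))" by (rule strict_mono_Suc_iff[THEN iffD2, rule_format])
    then have "inj (\<lambda>n. F (\<omega> i) (dih c x y n))" by (rule strict_mono_imp_inj_on)
    then have "inj (\<lambda>n. dih c x y (Suc n))" by (metis (mono_tags, lifting) injD injI nat.inject)
    then have "infinite (range (\<lambda>n. dih c x y (Suc n)))" by (rule range_inj_infinite)
    moreover obtain w where w: "set w \<subseteq> I" "act w = rfl F y" using Phi_rfl_act x by blast
    have "range (\<lambda>n. dih c x y (Suc n)) \<subseteq> {\<beta> \<in> Phi. F \<rho> \<beta> > 0 \<and> F \<rho> (act w \<beta>) < 0}"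
      using P h rfl_dih[OF Phi_norm[OF x(2)], of x] by (auto simp: w lin c_def)
    ultimately show False using finite_inversions[OF w(1)] finite_subset by blast
  qed
  have "\<exists>i\<in>I. F (\<omega> i) \<beta> \<noteq> F (\<omega> i) \<gamma>"
  proof (rule ccontr)
    assume "\<not> ?thesis"
    then have "(\<Sum>i\<in>I. F (\<omega> i) \<beta> *\<^sub>R \<alpha> i) = (\<Sum>i\<in>I. F (\<omega> i) \<gamma> *\<^sub>R \<alpha> i)"
      by (intro sum.cong) auto
    then show False using Phi_expand assms by simp
  qed
  then obtain i where i: "i \<in> I" "F (\<omega> i) \<beta> < F (\<omega> i) \<gamma> \<or> F (\<omega> i) \<gamma> < F (\<omega> i) \<beta>"
    by (meson neq_iff)
  have "(F \<rho> \<gamma>)\<^sup>2 + (F \<rho> \<beta>)\<^sup>2 \<le> F \<gamma> \<beta> * (F \<rho> \<gamma> * F \<rho> \<beta>)"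
    if "(F \<rho> \<beta>)\<^sup>2 + (F \<rho> \<gamma>)\<^sup>2 \<le> F \<beta> \<gamma> * (F \<rho> \<beta> * F \<rho> \<gamma>)"
    using that sym[of \<beta> \<gamma>] by (simp add: algebra_simps)
  then show ?thesis
    using i assms ordered[of \<beta> \<gamma> i] ordered[of \<gamma> \<beta> i] by (meson not_le)
qed

text \<open>For a list of roots, this is half of \<open>F v v\<close> with
  \<open>v = \<rho> - rprod F xs \<rho>\<close>, because the product is an isometry: a kind of
  distance from the identity.\<close>

definition pot :: "'v list \<Rightarrow> real" where "pot xs = F \<rho> \<rho> - F \<rho> (rprod F xs \<rho>)"

text \<open>Appending a positive root raises the potential exactly when the preceding product keeps
  that root positive.\<close>

lemma pot_snoc: "pot (xs @ [\<beta>]) = pot xs + F \<rho> \<beta> * F \<rho> (rprod F xs \<beta>)"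
  by (simp add: pot_def rfl_def rprod_lin lin sym[of \<beta> \<rho>])

lemma pot_cong: "rprod F xs \<rho> = rprod F ys \<rho> \<Longrightarrow> pot xs = pot ys"
  by (simp add: pot_def)

text \<open>Splitting off the last letter \<open>t\<close> of a reduced word changes the value by
  the height of \<open>act v (\<alpha> t)\<close>, a positive root by \<open>nonneg_act\<close>.
  Integrality is what later turns potentials into a termination measure.\<close>

lemma pot_act:
  assumes "set w \<subseteq> I"
  shows "F \<rho> (act w \<rho>) \<le> F \<rho> \<rho> \<and> F \<rho> \<rho> - F \<rho> (act w \<rho>) \<in> \<int>"
  using assms
proof (induction "len w" arbitrary: w rule: less_induct)
  case less
  obtain w' where w': "set w' \<subseteq> I" "length w' = len w" "act w' = act w" using len_ex less by blast
  show ?case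
  proof (cases w' rule: rev_cases)
    case Nil
    then show ?thesis by (simp flip: w'(3))
  next
    case (snoc v t)
    have v: "set v \<subseteq> I" "t \<in> I" "len w = Suc (length v)" using w' snoc by auto
    have lv: "len v \<le> length v" by (rule len_le) (use v in auto)
    have "len w = len (v @ [t])" using w'(3) snoc len_cong by metis
    then have nn: "nonneg (act v (\<alpha> t))" using lv v by (intro nonneg_act) auto
    have P: "act v (\<alpha> t) \<in> Phi" using v act_Phi simple_Phi by blast
    have "act w \<rho> = act v \<rho> - act v (\<alpha> t)"
      using v(2) snoc by (simp flip: w'(3)) (simp add: rfl_def act_lin sym[of "\<alpha> t" \<rho>] height_simple)
    then have eq: "F \<rho> \<rho> - F \<rho> (act w \<rho>) = F \<rho> \<rho> - F \<rho> (act v \<rho>) + F \<rho> (act v (\<alpha> t))" by (simp add: lin)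
    have "F \<rho> (act v \<rho>) \<le> F \<rho> \<rho> \<and> F \<rho> \<rho> - F \<rho> (act v \<rho>) \<in> \<int>"
      using less.hyps[of v] v lv by simp
    with nonneg_height[OF P nn] Phi_height_Ints[OF P] eq
    show ?thesis by (metis Ints_add add_nonneg_nonneg diff_ge_0_iff_ge less_imp_le)
  qed
qed

lemma pot_nonneg: "set xs \<subseteq> Phi \<Longrightarrow> pot xs \<ge> 0 \<and> pot xs \<in> \<int>"
  using Phi_rprod_act[of xs] pot_act unfolding pot_def by (metis diff_ge_0_iff_ge)

lemma pot_snoc_neq: "set xs \<subseteq> Phi \<Longrightarrow> \<beta> \<in> Phi \<Longrightarrow> pot (xs @ [\<beta>]) \<noteq> pot xs"
  using Phi_height_nonzero Phi_rprod by (simp add: pot_snoc)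

section \<open>Increasing paths and peaks\<close>

definition incr :: "'v list \<Rightarrow> bool" where
  "incr xs \<longleftrightarrow> (\<forall>k<length xs. pot (take k xs) < pot (take (Suc k) xs))"

lemma incr_snoc: "incr (xs @ [x]) \<longleftrightarrow> incr xs \<and> pot xs < pot (xs @ [x])"
  by (auto simp: incr_def less_Suc_eq all_conj_distrib)

lemma incr_or_peak:
  assumes "set xs \<subseteq> Phi"
  shows "incr xs \<or> (\<exists>ps \<beta> \<gamma> qs. xs = ps @ [\<beta>, \<gamma>] @ qs \<and>
     pot ps < pot (ps @ [\<beta>]) \<and> pot (ps @ [\<beta>, \<gamma>]) < pot (ps @ [\<beta>]))"
  using assms
proof (induction xs rule: rev_induct)
  case (snoc \<gamma> xs)
  show ?case
  proof (cases "incr xs")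
    case False
    then obtain ps \<beta> \<gamma>' qs where "xs = ps @ [\<beta>, \<gamma>'] @ qs" "pot ps < pot (ps @ [\<beta>])"
        "pot (ps @ [\<beta>, \<gamma>']) < pot (ps @ [\<beta>])"
      using snoc by auto
    then show ?thesis by (intro disjI2 exI[of _ ps] exI[of _ \<beta>] exI[of _ \<gamma>'] exI[of _ "qs @ [\<gamma>]"]) simp
  next
    case True
    show ?thesis
    proof (cases "pot xs < pot (xs @ [\<gamma>])")
      case False
      then have less: "pot (xs @ [\<gamma>]) < pot xs" using pot_snoc_neq[of xs \<gamma>] snoc by auto
      show ?thesis
      proof (cases xs rule: rev_cases)
        case Nil
        \<comment> \<open>The first step always rises, by the square of the height of
          \<open>\<gamma>\<close>, so the first descent is preceded by a rise.\<close>
        have "pot ([] @ [\<gamma>]) > pot []"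
          using snoc Phi_height_nonzero[of \<gamma>] by (subst pot_snoc) (auto simp: zero_less_mult_iff)
        then show ?thesis using less Nil by simp
      next
        case (snoc ps \<beta>)
        then show ?thesis using less True
          by (intro disjI2 exI[of _ ps] exI[of _ \<beta>] exI[of _ \<gamma>] exI[of _ "[]"]) (auto simp: incr_snoc)
      qed
    qed (use True in \<open>simp add: incr_snoc\<close>)
  qed
qed (simp add: incr_def)

lemma positive_representative:
  assumes "\<beta> \<in> Phi"
  shows "\<exists>\<beta>'\<in>Phi. F \<rho> \<beta>' > 0 \<and> hurw F [\<beta>] [\<beta>'] \<and> rfl F \<beta>' = rfl F \<beta>"
proof (cases "F \<rho> \<beta> > 0")
  case False
  then have "F \<rho> (- \<beta>) > 0" using Phi_height_nonzero[OF assms] by (simp add: lin)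
  then show ?thesis using assms Phi_uminus hurw_neg rfl_uminus by blast
qed (use assms in blast)

text \<open>With positive representatives \<open>x\<close>, \<open>y\<close>, the right move puts
  \<open>y\<close> first and the left move puts \<open>rfl F x y\<close> first. By
  \<open>dihedral_height_bound\<close>, \<open>peak_inequality\<close> applies and one of them ends
  below the peak; the remaining case \<open>x = y\<close> is a repeated reflection.\<close>

lemma peak_move:
  assumes ps: "set ps \<subseteq> Phi" and P: "\<beta> \<in> Phi" "\<gamma> \<in> Phi"
    and peak: "pot ps < pot (ps @ [\<beta>])" "pot (ps @ [\<beta>, \<gamma>]) < pot (ps @ [\<beta>])"
  shows "(\<exists>r. hurw F [\<beta>, \<gamma>] [r, r]) \<or>
    (\<exists>\<beta>' \<gamma>'. hurw F [\<beta>, \<gamma>] [\<beta>', \<gamma>'] \<and> pot (ps @ [\<beta>']) < pot (ps @ [\<beta>]))"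
proof -
  obtain x where x: "x \<in> Phi" "F \<rho> x > 0" "hurw F [\<beta>] [x]" "rfl F x = rfl F \<beta>"
    using positive_representative P by blast
  obtain y where y: "y \<in> Phi" "F \<rho> y > 0" "hurw F [\<gamma>] [y]" "rfl F y = rfl F \<gamma>"
    using positive_representative P by blast
  have "hurw F ([\<beta>] @ [\<gamma>]) ([x] @ [\<gamma>])" using x(3) by (rule hurw_append1)
  moreover have "hurw F ([x] @ [\<gamma>]) ([x] @ [y])" using y(3) by (rule hurw_append2)
  ultimately have xy: "hurw F [\<beta>, \<gamma>] [x, y]" by simp
  have px: "pot (ps @ [x]) = pot (ps @ [\<beta>])" and py: "pot ((ps @ [x]) @ [y]) = pot (ps @ [\<beta>, \<gamma>])"
    by (rule pot_cong; simp add: x y)+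
  define b' where "b' = F \<rho> (rprod F ps x)"
  define g' where "g' = - F \<rho> (rprod F (ps @ [x]) y)"
  define c where "c = F x y"
  have pb: "pot (ps @ [x]) = pot ps + F \<rho> x * b'" by (simp add: pot_snoc b'_def)
  have "0 < F \<rho> x * b'" using peak(1) pb px by simp
  then have b': "b' > 0" using x(2) by (simp add: zero_less_mult_iff)
  have "F \<rho> y * g' > 0" using peak(2) px py by (subst (asm) pot_snoc) (simp add: g'_def)
  then have g': "g' > 0" using y(2) by (simp add: zero_less_mult_iff)
  have g'_eq: "F \<rho> (rprod F ps y) = c * b' - g'"
    by (simp add: g'_def b'_def c_def rfl_def rprod_lin lin)
  show ?thesis
  proof (cases "x = y")
    case False
    have "c * (F \<rho> x * F \<rho> y) < (F \<rho> x)\<^sup>2 + (F \<rho> y)\<^sup>2"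
      unfolding c_def by (rule dihedral_height_bound) (use x y False in auto)
    then consider "F \<rho> y * (c * b' - g') < F \<rho> x * b'" | "(F \<rho> y - c * F \<rho> x) * (- g') < F \<rho> x * b'"
      using peak_inequality[of "F \<rho> x" "F \<rho> y" b' g' c] x y b' g' by blast
    then show ?thesis
    proof cases
      case 1
      then have "pot (ps @ [y]) < pot (ps @ [x])"
        by (simp add: pot_snoc g'_eq b'_def)
      then show ?thesis using px xy hurw_right[of F x y] by (metis rtranclp_trans)
    next
      case 2
      have "F \<rho> (rfl F x y) = F \<rho> y - c * F \<rho> x" by (simp add: rfl_def lin c_def)
      moreover have "F \<rho> (rprod F ps (rfl F x y)) = - g'" by (simp add: g'_def)
      ultimately have "pot (ps @ [rfl F x y]) < pot (ps @ [x])"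
        using 2 by (simp add: pot_snoc b'_def)
      then show ?thesis using px xy hurw_left[of F x y] by (metis rtranclp_trans)
    qed
  qed (use xy in blast)
qed

text \<open>Potentials of lists of roots are nonnegative integers, so the rounding loses
  nothing.\<close>

definition total_pot :: "'v list \<Rightarrow> nat" where
  "total_pot xs = (\<Sum>k\<le>length xs. nat \<lfloor>pot (take k xs)\<rfloor>)"

text \<open>A move on two adjacent entries keeps their product, hence alters a single point of the
  path.\<close>

lemma total_pot_less:
  assumes Phi: "set (ps @ [\<beta>, \<gamma>] @ qs) \<subseteq> Phi" and hw: "hurw F [\<beta>, \<gamma>] [\<beta>', \<gamma>']"
    and less: "pot (ps @ [\<beta>']) < pot (ps @ [\<beta>])"
  shows "total_pot (ps @ [\<beta>', \<gamma>'] @ qs) < total_pot (ps @ [\<beta>, \<gamma>] @ qs)"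
proof -
  have "set [\<beta>', \<gamma>'] \<subseteq> Phi" by (rule hurw_closed[OF hw]) (use Phi Phi_rfl Phi_uminus in auto)
  then have "pot (ps @ [\<beta>']) \<in> \<int>" "pot (ps @ [\<beta>]) \<in> \<int>" "pot (ps @ [\<beta>']) \<ge> 0"
    using pot_nonneg Phi by auto
  then have strict: "nat \<lfloor>pot (ps @ [\<beta>'])\<rfloor> < nat \<lfloor>pot (ps @ [\<beta>])\<rfloor>"
    using less by (auto elim!: Ints_cases)
  have prod: "rprod F [\<beta>', \<gamma>'] v = rprod F [\<beta>, \<gamma>] v" for v
    by (rule hurw_rprod[OF hw]) (use Phi Phi_norm in auto)
  have other: "pot (take k (ps @ [\<beta>', \<gamma>'] @ qs)) = pot (take k (ps @ [\<beta>, \<gamma>] @ qs))" if "k \<noteq> Suc (length ps)" for k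
  proof (cases "k \<le> length ps")
    case False
    then obtain l where "k = length ps + Suc (Suc l)" using \<open>k \<noteq> _\<close>
      by (intro that[of "k - Suc (Suc (length ps))"]) auto
    then show ?thesis using prod by (intro pot_cong) simp
  qed simp
  let ?n = "length ps + (2 + length qs)"
  have "(\<Sum>k\<le>?n. nat \<lfloor>pot (take k (ps @ [\<beta>', \<gamma>'] @ qs))\<rfloor>) < (\<Sum>k\<le>?n. nat \<lfloor>pot (take k (ps @ [\<beta>, \<gamma>] @ qs))\<rfloor>)"
  proof (rule sum_strict_mono_ex1)
    have "nat \<lfloor>pot (take k (ps @ [\<beta>', \<gamma>'] @ qs))\<rfloor> \<le> nat \<lfloor>pot (take k (ps @ [\<beta>, \<gamma>] @ qs))\<rfloor>" for k
    proof (cases "k = Suc (length ps)")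
      case True
      have "take (Suc (length ps)) (ps @ [x, y] @ qs) = ps @ [x]" for x y by simp
      then show ?thesis unfolding True using strict less_imp_le by metis
    qed (use other in simp)
    then show "\<forall>k\<in>{..?n}. nat \<lfloor>pot (take k (ps @ [\<beta>', \<gamma>'] @ qs))\<rfloor> \<le> nat \<lfloor>pot (take k (ps @ [\<beta>, \<gamma>] @ qs))\<rfloor>"
      by blast
    show "\<exists>k\<in>{..?n}. nat \<lfloor>pot (take k (ps @ [\<beta>', \<gamma>'] @ qs))\<rfloor> < nat \<lfloor>pot (take k (ps @ [\<beta>, \<gamma>] @ qs))\<rfloor>"
      using strict by (intro bexI[of _ "Suc (length ps)"]) auto
  qed simp
  then show ?thesis by (simp add: total_pot_def)
qed


text \<open>
  A peak of the path \<open>1, t\<^sub>1, t\<^sub>1 t\<^sub>2, \<dots>\<close> is lowered by a Hurwitz move, unless the two reflections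
  meeting there coincide; such pairs are pushed to the end.
\<close>

lemma increasing_normal_form:
  assumes "set xs \<subseteq> Phi"
  shows "\<exists>ys rs. hurw F xs (ys @ dbl rs) \<and> incr ys"
  using assms
\<comment> \<open>Removing a repeated pair shortens the list; lowering a peak keeps the length and
  decreases \<open>total_pot\<close>.\<close>
proof (induction xs rule: wf_induct_rule[OF wf_measures[of "[length, total_pot]"]])
  case (1 xs)
  show ?case
  proof (cases "incr xs")
    case True
    then show ?thesis by (intro exI[of _ xs] exI[of _ "[]"]) simp
  next
    case False
    then obtain ps \<beta> \<gamma> qs where xs: "xs = ps @ [\<beta>, \<gamma>] @ qs"
        and peak: "pot ps < pot (ps @ [\<beta>])" "pot (ps @ [\<beta>, \<gamma>]) < pot (ps @ [\<beta>])"
      using incr_or_peak 1 by blast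
    have P: "set ps \<subseteq> Phi" "\<beta> \<in> Phi" "\<gamma> \<in> Phi" "set qs \<subseteq> Phi" using 1 xs by auto
    from peak_move[OF P(1-3) peak] show ?thesis
    proof (elim disjE exE conjE)
      fix r assume "hurw F [\<beta>, \<gamma>] [r, r]"
      then have 2: "hurw F xs (ps @ [r, r] @ qs)" unfolding xs by (rule hurw_append)
      obtain r' where "hurw F ([r, r] @ qs) (qs @ [r', r'])" using hurw_pair_right by blast
      then have "hurw F (ps @ [r, r] @ qs) (ps @ qs @ [r', r'])" by (rule hurw_append2)
      with 2 have 3: "hurw F xs ((ps @ qs) @ [r', r'])" by simp
      obtain ys rs where ys: "hurw F (ps @ qs) (ys @ dbl rs)" "incr ys"
        using "1.IH"[of "ps @ qs"] P xs by auto
      have "hurw F ((ps @ qs) @ [r', r']) ((ys @ dbl rs) @ [r', r'])" by (rule hurw_append1[OF ys(1)])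
      with 3 have "hurw F xs (ys @ dbl (rs @ [r']))" by simp
      then show ?thesis using ys by blast
    next
      fix \<beta>' \<gamma>' assume a: "hurw F [\<beta>, \<gamma>] [\<beta>', \<gamma>']" "pot (ps @ [\<beta>']) < pot (ps @ [\<beta>])"
      then have 2: "hurw F xs (ps @ [\<beta>', \<gamma>'] @ qs)" unfolding xs by (intro hurw_append)
      have "set (ps @ [\<beta>', \<gamma>'] @ qs) \<subseteq> Phi" by (rule hurw_closed[OF 2 "1.prems"]) (use Phi_rfl Phi_uminus in auto)
      moreover have "total_pot (ps @ [\<beta>', \<gamma>'] @ qs) < total_pot xs"
        using total_pot_less[OF _ a] 1 xs by simp
      ultimately obtain ys rs where "hurw F (ps @ [\<beta>', \<gamma>'] @ qs) (ys @ dbl rs)" "incr ys"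
        using "1.IH"[of "ps @ [\<beta>', \<gamma>'] @ qs"] xs by auto
      with 2 show ?thesis by (meson rtranclp_trans)
    qed
  qed
qed

section \<open>Increasing paths to a product of distinct simple reflections\<close>

lemma coord_act: "set w \<subseteq> I \<Longrightarrow> i \<in> I \<Longrightarrow> i \<notin> set w \<Longrightarrow> F (\<omega> i) (act w v) = F (\<omega> i) v"
  by (induction w) (auto simp: rfl_def lin dual)

text \<open>A form of the exchange property: the sign changes at some letter \<open>i\<close>, where
  the root must be simple. Multiplying by the reflection at \<open>\<beta>\<close> then deletes this
  letter from the word.\<close>

lemma inversion_split:
  assumes "set is \<subseteq> I" "\<beta> \<in> Phi" "F \<rho> \<beta> > 0" "F \<rho> (act is \<beta>) < 0"
  shows "\<exists>js i ks. is = js @ [i] @ ks \<and> act ks \<beta> = \<alpha> i"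
  using assms
proof (induction "is")
  case (Cons i "is")
  have P: "act is \<beta> \<in> Phi" using act_Phi Cons by simp
  show ?case
  proof (cases "F \<rho> (act is \<beta>) < 0")
    case True
    then obtain js j ks where "is = js @ [j] @ ks" "act ks \<beta> = \<alpha> j" using Cons by auto
    then show ?thesis by (intro exI[of _ "i # js"] exI[of _ j] exI[of _ ks]) simp
  next
    case False
    then have "act is \<beta> = \<alpha> i"
      using Cons Phi_height_nonzero[OF P] by (intro simple_unique_inversion P) auto
    then show ?thesis by (intro exI[of _ "[]"] exI[of _ i] exI[of _ "is"]) simp
  qed
qed simp

end

text \<open>The values of the cover form are prescribed on a subspace only, so products of
  reflections are compared on \<open>U\<close>. As \<open>U\<close> contains simple roots and
  coweights, coordinates can be read off there.\<close>

locale simply_laced_space = simply_laced F I \<alpha> \<omega>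
  for F :: "'v::real_vector \<Rightarrow> 'v \<Rightarrow> real" and I :: "'i set" and \<alpha> \<omega> +
  fixes U :: "'v set"
  assumes subspace_U: "subspace U" and \<alpha>_U: "i \<in> I \<Longrightarrow> \<alpha> i \<in> U" and \<omega>_U: "i \<in> I \<Longrightarrow> \<omega> i \<in> U"
begin

lemma Phi_U: "\<beta> \<in> Phi \<Longrightarrow> \<beta> \<in> U"
  using Phi_expand[of \<beta>] subspace_U \<alpha>_U by (metis (mono_tags, lifting) subspace_sum subspace_scale)

lemma rfl_U: "x \<in> U \<Longrightarrow> u \<in> U \<Longrightarrow> rfl F x u \<in> U"
  unfolding rfl_def using subspace_U by (intro subspace_diff subspace_scale)

text \<open>The last rise means that the whole product inverts the last root, so removing this root
  corresponds to deleting one letter of \<open>is\<close>. The letters stay distinct and the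
  induction applies. Moving the last root back to the left past \<open>ks\<close> turns it into the
  missing simple root.\<close>

lemma increasing_simple:
  assumes "set ys \<subseteq> Phi" "incr ys" "distinct is" "set is \<subseteq> I"
    and "\<And>u. u \<in> U \<Longrightarrow> rprod F ys u = act is u"
  shows "hurw F ys (map \<alpha> is)"
  using assms
proof (induction "length is" arbitrary: ys "is" rule: less_induct)
  case less
  show ?case
  proof (cases ys rule: rev_cases)
    case Nil
    \<comment> \<open>A nonempty word with distinct letters is not the identity: it turns the simple
      root of its last letter into a vector with coordinate -1 there.\<close>
    have "is = []"
    proof (cases "is" rule: rev_cases)
      case (snoc js i)
      then have i: "i \<in> I" "i \<notin> set js" "set js \<subseteq> I" using less by auto
      have "F (\<omega> i) (act is (\<alpha> i)) = - 1"
        using i by (simp add: snoc rfl_self norm2 act_lin lin coord_act dual)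
      moreover have "act is (\<alpha> i) = \<alpha> i" using less(6)[OF \<alpha>_U[OF i(1)]] Nil by simp
      ultimately show ?thesis using i by (simp add: dual)
    qed
    then show ?thesis using Nil by simp
  next
    case (snoc ys' \<beta>)
    have P: "set ys' \<subseteq> Phi" "\<beta> \<in> Phi" and inc: "incr ys'" "pot ys' < pot (ys' @ [\<beta>])"
      using less snoc by (auto simp: incr_snoc)
    obtain x where x: "x \<in> Phi" "F \<rho> x > 0" "hurw F [\<beta>] [x]" "rfl F x = rfl F \<beta>"
      using positive_representative P by blast
    have eq: "rprod F ys' (rfl F x u) = act is u" if "u \<in> U" for u
      using less(6)[OF that] snoc x by simp
    have "pot (ys' @ [\<beta>]) = pot (ys' @ [x])" by (rule pot_cong) (simp add: x)
    then have "F \<rho> x * F \<rho> (rprod F ys' x) > 0" using inc(2) by (simp add: pot_snoc)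
    then have "F \<rho> (rprod F ys' x) > 0" using x(2) by (simp add: zero_less_mult_iff)
    moreover have "rprod F ys' (rfl F x x) = - rprod F ys' x"
      by (simp add: rfl_self Phi_norm x(1) rprod_lin)
    ultimately have "F \<rho> (act is x) < 0" using eq[OF Phi_U[OF x(1)]] by (simp add: lin)
    then obtain js i ks where split: "is = js @ [i] @ ks" "act ks x = \<alpha> i"
      using inversion_split less x by blast
    have I: "set js \<subseteq> I" "set ks \<subseteq> I" "i \<in> I" using less split by auto
    have "rprod F ys' u = act (js @ ks) u" if "u \<in> U" for u
    proof -
      have "rprod F ys' u = rprod F ys' (rfl F x (rfl F x u))" by (simp add: rfl_rfl Phi_norm x(1))
      also have "\<dots> = act is (rfl F x u)" by (rule eq) (use rfl_U Phi_U x that in blast)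
      also have "act ks (rfl F x u) = rfl F (\<alpha> i) (act ks u)"
        using act_conj[OF I(2), of x "act ks u"] by (simp add: split act_rev I)
      then have "act is (rfl F x u) = act (js @ ks) u"
        by (simp add: split(1) rfl_rfl norm2 I)
      finally show ?thesis .
    qed
    then have "hurw F ys' (map \<alpha> (js @ ks))"
      using less.hyps[of "js @ ks" ys'] P inc less split by auto
    then have "hurw F (ys' @ [\<beta>]) (map \<alpha> (js @ ks) @ [\<beta>])" by (rule hurw_append1)
    also have "hurw F (map \<alpha> (js @ ks) @ [\<beta>]) (map \<alpha> (js @ ks) @ [x])" by (rule hurw_append2) fact
    also have "hurw F (map \<alpha> js @ (map \<alpha> ks @ [x])) (map \<alpha> js @ (rprod F (map \<alpha> ks) x # map \<alpha> ks))"
      by (rule hurw_append2[OF hurw_past_left])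
    then have "hurw F (map \<alpha> (js @ ks) @ [x]) (map \<alpha> is)"
      using split by (simp add: act_def)
    finally show ?thesis using snoc by simp
  qed
qed

text \<open>The pairs multiply to the identity, so the increasing part has the same product as the
  whole list.\<close>

lemma coxeter_normal_form:
  assumes "set xs \<subseteq> Phi" "distinct is" "set is \<subseteq> I" "\<And>u. u \<in> U \<Longrightarrow> rprod F xs u = act is u"
  shows "\<exists>rs. hurw F xs (map \<alpha> is @ dbl rs)"
proof -
  obtain ys rs where ys: "hurw F xs (ys @ dbl rs)" "incr ys"
    using increasing_normal_form assms by blast
  have P: "set (ys @ dbl rs) \<subseteq> Phi"
    by (rule hurw_closed[OF ys(1) assms(1)]) (use Phi_rfl Phi_uminus in auto)
  have "set rs \<subseteq> Phi \<Longrightarrow> rprod F (dbl rs) u = u" for u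
    by (induction rs) (auto simp: rfl_rfl Phi_norm)
  then have "rprod F ys u = rprod F (ys @ dbl rs) u" for u using P by simp
  also have "rprod F (ys @ dbl rs) u = rprod F xs u" for u
    by (rule hurw_rprod[OF ys(1)]) (use assms Phi_norm in auto)
  finally have "hurw F ys (map \<alpha> is)"
    using P ys assms by (intro increasing_simple) auto
  then have "hurw F (ys @ dbl rs) (map \<alpha> is @ dbl rs)" by (rule hurw_append1)
  with ys(1) show ?thesis by (meson rtranclp_trans)
qed

end


section \<open>Affine levels\<close>

context simply_laced_space
begin

text \<open>A pair \<open>(\<beta>, k)\<close> stands for the vector \<open>\<beta> + k a\<close>, where \<open>a\<close> is isotropic and orthogonal to \<open>U\<close>.\<close>

definition lform :: "'v \<times> real \<Rightarrow> 'v \<times> real \<Rightarrow> real" where "lform z w = F (fst z) (fst w)"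

sublocale L: symmetric_form lform
proof
  have "linear (lform z)" "linear (\<lambda>w. lform w z)" for z
    by (rule linearI; simp add: lform_def lin)+
  then show "bilinear lform" by (simp add: bilinear_def)
  show "lform x y = lform y x" for x y by (simp add: lform_def sym)
qed

lemma rfl_lform: "rfl lform z w = (rfl F (fst z) (fst w), snd w - F (fst z) (fst w) * snd z)"
  by (simp add: rfl_def lform_def prod_eq_iff)

lemma fst_rprod_lform: "fst (rprod lform zs w) = rprod F (map fst zs) (fst w)"
  by (induction zs) (simp_all add: rfl_lform)

abbreviation roots :: "('v \<times> real) set" where "roots \<equiv> Phi \<times> \<int>"

lemma roots_rfl: "x \<in> roots \<Longrightarrow> y \<in> roots \<Longrightarrow> rfl lform x y \<in> roots"
  by (auto simp: rfl_lform Phi_rfl Phi_Ints)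

lemma roots_uminus: "x \<in> roots \<Longrightarrow> - x \<in> roots"
  by (auto simp: Phi_uminus)

lemma roots_norm: "x \<in> roots \<Longrightarrow> lform x x = 2"
  by (auto simp: lform_def Phi_norm)

lemma roots_hurw: "hurw lform xs ys \<Longrightarrow> set xs \<subseteq> roots \<Longrightarrow> set ys \<subseteq> roots"
  using hurw_closed[of lform xs ys roots] roots_rfl roots_uminus by blast

text \<open>Modulo \<open>a\<close>, the pair is a repeated reflection and acts trivially, so the
  entries it passes change at most in level.\<close>

lemma pair_pass_left:
  assumes "F \<delta> \<delta> = 2"
  shows "\<exists>as'. map fst as' = map fst as \<and> hurw lform (as @ [(\<delta>, k), (\<delta>, l)]) ([(\<delta>, k), (\<delta>, l)] @ as')"
proof (induction as)
  case (Cons x as)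
  then obtain as' where as': "map fst as' = map fst as"
      "hurw lform (as @ [(\<delta>, k), (\<delta>, l)]) ([(\<delta>, k), (\<delta>, l)] @ as')" by blast
  let ?x = "rfl lform (\<delta>, k) x" let ?y = "rfl lform (\<delta>, l) ?x"
  have "hurw lform (x # as @ [(\<delta>, k), (\<delta>, l)]) (x # [(\<delta>, k), (\<delta>, l)] @ as')"
    using hurw_append2[OF as'(2), of "[x]"] by simp
  also have "hurw lform (x # [(\<delta>, k), (\<delta>, l)] @ as') ((\<delta>, k) # ?x # (\<delta>, l) # as')"
    using hurw_append1[OF hurw_right[of lform x "(\<delta>, k)"], of "(\<delta>, l) # as'"] by simp
  also have "hurw lform ((\<delta>, k) # ?x # (\<delta>, l) # as') ((\<delta>, k) # (\<delta>, l) # ?y # as')"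
    using hurw_append[OF hurw_right[of lform ?x "(\<delta>, l)"], of "[(\<delta>, k)]" as'] by simp
  finally show ?case using as'(1) assms
    by (intro exI[of _ "?y # as'"]) (simp add: rfl_lform rfl_rfl)
qed simp

lemma pair_pass_right:
  assumes "F \<delta> \<delta> = 2"
  shows "\<exists>as'. map fst as' = map fst as \<and> hurw lform ([(\<delta>, k), (\<delta>, l)] @ as) (as' @ [(\<delta>, k), (\<delta>, l)])"
proof (induction as)
  case (Cons x as)
  then obtain as' where as': "map fst as' = map fst as"
      "hurw lform ([(\<delta>, k), (\<delta>, l)] @ as) (as' @ [(\<delta>, k), (\<delta>, l)])" by blast
  let ?x = "rfl lform (\<delta>, l) x" let ?y = "rfl lform (\<delta>, k) ?x"
  have "hurw lform ([(\<delta>, k), (\<delta>, l)] @ x # as) ((\<delta>, k) # ?x # (\<delta>, l) # as)"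
    using hurw_append[OF hurw_left[of lform "(\<delta>, l)" x], of "[(\<delta>, k)]" as] by simp
  also have "hurw lform ((\<delta>, k) # ?x # (\<delta>, l) # as) (?y # [(\<delta>, k), (\<delta>, l)] @ as)"
    using hurw_append1[OF hurw_left[of lform "(\<delta>, k)" ?x], of "(\<delta>, l) # as"] by simp
  also have "hurw lform (?y # [(\<delta>, k), (\<delta>, l)] @ as) (?y # as' @ [(\<delta>, k), (\<delta>, l)])"
    using hurw_append2[OF as'(2), of "[?y]"] by simp
  finally show ?case using as'(1) assms
    by (intro exI[of _ "?y # as'"]) (simp add: rfl_lform rfl_rfl)
qed simp

text \<open>The pair travels left to \<open>x\<close>, is reflected while crossing it, and returns
  to the end of the list.\<close>

lemma pair_conj:
  assumes "F \<delta> \<delta> = 2" "F (fst x) (fst x) = 2"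
  shows "\<exists>as'. map fst as' = map fst (as @ [x] @ bs) \<and>
    hurw lform ((as @ [x] @ bs) @ [(\<delta>, k), (\<delta>, l)]) (as' @ [rfl lform x (\<delta>, k), rfl lform x (\<delta>, l)])"
proof -
  let ?P = "[(\<delta>, k), (\<delta>, l)]" let ?Q = "[rfl lform x (\<delta>, k), rfl lform x (\<delta>, l)]"
  define \<epsilon> where "\<epsilon> = rfl F (fst x) \<delta>"
  obtain k' l' where Q: "?Q = [(\<epsilon>, k'), (\<epsilon>, l')]" by (simp add: rfl_lform \<epsilon>_def)
  have \<epsilon>: "F \<epsilon> \<epsilon> = 2" using assms by (simp add: \<epsilon>_def rfl_iso)
  obtain bs' where bs': "map fst bs' = map fst bs" "hurw lform (bs @ ?P) (?P @ bs')"
    using pair_pass_left[OF assms(1)] by blast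
  obtain cs where cs: "map fst cs = map fst (x # bs')" "hurw lform (?Q @ x # bs') (cs @ ?Q)"
    unfolding Q using pair_pass_right[OF \<epsilon>] by blast
  have "hurw lform ((as @ [x] @ bs) @ ?P) ((as @ [x]) @ ?P @ bs')"
    using hurw_append2[OF bs'(2), of "as @ [x]"] by simp
  also have "hurw lform ((as @ [x]) @ ?P @ bs') (as @ rfl lform x (\<delta>, k) # x # (\<delta>, l) # bs')"
    using hurw_append[OF hurw_left[of lform x "(\<delta>, k)"], of as "(\<delta>, l) # bs'"] by simp
  also have "hurw lform (as @ rfl lform x (\<delta>, k) # x # (\<delta>, l) # bs') (as @ ?Q @ x # bs')"
    using hurw_append[OF hurw_left[of lform x "(\<delta>, l)"], of "as @ [rfl lform x (\<delta>, k)]" bs'] by simp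
  also have "hurw lform (as @ ?Q @ x # bs') (as @ cs @ ?Q)"
    by (rule hurw_append2[OF cs(2)])
  finally show ?thesis using cs(1) bs'(1)
    by (intro exI[of _ "as @ cs"]) simp
qed

text \<open>The reflections at the levels of \<open>\<delta>\<close> form an infinite dihedral
  group, in which a Hurwitz move of two neighbours shifts the pair by one level in either
  direction.\<close>

lemma pair_shift:
  assumes "F \<delta> \<delta> = 2"
  shows "hurw lform [(\<delta>, of_int n), (\<delta>, of_int n + 1)] [(\<delta>, 0), (\<delta>, 1)]"
proof -
  have up: "hurw lform [(\<delta>, k), (\<delta>, k + 1)] [(\<delta>, k + 1), (\<delta>, k + 1 + 1)]" for k
  proof -
    have "rfl lform (\<delta>, k + 1) (\<delta>, k) = - (\<delta>, k + 1 + 1)"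
      using assms by (simp add: rfl_lform rfl_self)
    then have "hurw lform [(\<delta>, k), (\<delta>, k + 1)] [(\<delta>, k + 1), - (\<delta>, k + 1 + 1)]"
      by (metis hurw_right)
    also have "hurw lform \<dots> [(\<delta>, k + 1), (\<delta>, k + 1 + 1)]"
      using hurw_append2[OF hurw_neg[of lform "- (\<delta>, k + 1 + 1)"], of "[(\<delta>, k + 1)]"] by (simp add: algebra_simps)
    finally show ?thesis .
  qed
  have down: "hurw lform [(\<delta>, k + 1), (\<delta>, k + 1 + 1)] [(\<delta>, k), (\<delta>, k + 1)]" for k
  proof -
    have "rfl lform (\<delta>, k + 1) (\<delta>, k + 1 + 1) = - (\<delta>, k)"
      using assms by (simp add: rfl_lform rfl_self)
    then have "hurw lform [(\<delta>, k + 1), (\<delta>, k + 1 + 1)] [- (\<delta>, k), (\<delta>, k + 1)]"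
      by (metis hurw_left)
    also have "hurw lform \<dots> [(\<delta>, k), (\<delta>, k + 1)]"
      using hurw_append1[OF hurw_neg[of lform "- (\<delta>, k)"], of "[(\<delta>, k + 1)]"] by simp
    finally show ?thesis .
  qed
  show ?thesis
  proof (induction n rule: int_induct[where k = 0])
    case base
    then show ?case by simp
  next
    case (step1 n)
    then show ?case using down[of "of_int n"] by (simp add: rtranclp_trans add.commute)
  next
    case (step2 n)
    then show ?case using up[of "of_int n - 1"] by (simp add: rtranclp_trans)
  qed
qed

section \<open>Reading off levels with coweights\<close>

lemma rprod_fixes:
  assumes "map fst as = map \<alpha> is" "set is \<subseteq> I" "j \<in> I" "j \<notin> set is"
  shows "rprod lform as (\<omega> j, x) = (\<omega> j, x)"
  using assms
proof (induction as arbitrary: "is")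
  case (Cons a as)
  then obtain i is' where i: "is = i # is'" "fst a = \<alpha> i" "map fst as = map \<alpha> is'" by auto
  then have "F (\<alpha> i) (\<omega> j) = 0" using Cons dual[of j i] sym[of "\<omega> j" "\<alpha> i"] by auto
  then show ?case using Cons.IH[of is'] i Cons.prems by (simp add: rfl_lform rfl_def lform_def)
qed simp

text \<open>The linear parts cancel; what remains is a transvection along \<open>a\<close> that sees
  only the difference of the levels.\<close>

lemma rprod_pair:
  assumes "F \<delta> \<delta> = 2"
  shows "rprod lform [(\<delta>, k), (\<delta>, l)] (u, x) = (u, x + F \<delta> u * (k - l))"
  using assms by (simp add: rfl_lform rfl_rfl) (simp add: rfl_def lin algebra_simps)

text \<open>The later letters fix the coweight of the first letter, so evaluating the product there
  shows the level of the first factor. This factor is then cancelled.\<close>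

lemma levels_zero:
  assumes "map fst as = map \<alpha> is" "distinct is" "set is \<subseteq> I"
    and "\<And>u. u \<in> U \<Longrightarrow> rprod lform as (u, 0) = rprod lform (map (\<lambda>i. (\<alpha> i, 0)) is) (u, 0)"
  shows "as = map (\<lambda>i. (\<alpha> i, 0)) is"
  using assms
proof (induction "is" arbitrary: as)
  case (Cons i "is")
  obtain k as' where as: "as = (\<alpha> i, k) # as'" "map fst as' = map \<alpha> is" using Cons by (cases as) auto
  have i: "i \<in> I" "set is \<subseteq> I" "i \<notin> set is" using Cons by auto
  have "rfl lform (\<alpha> i, k) (\<omega> i, 0) = rfl lform (\<alpha> i, 0) (\<omega> i, 0)"
    using Cons(5)[OF \<omega>_U[OF i(1)]] rprod_fixes[OF as(2) i(2,1,3)]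
      rprod_fixes[of "map (\<lambda>i. (\<alpha> i, 0)) is" "is", OF _ i(2,1,3)] as by (simp add: comp_def)
  then have k: "k = 0" using dual[of i i] sym[of "\<alpha> i" "\<omega> i"] i by (simp add: rfl_lform)
  have "rprod lform as' (u, 0) = rprod lform (map (\<lambda>i. (\<alpha> i, 0)) is) (u, 0)" if "u \<in> U" for u
  proof -
    have n: "lform (\<alpha> i, 0) (\<alpha> i, 0) = 2" using norm2 i by (simp add: lform_def)
    have "rfl lform (\<alpha> i, 0) (rprod lform as' (u, 0)) =
        rfl lform (\<alpha> i, 0) (rprod lform (map (\<lambda>i. (\<alpha> i, 0)) is) (u, 0))"
      using Cons(5)[OF that] as k by simp
    then show ?thesis using L.rfl_rfl[OF n] by metis
  qed
  then show ?case using Cons.IH[of as'] Cons.prems as k by simp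
qed simp

lemma positive_coord_nonneg:
  assumes "\<beta> \<in> Phi" "i \<in> I" "F (\<omega> i) \<beta> > 0"
  shows "nonneg \<beta>"
proof -
  have "\<not> nonneg (- \<beta>)" using assms(2,3) by (auto simp: nonneg_def lin intro!: bexI[of _ i])
  then show ?thesis using Phi_coherent[OF assms(1)] by blast
qed

text \<open>
  A root with coefficient \<open>1\<close> at \<open>h\<close> that is antidominant for all other simple roots must be \<open>\<alpha> h\<close>:
  otherwise reflecting it at \<open>\<alpha> h\<close> would give a root with coefficients of both signs.
\<close>

lemma descend_to_simple:
  assumes "\<delta> \<in> Phi" "h \<in> I" "F (\<omega> h) \<delta> = 1" "\<And>i. i \<in> I - {h} \<Longrightarrow> F (\<alpha> i) \<delta> \<le> 0"
  shows "\<delta> = \<alpha> h"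
proof -
  have nn: "F (\<omega> i) \<delta> \<ge> 0" if "i \<in> I" for i
    using positive_coord_nonneg[OF assms(1,2)] assms(3) that by (auto simp: nonneg_def)
  have "2 = F (\<Sum>i\<in>I. F (\<omega> i) \<delta> *\<^sub>R \<alpha> i) \<delta>" using Phi_norm Phi_expand assms(1) by metis
  also have "\<dots> = (\<Sum>i\<in>I. F (\<omega> i) \<delta> * F (\<alpha> i) \<delta>)" by (simp add: form_sum_left lin)
  also have "\<dots> = F (\<alpha> h) \<delta> + (\<Sum>i\<in>I-{h}. F (\<omega> i) \<delta> * F (\<alpha> i) \<delta>)"
    using fin assms by (simp add: sum.remove)
  also have "\<dots> \<le> F (\<alpha> h) \<delta>"
    using sum_nonpos[of "I - {h}" "\<lambda>i. F (\<omega> i) \<delta> * F (\<alpha> i) \<delta>"] nn assms(4)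
    by (simp add: mult_nonneg_nonpos)
  finally have ge: "F (\<alpha> h) \<delta> \<ge> 2" .
  define \<epsilon> where "\<epsilon> = rfl F (\<alpha> h) \<delta>"
  have co: "F (\<omega> i) \<epsilon> = F (\<omega> i) \<delta> - (if i = h then F (\<alpha> h) \<delta> else 0)" if "i \<in> I" for i
    using that assms(2) by (simp add: \<epsilon>_def rfl_def lin dual)
  have \<epsilon>: "\<epsilon> \<in> Phi" using assms Phi_rfl simple_Phi \<epsilon>_def by blast
  have "F (\<omega> h) \<epsilon> < 0" using co[of h] assms ge by simp
  then have "nonneg (- \<epsilon>)" using positive_coord_nonneg[OF Phi_uminus[OF \<epsilon>] assms(2)] by (simp add: lin)
  then have zero: "F (\<omega> i) \<delta> = 0" if "i \<in> I" "i \<noteq> h" for i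
    using nn[OF that(1)] co[OF that(1)] that by (auto simp: nonneg_def lin)
  have "(\<Sum>i\<in>I. F (\<omega> i) \<delta> *\<^sub>R \<alpha> i) = (\<Sum>i\<in>I. if i = h then \<alpha> h else 0)"
    by (intro sum.cong) (use zero assms(3) in auto)
  then have "\<delta> = (\<Sum>i\<in>I. if i = h then \<alpha> h else 0)" using Phi_expand[OF assms(1)] by simp
  then show ?thesis using fin assms(2) by (simp add: sum.delta)
qed

text \<open>As long as \<open>\<delta>\<close> has a positive product with a simple root other than
  \<open>\<alpha> h\<close>, \<open>pair_conj\<close> at that entry lowers its height. The
  coefficient 1 at \<open>h\<close> is unaffected and keeps \<open>\<delta>\<close> positive, so the
  process ends in the situation of \<open>descend_to_simple\<close>.\<close>

lemma reduce_pair: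
  assumes "map fst as = map \<alpha> is" "I = insert h (set is)" "h \<notin> set is"
    and "\<delta> \<in> Phi" "F (\<omega> h) \<delta> = 1"
  shows "\<exists>as' k'. map fst as' = map \<alpha> is \<and>
    hurw lform (as @ [(\<delta>, k), (\<delta>, k + 1)]) (as' @ [(\<alpha> h, k'), (\<alpha> h, k' + 1)])"
  using assms(1,4,5)
proof (induction "nat \<lfloor>F \<rho> \<delta>\<rfloor>" arbitrary: as \<delta> k rule: less_induct)
  case less
  show ?case
  proof (cases "\<forall>i\<in>I-{h}. F (\<alpha> i) \<delta> \<le> 0")
    case True
    then have "\<delta> = \<alpha> h" using descend_to_simple less assms by blast
    then show ?thesis using less by blast
  next
    case False
    then obtain i where i: "i \<in> set is" "F (\<alpha> i) \<delta> > 0" using assms by fastforce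
    then have iI: "i \<in> I" "i \<noteq> h" "h \<in> I" using assms by auto
    obtain js ks where "is": "is = js @ i # ks" using i by (meson split_list)
    then obtain bs x cs where as: "as = bs @ [x] @ cs" "fst x = \<alpha> i"
      using less(2) by (auto simp: map_eq_append_conv map_eq_Cons_conv)
    define \<epsilon> where "\<epsilon> = rfl F (\<alpha> i) \<delta>"
    define l where "l = k - F (\<alpha> i) \<delta> * snd x"
    have eq: "rfl lform x (\<delta>, k) = (\<epsilon>, l)" "rfl lform x (\<delta>, k + 1) = (\<epsilon>, l + 1)"
      using as by (simp_all add: rfl_lform \<epsilon>_def l_def)
    obtain as' where as': "map fst as' = map fst as"
        "hurw lform (as @ [(\<delta>, k), (\<delta>, k + 1)]) (as' @ [(\<epsilon>, l), (\<epsilon>, l + 1)])"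
      using pair_conj[of \<delta> x bs cs k "k + 1"] as Phi_norm[OF less(3)] norm2[OF iI(1)] eq by auto
    have \<epsilon>: "\<epsilon> \<in> Phi" "F (\<omega> h) \<epsilon> = 1"
      using Phi_rfl simple_Phi less iI by (auto simp: \<epsilon>_def rfl_def lin dual)
    have "nonneg \<epsilon>"
      using positive_coord_nonneg[OF \<epsilon>(1) iI(3)] \<epsilon>(2) by simp
    then have "F \<rho> \<epsilon> > 0" using nonneg_height \<epsilon> by blast
    moreover have "F \<rho> \<epsilon> = F \<rho> \<delta> - F (\<alpha> i) \<delta>"
      using height_simple iI by (simp add: \<epsilon>_def rfl_def lin)
    ultimately have lt: "nat \<lfloor>F \<rho> \<epsilon>\<rfloor> < nat \<lfloor>F \<rho> \<delta>\<rfloor>"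
      using i(2) Phi_height_Ints[OF less(3)] Phi_height_Ints[OF \<epsilon>(1)] by (auto elim!: Ints_cases)
    obtain as'' k' where "map fst as'' = map \<alpha> is"
        "hurw lform (as' @ [(\<epsilon>, l), (\<epsilon>, l + 1)]) (as'' @ [(\<alpha> h, k'), (\<alpha> h, k' + 1)])"
      using less.hyps[OF lt, of as' l] as'(1) less(2) \<epsilon> by metis
    then show ?thesis using as'(2) by (meson rtranclp_trans)
  qed
qed

theorem lifted_normal_form:
  assumes zs: "set zs \<subseteq> roots" "length zs \<le> length is + 2"
    and "is": "distinct is" "I = insert h (set is)" "h \<notin> set is"
    and prod: "\<And>u x. u \<in> U \<Longrightarrow> rprod lform zs (u, x) =
      rprod lform (map (\<lambda>i. (\<alpha> i, 0)) is @ [(\<alpha> h, 0), (\<alpha> h, 1)]) (u, x)"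
  shows "hurw lform zs (map (\<lambda>i. (\<alpha> i, 0)) is @ [(\<alpha> h, 0), (\<alpha> h, 1)])"
proof -
  let ?arms = "map (\<lambda>i. (\<alpha> i, 0)) is" let ?P = "\<lambda>k. [(\<alpha> h, k), (\<alpha> h, k + 1)]"
  have I: "set is \<subseteq> I" "h \<in> I" using "is" by auto
  have arms: "map fst ?arms = map \<alpha> is" by simp
  have fst_zs: "set (map fst zs) \<subseteq> Phi" using zs(1) by auto
  have prod0: "rprod lform zs (u, x) = rprod lform ?arms (u, x - F (\<alpha> h) u)" if "u \<in> U" for u x
    using prod[OF that, of x] rprod_pair[OF norm2[OF I(2)], of 0 1 u x] by simp
  have "rprod F (map fst zs) u = act is u" if "u \<in> U" for u
    using arg_cong[OF prod0[OF that, of 0], of fst] by (simp add: fst_rprod_lform act_def comp_def)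
  then obtain rs where rs: "hurw F (map fst zs) (map \<alpha> is @ dbl rs)"
    using coxeter_normal_form[OF fst_zs "is"(1) I(1)] by blast
  obtain ws where ws: "hurw lform zs ws" "map fst ws = map \<alpha> is @ dbl rs"
    using hurw_lift[OF rs HOL.refl, of lform] by (auto simp: rfl_lform)
  then obtain as bs where asbs: "ws = as @ bs" "map fst as = map \<alpha> is" "map fst bs = dbl rs"
    by (auto simp: map_eq_append_conv)
  \<comment> \<open>The length bound leaves room for one pair. A pair must occur because the arms
    alone fix the coweight \<open>\<omega> h\<close>, whereas the product lowers its level by
    1.\<close>
  have "length rs \<le> 1"
    using hurw_length[OF ws(1)] zs(2) arg_cong[OF ws(2), of length] by simp
  have roots: "set ws \<subseteq> roots" using roots_hurw ws zs by blast
  have zs_prod: "rprod lform ys v = rprod lform zs v" if "hurw lform zs ys" for ys v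
    by (rule L.hurw_rprod[OF that]) (use zs roots_norm in blast)
  have F1: "F (\<alpha> h) (\<omega> h) = 1" using dual[OF I(2) I(2)] sym[of "\<alpha> h"] by simp
  have "rprod lform ws (\<omega> h, 0) = (\<omega> h, -1)"
    using zs_prod[OF ws(1)] prod0[OF \<omega>_U[OF I(2)], of 0] rprod_fixes[OF arms I "is"(3)] F1 by simp
  then have "rprod lform bs (\<omega> h, 0) \<noteq> (\<omega> h, 0)"
    using asbs rprod_fixes[OF asbs(2) I "is"(3), of 0] by auto
  then have "rs \<noteq> []" using asbs by auto
  with \<open>length rs \<le> 1\<close> obtain r where "rs = [r]" by (cases rs) auto
  then obtain k l where bs: "bs = [(r, k), (r, l)]" using asbs by auto
  have r: "r \<in> Phi" "k \<in> \<int>" "l \<in> \<int>" using roots asbs bs by auto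
  have "rprod lform as (\<omega> h, F r (\<omega> h) * (k - l)) = (\<omega> h, -1)"
    using \<open>rprod lform ws (\<omega> h, 0) = (\<omega> h, -1)\<close> asbs bs rprod_pair[OF Phi_norm[OF r(1)], of k l "\<omega> h" 0] by simp
  \<comment> \<open>The coefficient and the difference of levels are integers, hence both are
    units.\<close>
  then have "F (\<omega> h) r * (k - l) = - 1"
    using rprod_fixes[OF asbs(2) I "is"(3)] sym[of r "\<omega> h"] by simp
  moreover obtain d e :: int where de: "F (\<omega> h) r = of_int d" "k - l = of_int e"
    using Phi_coord_Ints[OF r(1) I(2)] r by (metis Ints_cases Ints_diff)
  ultimately have "of_int (d * e) = (of_int (- 1) :: real)" by simp
  then have "d * e = - 1" by (simp only: of_int_eq_iff)
  then have "d * - e = 1" by simp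
  then have "d = 1 \<and> e = - 1 \<or> d = - 1 \<and> e = 1" unfolding zmult_eq_1_iff by linarith
  then have "F (\<omega> h) r = 1 \<and> l = k + 1 \<or> F (\<omega> h) r = - 1 \<and> l = k - 1"
    using de by (elim disjE) (simp_all add: algebra_simps)
  then consider "F (\<omega> h) r = 1" "l = k + 1" | "F (\<omega> h) r = - 1" "l = k - 1"
    by blast
  then obtain \<delta> m where \<delta>: "\<delta> \<in> Phi" "F (\<omega> h) \<delta> = 1" "hurw lform bs [(\<delta>, m), (\<delta>, m + 1)]"
  proof cases
    case 1
    then show ?thesis using r bs that by blast
  next
    case 2
    \<comment> \<open>Changing both signs makes the coefficient 1 and reverses the difference of
      levels.\<close>
    have "hurw lform [(r, k), (r, l)] [- (r, k), (r, l)]"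
      using hurw_append1[OF hurw_neg[of lform "(r, k)"], of "[(r, l)]"] by simp
    also have "hurw lform \<dots> [- (r, k), - (r, l)]"
      using hurw_append2[OF hurw_neg[of lform "(r, l)"], of "[- (r, k)]"] by simp
    finally show ?thesis
      using 2 r bs by (intro that[of "- r" "- k"]) (simp_all add: Phi_uminus lin)
  qed
  obtain as' k' where as': "map fst as' = map \<alpha> is"
      "hurw lform (as @ [(\<delta>, m), (\<delta>, m + 1)]) (as' @ ?P k')"
    using reduce_pair[OF asbs(2) "is"(2,3) \<delta>(1,2)] by blast
  have "hurw lform ws (as @ [(\<delta>, m), (\<delta>, m + 1)])"
    unfolding asbs by (rule hurw_append2[OF \<delta>(3)])
  with ws(1) as'(2) have zs_as': "hurw lform zs (as' @ ?P k')" by (meson rtranclp_trans)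
  \<comment> \<open>The starting level \<open>F (\<alpha> h) u\<close> is chosen so that the pair
    brings it to 0; what remains compares the arms alone.\<close>
  have "rprod lform as' (u, 0) = rprod lform ?arms (u, 0)" if "u \<in> U" for u
    using zs_prod[OF zs_as', of "(u, F (\<alpha> h) u)"] prod0[OF that, of "F (\<alpha> h) u"]
      rprod_pair[OF norm2[OF I(2)], of k' "k' + 1" u "F (\<alpha> h) u"] by simp
  then have arms': "as' = ?arms" using levels_zero[OF as'(1) "is"(1) I(1)] by blast
  have "set (as' @ ?P k') \<subseteq> roots" using roots_hurw zs_as' zs by blast
  then obtain n where "k' = of_int n" by (auto elim: Ints_cases)
  then have "hurw lform (as' @ ?P k') (as' @ [(\<alpha> h, 0), (\<alpha> h, 1)])"
    using hurw_append2[OF pair_shift[OF norm2[OF I(2)]]] by simp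
  with zs_as' have "hurw lform zs (as' @ [(\<alpha> h, 0), (\<alpha> h, 1)])" by (rule rtranclp_trans)
  then show ?thesis by (simp add: arms')
qed

end


section \<open>The form on the hyperbolic cover\<close>

text \<open>Induction as in the Gram-Schmidt process: \<open>\<pi>\<close> projects to the common
  kernel of the earlier functionals, the new functional is normalised there, and the earlier dual
  vectors are corrected.\<close>

lemma dual_family_exists:
  fixes \<phi> :: "'i \<Rightarrow> 'v::real_vector \<Rightarrow> real"
  assumes "finite I" "subspace U" "\<And>i. i \<in> I \<Longrightarrow> linear (\<phi> i)"
    and "\<And>c. (\<And>u. u \<in> U \<Longrightarrow> (\<Sum>i\<in>I. c i * \<phi> i u) = 0) \<Longrightarrow> (\<forall>i\<in>I. c i = 0)"
  shows "\<exists>\<omega>. \<forall>i\<in>I. \<omega> i \<in> U \<and> (\<forall>j\<in>I. \<phi> j (\<omega> i) = (if i = j then 1 else 0))"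
  using assms(1,3,4)
proof (induction I rule: finite_induct)
  case (insert j I)
  have indep: "\<forall>i\<in>I. c i = 0" if "\<And>u. u \<in> U \<Longrightarrow> (\<Sum>i\<in>I. c i * \<phi> i u) = 0" for c
  proof -
    have eq: "(\<Sum>i\<in>insert j I. (c(j := 0)) i * \<phi> i u) = (\<Sum>i\<in>I. c i * \<phi> i u)" for u
    proof -
      have "(\<Sum>i\<in>I. (c(j := 0)) i * \<phi> i u) = (\<Sum>i\<in>I. c i * \<phi> i u)"
        using insert(2) by (intro sum.cong) auto
      then show ?thesis using insert(1,2) by simp
    qed
    have "\<forall>i\<in>insert j I. (c(j := 0)) i = 0"
      by (rule insert.prems(2)) (use that eq in simp)
    then show ?thesis using insert(2) by (metis fun_upd_other insertI2)
  qed
  obtain \<omega> where \<omega>: "\<And>i. i \<in> I \<Longrightarrow> \<omega> i \<in> U" "\<And>i k. i \<in> I \<Longrightarrow> k \<in> I \<Longrightarrow> \<phi> k (\<omega> i) = (if i = k then 1 else 0)"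
    using insert.IH[OF insert.prems(1) indep] by blast
  have lin: "\<phi> i (u + v) = \<phi> i u + \<phi> i v" "\<phi> i (u - v) = \<phi> i u - \<phi> i v" "\<phi> i (c *\<^sub>R u) = c * \<phi> i u"
      "\<phi> i (\<Sum>k\<in>A. f k) = (\<Sum>k\<in>A. \<phi> i (f k))" if "i \<in> insert j I" for i u v c f and A :: "'i set"
    using insert.prems(1)[OF that] by (simp_all add: linear_add linear_diff linear_scale linear_sum)
  define \<pi> where "\<pi> u = u - (\<Sum>i\<in>I. \<phi> i u *\<^sub>R \<omega> i)" for u
  have \<pi>U: "\<pi> u \<in> U" if "u \<in> U" for u
    unfolding \<pi>_def using that \<omega>(1) assms(2) by (intro subspace_diff subspace_sum subspace_scale)
  have \<pi>I: "\<phi> k (\<pi> u) = 0" if "k \<in> I" for k u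
    using that insert(1) by (simp add: \<pi>_def lin \<omega>(2) if_distrib sum.delta cong: if_cong)
  \<comment> \<open>Otherwise the new functional would be a combination of the earlier ones on
    \<open>U\<close>, against independence.\<close>
  have "\<exists>u\<in>U. \<phi> j (\<pi> u) \<noteq> 0"
  proof (rule ccontr)
    assume "\<not> ?thesis"
    then have "\<phi> j u = (\<Sum>i\<in>I. \<phi> j (\<omega> i) * \<phi> i u)" if "u \<in> U" for u
      using that by (force simp: \<pi>_def lin mult.commute)
    define c where "c = (\<lambda>i. if i = j then -1 else \<phi> j (\<omega> i))"
    have "(\<Sum>i\<in>insert j I. c i * \<phi> i u) = 0" if "u \<in> U" for u
    proof -
      have "(\<Sum>i\<in>I. c i * \<phi> i u) = (\<Sum>i\<in>I. \<phi> j (\<omega> i) * \<phi> i u)"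
        using insert(2) by (intro sum.cong) (auto simp: c_def)
      then show ?thesis
        using \<open>\<And>u. u \<in> U \<Longrightarrow> \<phi> j u = _\<close>[OF that] insert(1,2) by (simp add: c_def)
    qed
    then have "c j = 0" using insert.prems(2) by blast
    then show False by (simp add: c_def)
  qed
  then obtain u where u: "u \<in> U" "\<phi> j (\<pi> u) \<noteq> 0" by blast
  define \<omega>j where "\<omega>j = (1 / \<phi> j (\<pi> u)) *\<^sub>R \<pi> u"
  define \<omega>' where "\<omega>' i = (if i = j then \<omega>j else \<omega> i - \<phi> j (\<omega> i) *\<^sub>R \<omega>j)" for i
  have j: "\<omega>j \<in> U" "\<phi> j \<omega>j = 1" "\<And>k. k \<in> I \<Longrightarrow> \<phi> k \<omega>j = 0"
    using u \<pi>U assms(2) \<pi>I by (simp_all add: \<omega>j_def subspace_scale lin)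
  have "\<omega>' i \<in> U" if "i \<in> insert j I" for i
    using that j(1) \<omega>(1) assms(2) by (auto simp: \<omega>'_def intro: subspace_diff subspace_scale)
  moreover have "\<phi> k (\<omega>' i) = (if i = k then 1 else 0)" if "i \<in> insert j I" "k \<in> insert j I" for i k
    using that j insert(2) \<omega>(2) by (auto simp: \<omega>'_def lin)
  ultimately show ?case by blast
qed simp

text \<open>In an orthogonal spanning set, pairing with a nonisotropic member isolates its
  coefficient.\<close>

lemma radical_in_span_isotropic:
  fixes f :: "'v::real_vector \<Rightarrow> 'v \<Rightarrow> real"
  assumes bil: "bilinear f" and E: "finite E" "pairwise (\<lambda>x y. f x y = 0) E"
    and x: "x \<in> span E" "\<And>y. y \<in> E \<Longrightarrow> f x y = 0"
  shows "x \<in> span {e \<in> E. f e e = 0}"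
proof -
  obtain c where c: "x = (\<Sum>e\<in>E. c e *\<^sub>R e)" using x(1) E(1) by (auto simp: span_finite)
  have "c e = 0" if e: "e \<in> E" "f e e \<noteq> 0" for e
  proof -
    have "f x e = (\<Sum>d\<in>E. c d * f d e)"
      unfolding c using bil by (simp add: bilinear_def linear_sum[of "\<lambda>x. f x e"] linear_scale[of "\<lambda>x. f x e"])
    also have "\<dots> = (\<Sum>d\<in>E. if d = e then c e * f e e else 0)"
      using E(2) e by (intro sum.cong) (auto simp: pairwise_def)
    also have "\<dots> = c e * f e e" using E(1) e by (simp add: sum.delta)
    finally show ?thesis using x(2)[OF e(1)] e by simp
  qed
  then show ?thesis
    unfolding c by (intro span_sum) (metis (mono_tags, lifting) mem_Collect_eq scaleR_zero_left span_base span_scale span_zero)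
qed

text \<open>This puts \<open>a\<close> into the radical of the extended form.\<close>

lemma gram_Hub_star: "\<omega> \<in> vertices r p \<Longrightarrow> gram r p Hub_star \<omega> = gram r p Hub \<omega>"
  by (cases \<omega>) (auto simp: gram_def single_edges_def doubleton_eq_iff)

lemma gram_off_diagonal:
  "\<nu> \<noteq> \<omega> \<Longrightarrow> \<nu> \<noteq> Hub_star \<Longrightarrow> \<omega> \<noteq> Hub_star \<Longrightarrow> gram r p \<nu> \<omega> = 0 \<or> gram r p \<nu> \<omega> = - 1"
  by (auto simp: gram_def doubleton_eq_iff)

text \<open>Written as a sum of indicators so that \<open>sum.delta\<close> can evaluate row sums.
  If \<open>j = p i\<close>, the neighbour \<open>Arm i (j + 1)\<close> is no vertex and its
  indicator is zero.\<close>

lemma gram_Arm: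
  assumes "1 \<le> i" "i \<le> r" "1 \<le> j" "j \<le> p i" "\<mu> \<in> vertices r p"
  shows "gram r p \<mu> (Arm i j) = (if \<mu> = Arm i j then 2 else 0) - (if \<mu> = Arm i (j + 1) then 1 else 0)
    - (if \<mu> = (if j = 1 then Hub else Arm i (j - 1)) then 1 else 0) - (if \<mu> = Hub_star \<and> j = 1 then 1 else 0)"
  using assms by (cases \<mu>) (auto simp: gram_def single_edges_def doubleton_eq_iff vertices_def)

lemma arithmetic_progression:
  fixes y :: "nat \<Rightarrow> real"
  assumes "\<And>j. 1 \<le> j \<Longrightarrow> j \<le> n \<Longrightarrow> 2 * y j = y (j - 1) + y (j + 1)" "j \<le> n + 1"
  shows "y j = y 0 + real j * (y 1 - y 0)"
  using assms(2)
proof (induction j rule: less_induct)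
  case (less j)
  consider "j = 0" | "j = 1" | k where "j = Suc (Suc k)" by (metis One_nat_def not0_implies_Suc)
  then show ?case
  proof cases
    case 3
    then have "2 * y (Suc k) = y k + y j" using assms(1)[of "Suc k"] less.prems by simp
    then show ?thesis using less.IH[of k] less.IH[of "Suc k"] less.prems 3 by (simp add: algebra_simps)
  qed simp_all
qed

lemma lookup_simple_root: "Poly_Mapping.lookup (simple_root \<nu>) \<mu> = (if \<mu> = \<nu> then 1 else 0)"
  by (simp add: simple_root_def lookup_single when_def)

lemma bar_basis_image: "bar_basis r p = simple_root ` (vertices r p - {Hub_star})"
  using inj_simple_root by (auto simp: bar_basis_def ext_basis_def dest: injD)

lemma ext_form_row:
  assumes "\<omega> \<in> vertices r p"
  shows "ext_form r p v (simple_root \<omega>) = (\<Sum>\<mu>\<in>vertices r p. Poly_Mapping.lookup v \<mu> * gram r p \<mu> \<omega>)"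
proof -
  have "(\<Sum>\<kappa>\<in>vertices r p. Poly_Mapping.lookup v \<mu> * (if \<kappa> = \<omega> then 1 else 0) * gram r p \<mu> \<kappa>) =
      Poly_Mapping.lookup v \<mu> * gram r p \<mu> \<omega>" for \<mu>
  proof -
    have "(\<Sum>\<kappa>\<in>vertices r p. Poly_Mapping.lookup v \<mu> * (if \<kappa> = \<omega> then 1 else 0) * gram r p \<mu> \<kappa>) =
        (\<Sum>\<kappa>\<in>vertices r p. if \<kappa> = \<omega> then Poly_Mapping.lookup v \<mu> * gram r p \<mu> \<omega> else 0)"
      by (intro sum.cong) auto
    then show ?thesis using assms by (simp add: sum.delta)
  qed
  then show ?thesis by (simp add: ext_form_def lookup_simple_root)
qed

text \<open>Radical vectors restrict to arithmetic progressions on the arms.\<close>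

lemma radical_zero_of_end:
  assumes "1 \<le> i" "i \<le> r" "\<And>k. 1 \<le> k \<Longrightarrow> k \<le> r \<Longrightarrow> 1 \<le> p k"
    and v: "v \<in> span (simple_root ` (vertices r p - {Hub_star, Arm i (p i)}))"
    and rad: "\<And>\<omega>. \<omega> \<in> vertices r p - {Hub_star} \<Longrightarrow> ext_form r p v (simple_root \<omega>) = 0"
  shows "v = 0"
proof -
  define z where "z = Poly_Mapping.lookup v"
  have z0: "z \<mu> = 0" if "\<mu> \<notin> vertices r p - {Hub_star, Arm i (p i)}" for \<mu>
    unfolding z_def by (rule lookup_span[OF v that])
  \<comment> \<open>Each arm is read as a sequence with the hub at index 0.\<close>
  define y where "y k j = (if j = 0 then z Hub else z (Arm k j))" for k j
  have rec: "2 * y k j = y k (j - 1) + y k (j + 1)" if k: "1 \<le> k" "k \<le> r" "1 \<le> j" "j \<le> p k" for k j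
  proof -
    let ?V = "vertices r p" let ?prev = "if j = 1 then Hub else Arm k (j - 1)"
    have V: "Arm k j \<in> ?V" using k by (auto simp: vertices_def)
    have prev: "?prev \<in> ?V" using k by (auto simp: vertices_def)
    have "0 = (\<Sum>\<mu>\<in>?V. z \<mu> * gram r p \<mu> (Arm k j))"
      using rad[of "Arm k j"] ext_form_row[OF V, of v] V by (simp add: z_def)
    also have "\<dots> = (\<Sum>\<mu>\<in>?V. (if \<mu> = Arm k j then 2 * z (Arm k j) else 0)
        - (if \<mu> = Arm k (j + 1) then z (Arm k (j + 1)) else 0) - (if \<mu> = ?prev then z ?prev else 0)
        - (if \<mu> = Hub_star then if j = 1 then z Hub_star else 0 else 0))"
      using gram_Arm[of k r j p] k by (intro sum.cong HOL.refl) auto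
    also have "\<dots> = 2 * z (Arm k j) - (if Arm k (j + 1) \<in> ?V then z (Arm k (j + 1)) else 0)
        - (if ?prev \<in> ?V then z ?prev else 0) - (if Hub_star \<in> ?V then if j = 1 then z Hub_star else 0 else 0)"
      using V by (simp only: sum_subtractf sum.delta finite_vertices if_True)
    also have "\<dots> = 2 * y k j - y k (j + 1) - y k (j - 1)"
      using z0[of Hub_star] z0[of "Arm k (j + 1)"] prev k by (auto simp: y_def)
    finally show ?thesis by simp
  qed
  \<comment> \<open>Continued by 0 one place beyond its end, the arm satisfies the recursion at its
    last vertex too.\<close>
  have outside: "y k (p k + 1) = 0" for k
    using z0[of "Arm k (p k + 1)"] by (auto simp: y_def vertices_def)
  have prog: "y k j = y k 0 + real j * (y k 1 - y k 0)" if "1 \<le> k" "k \<le> r" "j \<le> p k + 1" for k j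
    by (rule arithmetic_progression[of "p k"]) (use rec that in auto)
  have "y i (p i) = 0" using z0[of "Arm i (p i)"] assms(3)[OF assms(1,2)] by (auto simp: y_def)
  \<comment> \<open>The distinguished arm vanishes at two consecutive places, so its progression is
    zero, and with it the hub coefficient. Every other arm then runs from 0 to 0.\<close>
  then have e: "y i 0 + real (p i) * (y i 1 - y i 0) = 0" "y i 0 + real (p i + 1) * (y i 1 - y i 0) = 0"
    using prog[of i "p i"] prog[of i "p i + 1"] outside[of i] assms(1,2) by auto
  then have "y i 1 - y i 0 = 0" by (simp add: algebra_simps)
  then have hub: "z Hub = 0" using e(1) by (simp add: y_def)
  have "z (Arm k j) = 0" if "1 \<le> k" "k \<le> r" "1 \<le> j" "j \<le> p k" for k j
  proof -
    have "real (p k + 1) * (y k 1 - y k 0) = 0"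
      using prog[of k "p k + 1"] outside[of k] that hub by (simp add: y_def)
    then have "y k 1 - y k 0 = 0" by simp
    then show ?thesis using prog[of k j] that hub by (simp add: y_def)
  qed
  then have "z \<mu> = 0" for \<mu> using z0[of \<mu>] hub by (cases \<mu>) (auto simp: vertices_def)
  then show ?thesis by (intro poly_mapping_eqI) (simp add: z_def)
qed


section \<open>Coweights on the cover\<close>

locale hyperbolic_cover =
  fixes r :: nat and p :: "nat \<Rightarrow> nat" and F :: "cover_vector \<Rightarrow> cover_vector \<Rightarrow> real"
  assumes arm_length: "1 \<le> i \<Longrightarrow> i \<le> r \<Longrightarrow> 1 \<le> p i"
    and type: "domestic r p \<or> wild r p \<or> tubular r p"
    and form: "cover_form r p F"
begin

definition node_root :: "vertex \<Rightarrow> cover_vector" where "node_root \<nu> = (simple_root \<nu>, 0)"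

definition imag :: cover_vector where "imag = (simple_root Hub_star - simple_root Hub, 0)"

definition nodes :: "vertex set" where "nodes = vertices r p - {Hub_star}"

text \<open>Orthogonal to \<open>imag\<close> and large enough to carry the coweights. In the
  tubular type, the simple roots without \<open>Hub_star\<close> still span the radical vector
  \<open>b\<close>, so the line of \<open>b'\<close> is added to detect it.\<close>

definition base_space :: "cover_vector set" where
  "base_space = span (bar_basis r p) \<times> (if tubular r p then UNIV else {0})"

sublocale symmetric_form F
proof
  show "bilinear F" "F x y = F y x" for x y using form unfolding cover_form_def by blast+
qed

lemma form_ext: "v \<in> ext_space r p \<Longrightarrow> w \<in> ext_space r p \<Longrightarrow> F (v, 0) (w, 0) = ext_form r p v w"
  using form by (simp add: cover_form_def)

lemma simple_root_ext: "\<nu> \<in> vertices r p \<Longrightarrow> simple_root \<nu> \<in> ext_space r p"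
  by (simp add: ext_space_def ext_basis_def span_base)

lemma form_node_root: "\<nu> \<in> vertices r p \<Longrightarrow> \<omega> \<in> vertices r p \<Longrightarrow> F (node_root \<nu>) (node_root \<omega>) = gram r p \<nu> \<omega>"
  by (simp add: node_root_def form_ext simple_root_ext ext_form_simple_root)

lemma bar_ext: "v \<in> span (bar_basis r p) \<Longrightarrow> v \<in> ext_space r p"
  unfolding ext_space_def by (rule span_mono[THEN subsetD]) (auto simp: bar_basis_def)

lemma Hub_vertices: "Hub \<in> vertices r p" "Hub_star \<in> vertices r p"
  by (simp_all add: vertices_def)

lemma imag_radical: "v \<in> ext_space r p \<Longrightarrow> ext_form r p (simple_root Hub_star - simple_root Hub) v = 0"
  unfolding ext_space_def
proof (induction rule: span_induct_alt)
  case base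
  then show ?case by (simp add: bilinear_rzero[OF bilinear_ext_form])
next
  case (step c x y)
  then obtain \<nu> where "\<nu> \<in> vertices r p" "x = simple_root \<nu>" by (auto simp: ext_basis_def)
  then have "ext_form r p (simple_root Hub_star - simple_root Hub) x = 0"
    using Hub_vertices by (simp add: bilinear_lsub[OF bilinear_ext_form] ext_form_simple_root gram_Hub_star)
  then show ?case using step
    by (simp add: bilinear_radd[OF bilinear_ext_form] bilinear_rmul[OF bilinear_ext_form])
qed

lemma imag_ext: "simple_root Hub_star - simple_root Hub \<in> ext_space r p"
  using simple_root_ext Hub_vertices unfolding ext_space_def by (simp add: span_diff)

lemma form_imag_ext: "v \<in> ext_space r p \<Longrightarrow> F imag (v, 0) = 0"
  by (simp add: imag_def form_ext imag_ext imag_radical)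

lemma form_imag_imag: "F imag imag = 0"
  using form_imag_ext[OF imag_ext] by (simp add: imag_def)

lemma pair_split: "(v, x) = (v, 0) + x *\<^sub>R (0, 1)" for v :: "vertex \<Rightarrow>\<^sub>0 real" and x :: real
  by simp

lemma form_imag_base:
  assumes "u \<in> base_space"
  shows "F imag u = 0"
proof (cases "tubular r p")
  case True
  then have 0: "F imag (0, 1) = 0" using form by (auto simp: cover_form_def imag_def Let_def)
  obtain v x where "u = (v, x)" "v \<in> ext_space r p"
    using assms bar_ext by (auto simp: base_space_def)
  then show ?thesis using form_imag_ext 0 by (subst \<open>u = _\<close>, subst pair_split) (simp only: lin, simp)
next
  case False
  then show ?thesis using assms bar_ext form_imag_ext by (auto simp: base_space_def)
qed

text \<open>Tubular type: pairing with \<open>b'\<close> reads the coefficient at the affine node,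
  and a radical vector without it vanishes by \<open>radical_zero_of_end\<close>. Other types: the
  signature leaves a radical spanned by one vector; \<open>a\<close> lies in it, while
  \<open>v\<close> has no component at \<open>Hub_star\<close>.\<close>

lemma base_nondegenerate:
  assumes v: "v \<in> span (bar_basis r p)" and orth: "\<And>u. u \<in> base_space \<Longrightarrow> F (v, 0) u = 0"
  shows "v = 0"
proof -
  have bar0: "F (v, 0) (w, 0) = 0" if "w \<in> span (bar_basis r p)" for w
    using orth[of "(w, 0)"] that by (auto simp: base_space_def)
  show ?thesis
  proof (cases "tubular r p")
    case True
    then obtain \<nu> \<theta> where \<nu>: "affine_node r p \<nu>"
      and hr: "highest_root (ext_form r p) (span (bar_basis r p - {simple_root \<nu>})) (bar_basis r p - {simple_root \<nu>}) \<theta>"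
      and orth': "\<And>v. v \<in> span (bar_basis r p - {simple_root \<nu>}) \<Longrightarrow> F (v, 0) (0, 1) = 0"
      and b: "F (simple_root \<nu> + \<theta>, 0) (0, 1) = 1"
      using form by (auto simp: cover_form_def Let_def)
    obtain i where i: "1 \<le> i" "i \<le> r" "\<nu> = Arm i (p i)" using \<nu> by (auto simp: affine_node_def)
    have \<nu>_bar: "simple_root \<nu> \<in> bar_basis r p"
      using i arm_length[of i] by (auto simp: bar_basis_image vertices_def)
    obtain w \<beta> where w: "w \<in> carrier (weyl_group (ext_form r p) (span (bar_basis r p - {simple_root \<nu>}))
        (bar_basis r p - {simple_root \<nu>}))" "\<beta> \<in> bar_basis r p - {simple_root \<nu>}" "\<theta> = w \<beta>"
      using hr by (auto simp: highest_root_def root_system_def)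
    have "\<theta> \<in> span (bar_basis r p - {simple_root \<nu>})"
      unfolding w(3) by (rule weyl_group_closed[OF subspace_span w(1) span_base[OF w(2)]])
    then have "F (\<theta>, 0) (0, 1) = 0" by (rule orth')
    moreover have "(simple_root \<nu> + \<theta>, 0::real) = (simple_root \<nu>, 0) + (\<theta>, 0)" by simp
    \<comment> \<open>The highest root pairs to 0 with \<open>b'\<close>, so the normalisation of
      \<open>b\<close> passes to the affine node.\<close>
    ultimately have one: "F (simple_root \<nu>, 0) (0, 1) = 1" using b by (metis add_0_right bilinear_ladd[OF bil])
    obtain k where k: "v - k *\<^sub>R simple_root \<nu> \<in> span (bar_basis r p - {simple_root \<nu>})"
      using v \<nu>_bar span_breakdown by blast
    have "(v, 0::real) = (v - k *\<^sub>R simple_root \<nu>, 0) + k *\<^sub>R (simple_root \<nu>, 0)" by simp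
    then have "F (v, 0) (0, 1) = k" using orth'[OF k] one
      by (metis add_0_left bilinear_ladd[OF bil] bilinear_lmul[OF bil] mult.right_neutral real_scaleR_def)
    moreover have "F (v, 0) (0, 1) = 0" using True orth[of "(0, 1)"] by (simp add: base_space_def span_zero)
    ultimately have v': "v \<in> span (bar_basis r p - {simple_root \<nu>})" using k by simp
    have "bar_basis r p - {simple_root \<nu>} = simple_root ` (vertices r p - {Hub_star, \<nu>})"
      using inj_simple_root by (auto simp: bar_basis_image dest: injD)
    then have end0: "v \<in> span (simple_root ` (vertices r p - {Hub_star, Arm i (p i)}))" using v' i by simp
    show ?thesis
    proof (rule radical_zero_of_end[of i r p, OF i(1,2) _ end0])
      show "1 \<le> p k" if "1 \<le> k" "k \<le> r" for k by (rule arm_length[OF that])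
    next
      fix \<omega> assume \<omega>: "\<omega> \<in> vertices r p - {Hub_star}"
      then have "F (v, 0) (simple_root \<omega>, 0) = 0"
        by (intro bar0 span_base) (auto simp: bar_basis_image)
      then show "ext_form r p v (simple_root \<omega>) = 0"
        using \<omega> form_ext bar_ext[OF v] simple_root_ext by simp
    qed
  next
    case False
    then obtain pos neg where "has_signature (ext_form r p) (ext_space r p) (pos, neg, 1)"
      using type by (auto simp: domestic_def wild_def)
    then obtain E where E: "finite E" "span E = ext_space r p" "pairwise (\<lambda>x y. ext_form r p x y = 0) E"
        "card {e \<in> E. ext_form r p e e = 0} = 1"
      by (auto simp: has_signature_def)
    then obtain e where e: "{e \<in> E. ext_form r p e e = 0} = {e}" by (auto simp: card_1_singleton_iff)
    have rad: "x \<in> span {e}" if "x \<in> ext_space r p" "\<And>y. y \<in> ext_space r p \<Longrightarrow> ext_form r p x y = 0" for x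
      unfolding e[symmetric] using that E
      by (intro radical_in_span_isotropic[OF bilinear_ext_form]) (auto intro: span_base)
    let ?a = "simple_root Hub_star - simple_root Hub"
    \<comment> \<open>Orthogonality to \<open>bar_basis\<close> and to \<open>a\<close> covers the
      remaining basis vector \<open>simple_root Hub_star\<close>.\<close>
    have "ext_form r p v y = 0" if "y \<in> ext_space r p" for y
      using that unfolding ext_space_def
    proof (induction rule: span_induct_alt)
      case base
      then show ?case by (simp add: bilinear_rzero[OF bilinear_ext_form])
    next
      case (step c x y)
      have "ext_form r p v x = 0"
      proof (cases "x = simple_root Hub_star")
        case True
        have "simple_root Hub \<in> bar_basis r p" using Hub_vertices by (auto simp: bar_basis_image)
        then have "ext_form r p v (simple_root Hub) = 0"
          using bar0[of "simple_root Hub"] span_base form_ext bar_ext[OF v] simple_root_ext Hub_vertices by auto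
        moreover have "ext_form r p v ?a = 0"
          using imag_radical[OF bar_ext[OF v]] ext_form_sym by metis
        ultimately show ?thesis using True by (simp add: bilinear_rsub[OF bilinear_ext_form])
      next
        case False
        then have "x \<in> bar_basis r p" using step by (simp add: bar_basis_def)
        then show ?thesis using bar0[of x] span_base form_ext bar_ext[OF v] bar_ext[of x] by auto
      qed
      then show ?case using step
        by (simp add: bilinear_radd[OF bilinear_ext_form] bilinear_rmul[OF bilinear_ext_form])
    qed
    then have "v \<in> span {e}" by (rule rad[OF bar_ext[OF v]])
    then obtain s where s: "v = s *\<^sub>R e" by (auto simp: span_singleton)
    have "?a \<in> span {e}" by (rule rad[OF imag_ext imag_radical])
    then obtain t where t: "?a = t *\<^sub>R e" by (auto simp: span_singleton)
    have "Poly_Mapping.lookup ?a Hub_star = 1" by (simp add: lookup_minus lookup_simple_root)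
    then have "t * Poly_Mapping.lookup e Hub_star = 1" using t by (simp add: lookup_scaleR)
    moreover have "Poly_Mapping.lookup v Hub_star = 0"
      using lookup_span[OF v[unfolded bar_basis_image]] by blast
    then have "s * Poly_Mapping.lookup e Hub_star = 0" using s by (simp add: lookup_scaleR)
    ultimately have "s = 0" by auto
    then show ?thesis using s by simp
  qed
qed

lemma node_root_base: "\<nu> \<in> nodes \<Longrightarrow> node_root \<nu> \<in> base_space"
  by (auto simp: nodes_def node_root_def base_space_def bar_basis_image intro: span_base)

lemma subspace_base: "subspace base_space"
  unfolding base_space_def by (intro subspace_Times subspace_span) (auto simp: subspace_def)

lemma finite_nodes: "finite nodes"
  by (simp add: nodes_def)

text \<open>Nondegeneracy and the independence of the simple roots make the functionals
  \<open>F (node_root \<nu>)\<close> independent on \<open>base_space\<close>.\<close>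

lemma dual_nodes_exists:
  "\<exists>\<omega>. \<forall>\<nu>\<in>nodes. \<omega> \<nu> \<in> base_space \<and> (\<forall>\<mu>\<in>nodes. F (node_root \<mu>) (\<omega> \<nu>) = (if \<nu> = \<mu> then 1 else 0))"
proof (rule dual_family_exists[OF finite_nodes subspace_base])
  show "linear (F (node_root \<nu>))" for \<nu> using bil unfolding bilinear_def by blast
next
  fix c assume c: "\<And>u. u \<in> base_space \<Longrightarrow> (\<Sum>\<nu>\<in>nodes. c \<nu> * F (node_root \<nu>) u) = 0"
  define v where "v = (\<Sum>\<nu>\<in>nodes. c \<nu> *\<^sub>R simple_root \<nu>)"
  have eq: "(v, 0) = (\<Sum>\<nu>\<in>nodes. c \<nu> *\<^sub>R node_root \<nu>)"
    by (simp add: v_def node_root_def prod_eq_iff fst_sum snd_sum)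
  have "v \<in> span (bar_basis r p)"
    unfolding v_def by (intro span_sum span_scale span_base) (auto simp: nodes_def bar_basis_image)
  moreover have "F (v, 0) u = 0" if "u \<in> base_space" for u
    using c[OF that] by (simp add: eq form_sum_left lin)
  ultimately have "v = 0" by (rule base_nondegenerate)
  have "Poly_Mapping.lookup (\<Sum>\<nu>\<in>A. c \<nu> *\<^sub>R simple_root \<nu>) \<mu> = (\<Sum>\<nu>\<in>A. c \<nu> * (if \<mu> = \<nu> then 1 else 0))" for A \<mu>
    by (induction A rule: infinite_finite_induct) (simp_all add: lookup_add lookup_scaleR lookup_simple_root)
  from this[of nodes]
  have "Poly_Mapping.lookup v \<mu> = (\<Sum>\<nu>\<in>nodes. c \<nu> * (if \<mu> = \<nu> then 1 else 0))" for \<mu>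
    by (simp add: v_def)
  then have "c \<mu> = 0" if "\<mu> \<in> nodes" for \<mu>
    using that finite_nodes \<open>v = 0\<close> by (simp add: if_distrib sum.delta' cong: if_cong)
  then show "\<forall>\<nu>\<in>nodes. c \<nu> = 0" by blast
qed

definition coweight :: "vertex \<Rightarrow> cover_vector" where
  "coweight = (SOME \<omega>. \<forall>\<nu>\<in>nodes. \<omega> \<nu> \<in> base_space \<and>
     (\<forall>\<mu>\<in>nodes. F (node_root \<mu>) (\<omega> \<nu>) = (if \<nu> = \<mu> then 1 else 0)))"

lemma coweight:
  assumes "\<nu> \<in> nodes"
  shows "coweight \<nu> \<in> base_space" "\<mu> \<in> nodes \<Longrightarrow> F (node_root \<mu>) (coweight \<nu>) = (if \<nu> = \<mu> then 1 else 0)"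
  using someI_ex[OF dual_nodes_exists] assms by (auto simp: coweight_def)

sublocale simply_laced_space F nodes node_root coweight base_space
proof
  show "finite nodes" by (rule finite_nodes)
  show "F (node_root i) (node_root i) = 2" if "i \<in> nodes" for i
    using that by (simp add: nodes_def form_node_root gram_def)
  show "F (node_root i) (node_root j) = 0 \<or> F (node_root i) (node_root j) = - 1"
    if "i \<in> nodes" "j \<in> nodes" "i \<noteq> j" for i j
    using that gram_off_diagonal[of i j r p] by (auto simp: nodes_def form_node_root)
  show "F (coweight i) (node_root j) = (if i = j then 1 else 0)" if "i \<in> nodes" "j \<in> nodes" for i j
    using coweight(2)[OF that] sym by metis
  show "subspace base_space" by (rule subspace_base)
  show "node_root i \<in> base_space" if "i \<in> nodes" for i by (rule node_root_base[OF that])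
  show "coweight i \<in> base_space" if "i \<in> nodes" for i by (rule coweight(1)[OF that])
qed

section \<open>From roots with levels to vectors of the cover\<close>

definition unlift :: "cover_vector \<times> real \<Rightarrow> cover_vector" where "unlift z = fst z + snd z *\<^sub>R imag"

lemma unlift_form:
  "fst z \<in> base_space \<Longrightarrow> fst w \<in> base_space \<Longrightarrow> F (unlift z) (unlift w) = lform z w"
  using form_imag_base sym[of "fst z" imag] by (simp add: unlift_def lform_def lin form_imag_imag)

lemma unlift_rfl:
  assumes "fst z \<in> base_space" "fst w \<in> base_space"
  shows "rfl F (unlift z) (unlift w) = unlift (rfl lform z w)"
  using unlift_form[OF assms] by (simp add: rfl_def) (simp add: unlift_def algebra_simps)

lemma unlift_rprod:
  assumes "\<And>z. z \<in> set zs \<Longrightarrow> fst z \<in> base_space" "fst w \<in> base_space"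
  shows "rprod F (map unlift zs) (unlift w) = unlift (rprod lform zs w) \<and> fst (rprod lform zs w) \<in> base_space"
  using assms by (induction zs) (simp_all add: unlift_rfl, simp add: rfl_lform rfl_U)

text \<open>The coordinate at \<open>Hub_star\<close> comes from \<open>imag\<close> alone and
  equals the level.\<close>

lemma unlift_inj:
  assumes "fst z \<in> base_space" "fst w \<in> base_space" "unlift z = unlift w"
  shows "z = w"
proof -
  have zero: "Poly_Mapping.lookup (fst u) Hub_star = 0" if "u \<in> base_space" for u
    using that lookup_span[of "fst u" "vertices r p - {Hub_star}" Hub_star]
    by (auto simp: base_space_def bar_basis_image)
  have "Poly_Mapping.lookup (fst (unlift z)) Hub_star = snd z" if "fst z \<in> base_space" for z
    using zero[OF that] by (simp add: unlift_def imag_def lookup_add lookup_scaleR lookup_minus lookup_simple_root)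
  then have "snd z = snd w" using assms by metis
  then show ?thesis using assms(3) by (simp add: unlift_def prod_eq_iff)
qed

lemma base_cover: "u \<in> base_space \<Longrightarrow> u \<in> cover_space r p"
  using bar_ext by (auto simp: base_space_def cover_space_def)

lemma unlift_cover: "fst z \<in> base_space \<Longrightarrow> unlift z \<in> cover_space r p"
  using base_cover imag_ext unfolding unlift_def
  by (intro subspace_add subspace_scale subspace_cover_space) (auto simp: cover_space_def imag_def)

definition cover_roots :: "cover_vector set" where "cover_roots = unlift ` roots"

lemma cover_roots_rfl: "x \<in> cover_roots \<Longrightarrow> y \<in> cover_roots \<Longrightarrow> rfl F x y \<in> cover_roots"
proof -
  assume "x \<in> cover_roots" "y \<in> cover_roots"
  then obtain z w where zw: "z \<in> roots" "w \<in> roots" "x = unlift z" "y = unlift w"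
    unfolding cover_roots_def by blast
  then have "rfl F x y = unlift (rfl lform z w)" by (simp add: unlift_rfl Phi_U mem_Times_iff)
  then show ?thesis using zw roots_rfl unfolding cover_roots_def by blast
qed

lemma cover_roots_norm: "x \<in> cover_roots \<Longrightarrow> F x x = 2"
  using unlift_form roots_norm Phi_U unfolding cover_roots_def by (force simp: mem_Times_iff)

lemma cover_roots_space: "x \<in> cover_roots \<Longrightarrow> x \<in> cover_space r p"
  using unlift_cover Phi_U unfolding cover_roots_def by (force simp: mem_Times_iff)

text \<open>The two hubs are the levels 0 and 1 over the same root.\<close>

lemma unlift_simple: "unlift (node_root \<nu>, 0) = (simple_root \<nu>, 0)"
  "unlift (node_root Hub, 1) = (simple_root Hub_star, 0)"
  by (simp_all add: unlift_def node_root_def imag_def)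

lemma basis_roots: "\<nu> \<in> vertices r p \<Longrightarrow> (simple_root \<nu>, 0) \<in> cover_roots"
proof (cases "\<nu> = Hub_star")
  case True
  have "(node_root Hub, 1) \<in> roots" using simple_Phi Hub_vertices by (simp add: nodes_def)
  then show ?thesis using True unfolding cover_roots_def by (metis imageI unlift_simple(2))
next
  case False
  assume "\<nu> \<in> vertices r p"
  then have "(node_root \<nu>, 0) \<in> roots" using False simple_Phi by (simp add: nodes_def)
  then show ?thesis unfolding cover_roots_def by (metis imageI unlift_simple(1))
qed

lemma unlift_hurw:
  assumes "hurw lform zs ws" "set zs \<subseteq> roots"
  shows "hurw F (map unlift zs) (map unlift ws)"
proof (rule hurw_transport[OF assms])
  show "unlift (rfl lform x y) = rfl F (unlift x) (unlift y)" if "x \<in> roots" "y \<in> roots" for x y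
    using that by (simp add: unlift_rfl Phi_U mem_Times_iff)
  show "unlift (- x) = - unlift x" for x by (simp add: unlift_def)
qed (use roots_rfl roots_uminus in auto)

text \<open>By \<open>unlift_inj\<close>, products that agree on the cover agree on
  \<open>base_space\<close> with levels. There \<open>lifted_normal_form\<close> applies, and
  \<open>unlift_hurw\<close> carries its moves back.\<close>

theorem cover_normal_form:
  assumes xs: "set xs \<subseteq> cover_roots" "length xs \<le> length is + 2"
    and "is": "distinct is" "set is = vertices r p - {Hub, Hub_star}"
    and prod: "\<And>v. v \<in> cover_space r p \<Longrightarrow>
      rprod F xs v = rprod F (map (\<lambda>\<nu>. (simple_root \<nu>, 0)) (is @ [Hub, Hub_star])) v"
  shows "hurw F xs (map (\<lambda>\<nu>. (simple_root \<nu>, 0)) (is @ [Hub, Hub_star]))"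
proof -
  have "xs \<in> lists (unlift ` roots)" using xs(1) by (simp add: cover_roots_def lists_eq_set)
  then obtain zs where "zs \<in> lists roots" and zs2: "xs = map unlift zs" unfolding lists_image by blast
  then have zs: "set zs \<subseteq> roots" "xs = map unlift zs" by (simp_all add: lists_eq_set)
  let ?std = "map (\<lambda>i. (node_root i, 0)) is @ [(node_root Hub, 0), (node_root Hub, 1)]"
  have std: "map unlift ?std = map (\<lambda>\<nu>. (simple_root \<nu>, 0)) (is @ [Hub, Hub_star])"
    by (simp add: unlift_simple)
  have Hub: "nodes = insert Hub (set is)" "Hub \<notin> set is" using "is" Hub_vertices by (auto simp: nodes_def)
  have "hurw lform zs ?std"
  proof (rule lifted_normal_form)
    fix u :: cover_vector and x :: real
    assume u: "u \<in> base_space"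
    have zsb: "fst z \<in> base_space" if "z \<in> set zs" for z using that zs Phi_U by (force simp: mem_Times_iff)
    have stdb: "fst z \<in> base_space" if "z \<in> set ?std" for z using that node_root_base Hub by auto
    have ux: "fst (u, x) \<in> base_space" using u by simp
    have "unlift (rprod lform zs (u, x)) = unlift (rprod lform ?std (u, x))"
      using prod[OF unlift_cover[OF ux]] unlift_rprod[OF zsb ux] unlift_rprod[OF stdb ux] zs(2) std by metis
    then show "rprod lform zs (u, x) = rprod lform ?std (u, x)"
      using unlift_inj unlift_rprod[OF zsb ux] unlift_rprod[OF stdb ux] by blast
  qed (use zs xs "is" Hub in auto)
  then have "hurw F (map unlift zs) (map unlift ?std)" using zs(1) by (rule unlift_hurw)
  then show ?thesis using zs(2) std by metis
qed

end


section \<open>Reflection factorizations in the Weyl group\<close>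

lemma (in group) conjugates_closed:
  assumes S: "S \<subseteq> carrier G" and T: "T = (\<Union>w\<in>carrier G. (\<lambda>s. w \<otimes> s \<otimes> inv w) ` S)"
  shows "T \<subseteq> carrier G" "s \<in> T \<Longrightarrow> t \<in> T \<Longrightarrow> t \<otimes> s \<otimes> inv t \<in> T \<and> inv t \<otimes> s \<otimes> t \<in> T" "S \<subseteq> T"
proof -
  show sub: "T \<subseteq> carrier G" using S by (auto simp: T)
  have conj: "g \<otimes> s \<otimes> inv g \<in> T" if s: "s \<in> T" and g: "g \<in> carrier G" for s g
  proof -
    obtain w \<sigma> where w: "w \<in> carrier G" "\<sigma> \<in> S" "s = w \<otimes> \<sigma> \<otimes> inv w" using s by (auto simp: T)
    then have "g \<otimes> s \<otimes> inv g = (g \<otimes> w) \<otimes> \<sigma> \<otimes> inv (g \<otimes> w)"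
      using S g by (auto simp: m_assoc inv_mult_group subset_iff)
    then show ?thesis using w g by (auto simp: T)
  qed
  show "s \<in> T \<Longrightarrow> t \<in> T \<Longrightarrow> t \<otimes> s \<otimes> inv t \<in> T \<and> inv t \<otimes> s \<otimes> t \<in> T"
    using conj[of s t] conj[of s "inv t"] sub by auto
  show "S \<subseteq> T"
  proof
    fix s assume s: "s \<in> S"
    then have "s = \<one> \<otimes> s \<otimes> inv \<one>" using S by auto
    then show "s \<in> T" using s unfolding T by blast
  qed
qed

text \<open>All tuples lead to the common tuple \<open>hs\<close>; one path followed by the inverse
  of another joins two given tuples.\<close>

lemma (in group) hurwitz_transitiveI:
  assumes action: "group_action (braid_group m) E (\<lambda>\<beta>. \<lambda>gs\<in>E. hurwitz G \<beta> gs)"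
    and E: "\<And>gs. gs \<in> E \<Longrightarrow> length gs = m \<and> set gs \<subseteq> carrier G"
    and standard: "\<And>gs. gs \<in> E \<Longrightarrow> \<exists>u\<in>braid_words m. hurwitz_word G u gs = hs"
  shows "transitive_action (braid_group m) E (\<lambda>\<beta>. \<lambda>gs\<in>E. hurwitz G \<beta> gs)"
proof (intro transitive_action.intro transitive_action_axioms.intro action)
  fix x y assume xy: "x \<in> E" "y \<in> E"
  obtain u where u: "u \<in> braid_words m" "hurwitz_word G u x = hs" using standard xy by blast
  obtain v where v: "v \<in> braid_words m" "hurwitz_word G v y = hs" using standard xy by blast
  obtain w where w: "w \<in> braid_words m" "braid_eq m (w @ v) []" using braid_inverse_ex v by blast
  have "hurwitz_word G (w @ u) x = hurwitz_word G (w @ v) y"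
    using u v by (simp add: hurwitz_word_append)
  also have "\<dots> = hurwitz_word G [] y" using E[OF xy(2)] by (intro hurwitz_word_eq[OF w(2)]) auto
  also have "\<dots> = y" by (simp add: hurwitz_word_def)
  finally have "hurwitz G (braid_class m (w @ u)) x = y"
    using E[OF xy(1)] u w by (subst hurwitz_eq) auto
  moreover have "braid_class m (w @ u) \<in> carrier (braid_group m)"
    using u w by (simp add: braid_group_def)
  ultimately show "\<exists>g\<in>carrier (braid_group m). (\<lambda>gs\<in>E. hurwitz G g gs) x = y"
    using xy by (intro bexI[of _ "braid_class m (w @ u)"]) auto
qed

lemma GL_mult: "g \<in> carrier (GL U) \<Longrightarrow> h \<in> carrier (GL U) \<Longrightarrow> v \<in> U \<Longrightarrow> (g \<otimes>\<^bsub>GL U\<^esub> h) v = g (h v)"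
  by (simp add: GL_def BijGroup_def compose_def)

lemma GL_one: "v \<in> U \<Longrightarrow> \<one>\<^bsub>GL U\<^esub> v = v"
  by (simp add: GL_def BijGroup_def)

lemma GL_closed: "g \<in> carrier (GL U) \<Longrightarrow> v \<in> U \<Longrightarrow> g v \<in> U"
  using Bij_imp_funcset by (auto simp: GL_def)

lemma GL_eqI:
  "g \<in> carrier (GL U) \<Longrightarrow> h \<in> extensional U \<Longrightarrow> (\<And>v. v \<in> U \<Longrightarrow> g v = h v) \<Longrightarrow> g = h"
  by (rule extensionalityI[of _ U]) (auto simp: GL_def Bij_def)

section \<open>Reflections of the Weyl group and roots of the cover\<close>

context hyperbolic_cover
begin

abbreviation V where "V \<equiv> cover_space r p"
abbreviation W where "W \<equiv> cover_weyl_group r p F"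
abbreviation T where "T \<equiv> cover_reflections r p F"
abbreviation s where "s \<equiv> reflection F V"

lemma group_W: "group W"
  unfolding cover_weyl_group_def by (rule group_weyl_group[OF subspace_cover_space])

sublocale W: group W by (rule group_W)

lemma W_GL: "w \<in> carrier W \<Longrightarrow> w \<in> carrier (GL V)"
  using group.carrier_subgroup_generated_subset[OF group_GL[OF subspace_cover_space]]
  unfolding cover_weyl_group_def weyl_group_def by blast

lemma W_mult: "g \<in> carrier W \<Longrightarrow> h \<in> carrier W \<Longrightarrow> v \<in> V \<Longrightarrow> (g \<otimes>\<^bsub>W\<^esub> h) v = g (h v)"
  using GL_mult[OF W_GL W_GL] by (simp add: cover_weyl_group_def weyl_group_def)

lemma W_one: "v \<in> V \<Longrightarrow> \<one>\<^bsub>W\<^esub> v = v"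
  using GL_one by (simp add: cover_weyl_group_def weyl_group_def)

lemma s_apply: "x \<in> cover_roots \<Longrightarrow> v \<in> V \<Longrightarrow> s x v = rfl F x v"
  by (simp add: reflection_def rfl_def cover_roots_norm)

lemma s_ext: "s x \<in> extensional V"
  by (simp add: reflection_def)

lemma s_uminus: "s (- x) = s x"
  by (simp add: reflection_def lin)

lemma s_GL:
  assumes "x \<in> cover_roots"
  shows "s x \<in> carrier (GL V)"
proof (rule reflection_in_GL[OF subspace_cover_space])
  show "linear (F x)" using bil unfolding bilinear_def by blast
qed (use assms cover_roots_norm cover_roots_space in auto)

lemma basis_W: "s ` cover_basis r p \<subseteq> carrier W"
proof -
  have "s ` cover_basis r p \<subseteq> carrier (GL V)"
    using s_GL basis_roots by (auto simp: cover_basis_def ext_basis_def)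
  then show ?thesis
    by (auto simp: cover_weyl_group_def weyl_group_def carrier_subgroup_generated intro: generate.incl)
qed

lemma s_invol:
  assumes "x \<in> cover_roots" "v \<in> V"
  shows "s x (s x v) = v"
  using assms GL_closed[OF s_GL[OF assms(1)] assms(2)] by (simp add: s_apply rfl_rfl cover_roots_norm)

lemma s_s_GL:
  assumes "x \<in> cover_roots"
  shows "s x \<otimes>\<^bsub>GL V\<^esub> s x = \<one>\<^bsub>GL V\<^esub>"
proof -
  interpret GL: group "GL V" by (rule group_GL[OF subspace_cover_space])
  show ?thesis
  proof (rule GL_eqI)
    show "\<one>\<^bsub>GL V\<^esub> \<in> extensional V" using GL.one_closed by (simp add: GL_def Bij_def)
  qed (use s_GL[OF assms] in \<open>simp_all add: GL_mult GL_one s_invol assms\<close>)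
qed

lemma inv_s: "x \<in> cover_roots \<Longrightarrow> s x \<in> carrier W \<Longrightarrow> inv\<^bsub>W\<^esub> (s x) = s x"
  using s_s_GL by (intro W.inv_equality) (simp_all add: cover_weyl_group_def weyl_group_def)

text \<open>The generators preserve roots and form, and they are involutions, so inverses reduce to
  them.\<close>

lemma W_roots:
  assumes "w \<in> carrier W"
  shows "(\<forall>x\<in>cover_roots. w x \<in> cover_roots) \<and> (\<forall>u\<in>V. \<forall>v\<in>V. F (w u) (w v) = F u v)"
proof -
  have refl: "(\<forall>x\<in>cover_roots. w x \<in> cover_roots) \<and> (\<forall>u\<in>V. \<forall>v\<in>V. F (w u) (w v) = F u v)"
    if w: "w \<in> s ` cover_basis r p" for w
  proof -
    obtain a where "a \<in> cover_roots" "w = s a" using w basis_roots by (auto simp: cover_basis_def ext_basis_def)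
    then show ?thesis by (simp add: s_apply cover_roots_space cover_roots_rfl rfl_iso cover_roots_norm)
  qed
  have "w \<in> generate (GL V) (carrier (GL V) \<inter> s ` cover_basis r p)"
    using assms by (simp add: cover_weyl_group_def weyl_group_def carrier_subgroup_generated)
  then show ?thesis
  proof (induction rule: generate.induct)
    case one
    then show ?case by (simp add: GL_one cover_roots_space)
  next
    case (incl h)
    then show ?case using refl by blast
  next
    case (inv h)
    then have h: "h \<in> carrier W" using basis_W by blast
    obtain a where a: "a \<in> cover_roots" "h = s a" using inv basis_roots by (auto simp: cover_basis_def ext_basis_def)
    have "inv\<^bsub>GL V\<^esub> h = h"
      using a s_s_GL s_GL by (intro group.inv_equality[OF group_GL[OF subspace_cover_space]]) auto
    then show ?case using refl inv by auto
  next
    case (eng g h)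
    have "generate (GL V) (carrier (GL V) \<inter> s ` cover_basis r p) \<subseteq> carrier (GL V)"
      by (rule group.generate_incl[OF group_GL[OF subspace_cover_space]]) blast
    then have "g \<in> carrier (GL V)" "h \<in> carrier (GL V)" using eng by auto
    then show ?case using eng by (simp add: GL_mult cover_roots_space GL_closed)
  qed
qed

lemma T_def': "T = (\<Union>w\<in>carrier W. (\<lambda>s. w \<otimes>\<^bsub>W\<^esub> s \<otimes>\<^bsub>W\<^esub> inv\<^bsub>W\<^esub> w) ` (s ` cover_basis r p))"
  by (simp add: cover_reflections_def weyl_reflections_def cover_weyl_group_def Let_def)

text \<open>Linearity and isometry of \<open>w\<close> carry the reflection formula for
  \<open>a\<close> to that for \<open>w a\<close>.\<close>

lemma conj_s:
  assumes w: "w \<in> carrier W" and a: "a \<in> cover_roots" "s a \<in> carrier W"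
  shows "w \<otimes>\<^bsub>W\<^esub> s a \<otimes>\<^bsub>W\<^esub> inv\<^bsub>W\<^esub> w = s (w a)"
proof (rule GL_eqI[OF W_GL s_ext])
  show "w \<otimes>\<^bsub>W\<^esub> s a \<otimes>\<^bsub>W\<^esub> inv\<^bsub>W\<^esub> w \<in> carrier W" using w a by simp
  fix v assume v: "v \<in> V"
  define u where "u = (inv\<^bsub>W\<^esub> w) v"
  have u: "u \<in> V" unfolding u_def by (rule GL_closed[OF W_GL v]) (use w in simp)
  have "w u = (w \<otimes>\<^bsub>W\<^esub> inv\<^bsub>W\<^esub> w) v" unfolding u_def by (rule W_mult[symmetric]) (use w v in auto)
  then have wu: "w u = v" using w v by (simp add: W_one)
  have aV: "a \<in> V" by (rule cover_roots_space[OF a(1)])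
  have lin_w: "w (x + y) = w x + w y" "w (c *\<^sub>R x) = c *\<^sub>R w x" if "x \<in> V" "y \<in> V" for x y c
    using W_GL[OF w] that by (auto simp: GL_def)
  have "(w \<otimes>\<^bsub>W\<^esub> s a \<otimes>\<^bsub>W\<^esub> inv\<^bsub>W\<^esub> w) v = w (s a u)"
    using w a v u by (simp add: W_mult u_def)
  also have "\<dots> = w (u + (- F a u) *\<^sub>R a)" using a u by (simp add: s_apply rfl_def)
  also have "\<dots> = w u + (- F a u) *\<^sub>R w a"
    unfolding lin_w(1)[OF u subspace_scale[OF subspace_cover_space aV]] lin_w(2)[OF aV aV] ..
  also have "F a u = F (w a) v" using W_roots[OF w] u aV wu by metis
  finally show "(w \<otimes>\<^bsub>W\<^esub> s a \<otimes>\<^bsub>W\<^esub> inv\<^bsub>W\<^esub> w) v = s (w a) v"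
    using wu v W_roots[OF w] a by (simp add: s_apply rfl_def)
qed

lemma T_roots: "t \<in> T \<Longrightarrow> \<exists>x\<in>cover_roots. t = s x"
proof -
  assume "t \<in> T"
  then obtain w \<nu> where w: "w \<in> carrier W" "\<nu> \<in> vertices r p"
      "t = w \<otimes>\<^bsub>W\<^esub> s (simple_root \<nu>, 0) \<otimes>\<^bsub>W\<^esub> inv\<^bsub>W\<^esub> w"
    by (auto simp: T_def' cover_basis_def ext_basis_def)
  have "s (simple_root \<nu>, 0) \<in> carrier W"
    using basis_W w(2) by (auto simp: cover_basis_def ext_basis_def)
  then have "t = s (w (simple_root \<nu>, 0))" using conj_s[OF w(1) basis_roots[OF w(2)]] w(3) by simp
  then show ?thesis using W_roots[OF w(1)] basis_roots[OF w(2)] by blast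
qed

lemma list_product_s:
  assumes "set xs \<subseteq> cover_roots" "set (map s xs) \<subseteq> carrier W" "v \<in> V"
  shows "list_product W (map s xs) v = rprod F xs v"
proof -
  have closed: "list_product W gs \<in> carrier W" if "set gs \<subseteq> carrier W" for gs
    using that by (induction gs) (simp_all add: list_product_def)
  show ?thesis
    using assms
  proof (induction xs)
    case Nil
    then show ?case by (simp add: list_product_def W_one)
  next
    case (Cons x xs)
    have c: "list_product W (map s xs) \<in> carrier W" using closed[of "map s xs"] Cons.prems by simp
    have "list_product W (map s (x # xs)) v = (s x \<otimes>\<^bsub>W\<^esub> list_product W (map s xs)) v"
      by (simp add: list_product_def)
    also have "\<dots> = s x (list_product W (map s xs) v)" using c Cons.prems by (intro W_mult) auto
    also have "\<dots> = rfl F x (list_product W (map s xs) v)"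
      using Cons.prems GL_closed[OF W_GL[OF c]] by (intro s_apply) auto
    finally show ?case using Cons by simp
  qed
qed

text \<open>A right move is \<open>\<sigma>\<^sub>i\<close>, a left move its inverse, and a sign
  change is invisible on reflections. Since \<open>\<sigma>\<^sub>i\<close> acts on positions
  \<open>i - 1\<close> and \<open>i\<close>, the index is the length of the prefix plus 1. New
  letters go to the front, as \<open>hurwitz_word\<close> folds from the right.\<close>

lemma hurw_hurwitz_word:
  assumes "hurw F xs ys" "set xs \<subseteq> cover_roots" "set (map s xs) \<subseteq> carrier W"
  shows "\<exists>u\<in>braid_words (length xs). hurwitz_word W u (map s xs) = map s ys"
  using assms(1)
proof (induction rule: rtranclp_induct)
  case base
  then show ?case by (intro bexI[of _ "[]"]) (simp_all add: hurwitz_word_def)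
next
  case (step ys zs)
  then obtain u where u: "u \<in> braid_words (length xs)" "hurwitz_word W u (map s xs) = map s ys" by blast
  have uminus: "- x \<in> cover_roots" if "x \<in> cover_roots" for x
    using cover_roots_rfl[OF that that] by (simp add: rfl_self cover_roots_norm that)
  have R: "set ys \<subseteq> cover_roots" using hurw_closed[OF step(1) assms(2)] cover_roots_rfl uminus by blast
  have C: "set (map s ys) \<subseteq> carrier W"
    using W.hurwitz_word_tuples[OF u(1) _ assms(3)] u(2) by simp
  have len: "length ys = length xs" using hurw_length[OF step(1)] .
  have sym_conj: "s x \<otimes>\<^bsub>W\<^esub> s y \<otimes>\<^bsub>W\<^esub> inv\<^bsub>W\<^esub> (s x) = s (rfl F x y)"
      "inv\<^bsub>W\<^esub> (s x) \<otimes>\<^bsub>W\<^esub> s y \<otimes>\<^bsub>W\<^esub> s x = s (rfl F x y)" if "x \<in> set ys" "y \<in> set ys" for x y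
  proof -
    have xy: "x \<in> cover_roots" "y \<in> cover_roots" "s x \<in> carrier W" "s y \<in> carrier W" using that R C by auto
    then show 1: "s x \<otimes>\<^bsub>W\<^esub> s y \<otimes>\<^bsub>W\<^esub> inv\<^bsub>W\<^esub> (s x) = s (rfl F x y)"
      using conj_s[of "s x" y] by (simp add: s_apply cover_roots_space)
    then show "inv\<^bsub>W\<^esub> (s x) \<otimes>\<^bsub>W\<^esub> s y \<otimes>\<^bsub>W\<^esub> s x = s (rfl F x y)" using xy by (simp add: inv_s)
  qed
  from step(2) show ?case
  proof cases
    case (right ps x y qs)
    have "hurwitz_letter W (Suc (length ps), True) (map s ys) = map s zs"
      using right sym_conj(2)[of y x] by (simp add: nth_append list_update_append)
    then show ?thesis using u right len
      by (intro bexI[of _ "(Suc (length ps), True) # u"]) (auto simp: hurwitz_word_def)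
  next
    case (left ps x y qs)
    have "hurwitz_letter W (Suc (length ps), False) (map s ys) = map s zs"
      using left sym_conj(1)[of x y] by (simp add: nth_append list_update_append)
    then show ?thesis using u left len
      by (intro bexI[of _ "(Suc (length ps), False) # u"]) (auto simp: hurwitz_word_def)
  next
    case (neg ps x qs)
    then show ?thesis using u by (auto simp: s_uminus)
  qed
qed

lemma hurwitz_transitive:
  assumes "coxeter_transformation r p F c"
  shows "transitive_action (braid_group (factorization_length W T c)) (reduced_factorizations W T c)
    (\<lambda>\<beta>. \<lambda>ts\<in>reduced_factorizations W T c. hurwitz W \<beta> ts)"
proof -
  note T = W.conjugates_closed[OF basis_W T_def']
  obtain as where as: "distinct as" "set as = ext_basis r p - {simple_root Hub, simple_root Hub_star}"
      "c = list_product W (map (\<lambda>\<alpha>. s (\<alpha>, 0)) (as @ [simple_root Hub, simple_root Hub_star]))"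
    using assms by (auto simp: coxeter_transformation_def)
  define "is" where "is = map (the_inv simple_root) as"
  have as_is: "as = map simple_root is"
    unfolding is_def map_map using as(2)
    by (intro map_idI[symmetric]) (auto simp: ext_basis_def the_inv_f_f[OF inj_simple_root])
  then have "simple_root ` set is = simple_root ` (vertices r p - {Hub, Hub_star})"
    using as(2) inj_simple_root by (auto simp: ext_basis_def dest: injD)
  then have "is": "distinct is" "set is = vertices r p - {Hub, Hub_star}"
    using as(1) as_is inj_simple_root by (simp_all add: distinct_map inj_image_eq_iff)
  define std where "std = map (\<lambda>\<nu>. (simple_root \<nu>, 0 :: real)) (is @ [Hub, Hub_star])"
  have c: "c = list_product W (map s std)"
    unfolding as(3) as_is std_def by (simp add: comp_def)
  have std_basis: "set std \<subseteq> cover_basis r p"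
    using "is" Hub_vertices by (auto simp: std_def cover_basis_def ext_basis_def)
  then have std_T: "set (map s std) \<subseteq> T" using T(3) by auto
  have std_roots: "set std \<subseteq> cover_roots" using std_basis basis_roots by (auto simp: cover_basis_def ext_basis_def)
  \<comment> \<open>An upper bound on the reduced length suffices: the defining factorization has
    \<open>length is + 2\<close> factors.\<close>
  have "factorization_length W T c \<le> length std"
    unfolding factorization_length_def using std_T c by (intro Least_le exI[of _ "map s std"]) simp
  then have short: "factorization_length W T c \<le> length is + 2" by (simp add: std_def)
  have sub: "set gs \<subseteq> carrier W" if "gs \<in> reduced_factorizations W T c" for gs
    using that T(1) by (auto simp: reduced_factorizations_def)
  show ?thesis
  proof (rule W.hurwitz_transitiveI)
    show "group_action (braid_group (factorization_length W T c)) (reduced_factorizations W T c)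
        (\<lambda>\<beta>. \<lambda>ts\<in>reduced_factorizations W T c. hurwitz W \<beta> ts)"
      by (rule W.hurwitz_action_reduced_factorizations) (use T in auto)
    fix gs assume gs: "gs \<in> reduced_factorizations W T c"
    then show "length gs = factorization_length W T c \<and> set gs \<subseteq> carrier W"
      using sub by (auto simp: reduced_factorizations_def)
    have "gs \<in> lists (s ` cover_roots)"
      using gs T_roots by (fastforce simp: reduced_factorizations_def lists_eq_set)
    then obtain xs where xs: "set xs \<subseteq> cover_roots" "gs = map s xs"
      unfolding lists_image by (auto simp: lists_eq_set)
    have len: "length xs = factorization_length W T c" using gs xs by (auto simp: reduced_factorizations_def)
    have "hurw F xs std"
      unfolding std_def
    proof (rule cover_normal_form[OF xs(1) _ "is"])
      show "length xs \<le> length is + 2" using len short by simp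
      fix v assume v: "v \<in> V"
      have "rprod F xs v = list_product W gs v" using list_product_s[OF xs(1) _ v] sub[OF gs] xs(2) by simp
      also have "\<dots> = list_product W (map s std) v" using gs c by (simp add: reduced_factorizations_def)
      also have "\<dots> = rprod F std v" using list_product_s[OF std_roots _ v] std_T T(1) by auto
      finally show "rprod F xs v = rprod F (map (\<lambda>\<nu>. (simple_root \<nu>, 0)) (is @ [Hub, Hub_star])) v"
        by (simp add: std_def)
    qed
    then show "\<exists>u\<in>braid_words (factorization_length W T c). hurwitz_word W u gs = map s std"
      using hurw_hurwitz_word[OF _ xs(1)] sub[OF gs] xs(2) len by auto
  qed
qed

end

theorem theorem1p2:
  fixes r :: nat and p :: "nat \<Rightarrow> nat"
    and F :: "cover_vector \<Rightarrow> cover_vector \<Rightarrow> real"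
    and c :: "cover_vector \<Rightarrow> cover_vector"
  assumes "\<And>i. 1 \<le> i \<Longrightarrow> i \<le> r \<Longrightarrow> 1 \<le> p i"
    and "domestic r p \<or> wild r p \<or> tubular r p"
    and "cover_form r p F"
    and "coxeter_transformation r p F c"
  shows "transitive_action
           (braid_group (factorization_length (cover_weyl_group r p F) (cover_reflections r p F) c))
           (reduced_factorizations (cover_weyl_group r p F) (cover_reflections r p F) c)
           (\<lambda>\<beta>. \<lambda>ts \<in> reduced_factorizations (cover_weyl_group r p F) (cover_reflections r p F) c.
              hurwitz (cover_weyl_group r p F) \<beta> ts)"
proof -
  interpret hyperbolic_cover r p F
    using assms(1-3) by unfold_locales
  show ?thesis using assms(4) by (rule hurwitz_transitive)
qed

end
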